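(* Let $\mathbf{k}$ be an algebraically closed field of characteristic $p>0$. Let $q=p^e$, $q'=p^{e-1}$ for some integer $e\ge1$, let $q'\leq r\leq q$, and let $d\ge0$. There are $T$-equivariant isomorphisms of sheaves on $\mathbf{P}^1$ as follows: \begin{enumerate} \item If $d<r$ then $\mathcal{F}^d_r = H_{d,0}\otimes\mathcal{O}_{\mathbf{P}^1}$. \item If $d\geq q+r-1$ then $\mathcal{F}^d_r = L_{q,q}\otimes\mathcal{F}^{d-q}_r(-q)$. \item If $q-1\leq d\leq q+r-1$ then $\mathcal{F}^d_r = H_{d,q}(-q)\ \oplus\ H_{q-1,d-r+1}(r-q)$. \item If $r\leq d\leq q-1$, and if $1\leq a<p$ is such that $aq'\leq r<(a+1)q'$, then \[\mathcal{F}^d_r = F^{q'}(H_{a,0})\otimes\mathcal{F}^{d-aq'}_{r-aq'}\ \oplus\ F^{q'}(H_{a-1,0})\otimes\mathcal{F}^{d-r+q'}_{(a+1)q'-r}(r-aq').\] \end{enumerate}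
   Context: Let $U=\mathbf{k}^2$ and $\mathbf{P}^1=\mathbb{P}U=\operatorname{Proj}(\operatorname{Sym}U)$, with tautological $\mathrm{GL}(U)$-equivariant sequence $0\to\mathcal{R}\to U\otimes\mathcal{O}_{\mathbf{P}^1}\to\mathcal{O}_{\mathbf{P}^1}(1)\to0$, which fixes the linearization of $\mathcal{O}_{\mathbf{P}^1}(1)$. $D^mU$ is the $m$-th divided power (the $\mathfrak{S}_m$-invariants of $U^{\otimes m}$), $D^mU=0$ for $m<0$. The tautological sequence induces, for each $m$, a surjection $\Delta_m:D^mU\otimes\mathcal{O}_{\mathbf{P}^1}\to D^{m-1}U\otimes\mathcal{O}_{\mathbf{P}^1}(1)$ (comultiplication $D^mU\to D^{m-1}U\otimes U$ followed by $U\otimes\mathcal{O}\to\mathcal{O}(1)$). For $r\ge0$ define $\mathcal{F}^d_r$ as the kernel of the $r$-fold composite $D^dU\otimes\mathcal{O}_{\mathbf{P}^1}\to D^{d-r}U\otimes\mathcal{O}_{\mathbf{P}^1}(r)$ of (twists of) these maps; thus $\mathcal{F}^d_0=0$ and $\mathcal{F}^d_r=D^dU\otimes\mathcal{O}_{\mathbf{P}^1}$ for $d<r$. $T=\mathbb{G}_m\times\mathbb{G}_m\subset\mathrm{GL}(U)$ is the torus acting coordinate-wise. $L_{u,v}$ is the $1$-dimensional $T$-representation on which $(t_1,t_2)$ acts by $t_1^ut_2^v$. For $a\ge b\ge0$, $H_{a,b}=\bigoplus_{i=b}^aL_{a+b-i,i}$, and $H_{a,b}=0$ if $a<b$. $F^{q'}$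 is the Frobenius twist on $T$-representations: $F^{q'}(L_{u,v})=L_{q'u,q'v}$, extended additively. For a $T$-representation $W$, $W(i)$ means $W\otimes\mathcal{O}_{\mathbf{P}^1}(i)$. *)

theory Defs
  imports "HOL-Computational_Algebra.Polynomial" "HOL-Computational_Algebra.Fraction_Field"
    "HOL-Combinatorics.Permutations"
begin

section \<open>The projective line as Proj of a polynomial ring\<close>

text \<open>
  \<open>Sym U = k[x,y]\<close> is rendered as \<^typ>\<open>'k poly poly\<close>: the inner variable is \<open>x\<close> (the image of the
  first basis vector of \<open>U = k\<^sup>2\<close>), the outer variable is \<open>y\<close>. So \<open>coeff (coeff f j) i\<close> is the
  coefficient of \<open>x\<^sup>i y\<^sup>j\<close>. Its field of fractions is \<^typ>\<open>'k poly poly fract\<close>.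
\<close>

definition xvar :: "'k::field poly poly" where
  "xvar = [:[:0, 1:]:]"

definition yvar :: "'k::field poly poly" where
  "yvar = [:0, 1:]"

definition homog :: "int \<Rightarrow> 'k::field poly poly \<Rightarrow> bool" where
  "homog n f \<longleftrightarrow> (\<forall>i j. coeff (coeff f j) i \<noteq> 0 \<longrightarrow> int i + int j = n)"

definition homog_part :: "nat \<Rightarrow> 'k::field poly poly \<Rightarrow> 'k poly poly" where
  "homog_part n f = (\<Sum>j\<le>n. monom (monom (coeff (coeff f j) (n - j)) (n - j)) j)"

definition homog_prime :: "'k::field poly poly set \<Rightarrow> bool" where
  "homog_prime P \<longleftrightarrow>
     0 \<in> P \<and> (\<forall>f\<in>P. \<forall>g\<in>P. f + g \<in> P) \<and> (\<forall>f. \<forall>g\<in>P. f * g \<in> P) \<and>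
     1 \<notin> P \<and> (\<forall>f g. f * g \<in> P \<longrightarrow> f \<in> P \<or> g \<in> P) \<and>
     (\<forall>f\<in>P. \<forall>n. homog_part n f \<in> P)"

definition Proj1 :: "'k::field poly poly set set" where
  "Proj1 = {P. homog_prime P \<and> \<not> {f. homog_part 0 f = 0} \<subseteq> P}"

definition zariski_open :: "'k::field poly poly set set \<Rightarrow> bool" where
  "zariski_open V \<longleftrightarrow>
     (\<exists>E. (\<forall>f\<in>E. \<exists>n. homog n f) \<and> V = {P \<in> Proj1. \<not> E \<subseteq> P})"

text \<open>
  The sections of \<open>O(n)\<close> over \<open>V\<close>: functions assigning to \<open>P \<in> V\<close> an element of the degree \<open>n\<close> part
  of the homogeneous localization at \<open>P\<close> (inside the field of fractions, as \<open>k[x,y]\<close> is a domain)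
  which are locally a single fraction. As for all sections below, values outside \<open>V\<close> are normalized
  to \<open>0\<close>.
\<close>

definition twist_sections ::
    "int \<Rightarrow> 'k::field poly poly set set \<Rightarrow> ('k poly poly set \<Rightarrow> 'k poly poly fract) set" where
  "twist_sections n V =
     {s. (\<forall>P. P \<notin> V \<longrightarrow> s P = 0) \<and>
         (\<forall>P\<in>V. \<exists>W. zariski_open W \<and> P \<in> W \<and> W \<subseteq> V \<and>
            (\<exists>a b m. homog (m + n) a \<and> homog m b \<and> (\<forall>Q\<in>W. b \<notin> Q \<and> s Q = Fract a b)))}"


section \<open>The torus and its representations\<close>

text \<open>
  A \<open>k\<close>-point \<open>t = (t\<^sub>1, t\<^sub>2)\<close> of \<open>T\<close> (both components nonzero) acts on \<open>k[x,y] = Sym U\<close> by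
  \<open>x \<mapsto> t\<^sub>1 x\<close>, \<open>y \<mapsto> t\<^sub>2 y\<close>.
\<close>

definition tsym :: "'k \<times> 'k \<Rightarrow> 'k::field poly poly \<Rightarrow> 'k poly poly" where
  "tsym t f = pcompose (map_poly (\<lambda>g. pcompose g [:0, fst t:]) f) [:0, [:snd t:]:]"

lemma coeff_tsym: "coeff (coeff (tsym t f) j) i = fst t ^ i * snd t ^ j * coeff (coeff f j) i"
proof -
  have pow: "[:c:] ^ n = [:c ^ n:]" for c :: 'a and n
    by (induction n) simp_all
  show ?thesis
    unfolding tsym_def
    by (simp add: coeff_pcompose_linear coeff_map_poly pow mult_ac)
qed

lemma tsym_mult: "tsym t (f * g) = tsym t f * tsym t g"
proof (intro poly_eqI)
  fix j i
  have split: "c ^ n = c ^ m * c ^ (n - m)" if "m \<le> n" for c :: 'a and m n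
    using that by (simp flip: power_add)
  have *: "fst t ^ i * snd t ^ j * (coeff (coeff f j') i' * coeff (coeff g (j - j')) (i - i')) =
      (fst t ^ i' * snd t ^ j' * coeff (coeff f j') i') *
      (fst t ^ (i - i') * snd t ^ (j - j') * coeff (coeff g (j - j')) (i - i'))"
    if "j' \<in> {..j}" "i' \<in> {..i}" for i' j'
    using split[of i' i "fst t"] split[of j' j "snd t"] that by (simp add: mult_ac)
  have "coeff (coeff (tsym t (f * g)) j) i = (\<Sum>j'\<le>j. \<Sum>i'\<le>i.
      fst t ^ i * snd t ^ j * (coeff (coeff f j') i' * coeff (coeff g (j - j')) (i - i')))"
    by (simp add: coeff_tsym coeff_mult coeff_sum sum_distrib_left)
  also have "\<dots> = (\<Sum>j'\<le>j. \<Sum>i'\<le>i. (fst t ^ i' * snd t ^ j' * coeff (coeff f j') i') *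
      (fst t ^ (i - i') * snd t ^ (j - j') * coeff (coeff g (j - j')) (i - i')))"
    by (intro sum.cong refl *)
  also have "\<dots> = coeff (coeff (tsym t f * tsym t g) j) i"
    by (simp add: coeff_tsym coeff_mult coeff_sum)
  finally show "coeff (coeff (tsym t (f * g)) j) i = coeff (coeff (tsym t f * tsym t g) j) i" .
qed

lemma tsym_eq_0_iff: "fst t \<noteq> 0 \<Longrightarrow> snd t \<noteq> 0 \<Longrightarrow> tsym t f = 0 \<longleftrightarrow> f = 0"
  by (auto simp: poly_eq_iff coeff_tsym)

definition tfrac :: "'k \<times> 'k \<Rightarrow> 'k::field poly poly fract \<Rightarrow> 'k poly poly fract" where
  "tfrac t z = (THE z'. \<exists>a b. b \<noteq> 0 \<and> z = Fract a b \<and> z' = Fract (tsym t a) (tsym t b))"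

lemma tfrac_Fract:
  assumes "fst t \<noteq> 0" "snd t \<noteq> 0" "b \<noteq> 0"
  shows "tfrac t (Fract a b) = Fract (tsym t a) (tsym t b)"
  unfolding tfrac_def
proof (rule the_equality)
  fix z' assume "\<exists>a' b'. b' \<noteq> 0 \<and> Fract a b = Fract a' b' \<and> z' = Fract (tsym t a') (tsym t b')"
  then obtain a' b' where *: "b' \<noteq> 0" "Fract a b = Fract a' b'"
      "z' = Fract (tsym t a') (tsym t b')" by blast
  from * assms have "a * b' = a' * b" by (simp add: eq_fract)
  hence "tsym t a * tsym t b' = tsym t a' * tsym t b" by (metis tsym_mult)
  with * assms show "z' = Fract (tsym t a) (tsym t b)" by (simp add: eq_fract tsym_eq_0_iff)
qed (use assms in blast)

definition scalar :: "'k::field \<Rightarrow> 'k poly poly fract" where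
  "scalar c = Fract [:[:c:]:] 1"

definition character :: "int \<times> int \<Rightarrow> 'k \<times> 'k \<Rightarrow> 'k::field" where
  "character w t = fst t powi fst w * snd t powi snd w"

text \<open>
  A \<open>T\<close>-representation is a subspace of \<open>k\<^sup>I\<close> stable under the diagonal action in which \<open>T\<close> acts on the
  \<open>i\<close>-th coordinate through the character of weight \<open>rep_wt i\<close>.
\<close>

record ('i, 'k) trep =
  rep_space :: "('i \<Rightarrow> 'k) set"
  rep_wt :: "'i \<Rightarrow> int \<times> int"

text \<open>The direct sum over \<open>i \<in> I\<close> of the one-dimensional representations of weight \<open>w i\<close>.\<close>

definition weight_rep :: "'i set \<Rightarrow> ('i \<Rightarrow> int \<times> int) \<Rightarrow> ('i, 'k::field) trep" where
  "weight_rep I w = \<lparr>rep_space = {f. \<forall>i. i \<notin> I \<longrightarrow> f i = 0}, rep_wt = w\<rparr>"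

definition L :: "int \<Rightarrow> int \<Rightarrow> (unit, 'k::field) trep" where
  "L u v = weight_rep UNIV (\<lambda>_. (u, v))"

definition H :: "nat \<Rightarrow> nat \<Rightarrow> (nat, 'k::field) trep" where
  "H a b = weight_rep {b..a} (\<lambda>i. (int a + int b - int i, int i))"

definition frobenius_twist :: "nat \<Rightarrow> ('i, 'k) trep \<Rightarrow> ('i, 'k) trep" where
  "frobenius_twist q W =
     W\<lparr>rep_wt := (\<lambda>i. (int q * fst (rep_wt W i), int q * snd (rep_wt W i)))\<rparr>"

text \<open>
  The \<open>m\<close>-fold tensor power of \<open>U\<close> has as basis the words of length \<open>m\<close> in the two basis vectors of
  \<open>U\<close>; the divided power \<open>Dpow m\<close> is its space of invariants under permuting the tensor factors.
  It vanishes for \<open>m < 0\<close>, when there are no words.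
\<close>

datatype basis = E1 | E2

definition Dpow :: "int \<Rightarrow> (basis list, 'k::field) trep" where
  "Dpow m =
     \<lparr>rep_space = {f. (\<forall>w. int (length w) \<noteq> m \<longrightarrow> f w = 0) \<and>
                      (\<forall>w \<pi>. \<pi> permutes {..<length w} \<longrightarrow> f (permute_list \<pi> w) = f w)},
      rep_wt = (\<lambda>w. (int (count_list w E1), int (count_list w E2)))\<rparr>"


section \<open>Equivariant sheaves\<close>

text \<open>
  A \<open>T\<close>-equivariant sheaf of \<open>O\<close>-modules, realized inside the constant sheaf with values in \<open>K\<^sup>I\<close>,
  where \<open>K\<close> is the field of fractions of \<open>k[x,y]\<close>. The linearization is the one
  induced by the action of \<open>T\<close> on \<open>K\<close> and the weights \<open>wt\<close> on the coordinates.
\<close>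

record (overloaded) ('i, 'k) esheaf =
  sect :: "'k poly poly set set \<Rightarrow> ('k poly poly set \<Rightarrow> 'i \<Rightarrow> 'k poly poly fract) set"
  wt :: "'i \<Rightarrow> int \<times> int"

text \<open>The action of \<open>t\<close>, which takes sections over \<open>V\<close> to sections over the translate \<open>t V\<close>.\<close>

definition translate :: "'k \<times> 'k \<Rightarrow> 'k::field poly poly set set \<Rightarrow> 'k poly poly set set" where
  "translate t V = (\<lambda>P. tsym t ` P) ` V"

definition act :: "('i, 'k) esheaf \<Rightarrow> 'k \<times> 'k \<Rightarrow>
    ('k poly poly set \<Rightarrow> 'i \<Rightarrow> 'k::field poly poly fract) \<Rightarrow>
    ('k poly poly set \<Rightarrow> 'i \<Rightarrow> 'k poly poly fract)" where
  "act M t s = (\<lambda>Q i. scalar (character (wt M i) t) * tfrac t (s (tsym t -` Q) i))"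

definition restrict_section :: "'k::field poly poly set set \<Rightarrow>
    ('k poly poly set \<Rightarrow> 'i \<Rightarrow> 'k poly poly fract) \<Rightarrow>
    ('k poly poly set \<Rightarrow> 'i \<Rightarrow> 'k poly poly fract)" where
  "restrict_section W s = (\<lambda>P i. if P \<in> W then s P i else 0)"

definition equivariant_iso ::
    "(('k poly poly set set) \<Rightarrow> ('k poly poly set \<Rightarrow> 'i \<Rightarrow> 'k poly poly fract) \<Rightarrow>
        ('k poly poly set \<Rightarrow> 'j \<Rightarrow> 'k poly poly fract)) \<Rightarrow>
     ('i, 'k::field) esheaf \<Rightarrow> ('j, 'k) esheaf \<Rightarrow> bool" where
  "equivariant_iso \<phi> M N \<longleftrightarrow>
     (\<forall>V. zariski_open V \<longrightarrow>
        bij_betw (\<phi> V) (sect M V) (sect N V) \<and>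
        (\<forall>s\<in>sect M V. \<forall>s'\<in>sect M V.
           \<phi> V (\<lambda>P i. s P i + s' P i) = (\<lambda>P j. \<phi> V s P j + \<phi> V s' P j)) \<and>
        (\<forall>g\<in>twist_sections 0 V. \<forall>s\<in>sect M V.
           \<phi> V (\<lambda>P i. g P * s P i) = (\<lambda>P j. g P * \<phi> V s P j)) \<and>
        (\<forall>W s. zariski_open W \<and> W \<subseteq> V \<and> s \<in> sect M V \<longrightarrow>
           \<phi> W (restrict_section W s) = restrict_section W (\<phi> V s)) \<and>
        (\<forall>t s. fst t \<noteq> 0 \<and> snd t \<noteq> 0 \<and> s \<in> sect M V \<longrightarrow>
           \<phi> (translate t V) (act M t s) = act N t (\<phi> V s)))"

definition isomorphic :: "('i, 'k::field) esheaf \<Rightarrow> ('j, 'k) esheaf \<Rightarrow> bool"  (infix \<open>\<simeq>\<^sub>T\<close> 50) where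
  "M \<simeq>\<^sub>T N \<longleftrightarrow> (\<exists>\<phi>. equivariant_iso \<phi> M N)"

definition Osheaf :: "int \<Rightarrow> (unit, 'k::field) esheaf" where
  "Osheaf n = \<lparr>sect = (\<lambda>V. (\<lambda>g P i. g P) ` twist_sections n V), wt = (\<lambda>_. (0, 0))\<rparr>"

text \<open>
  \<open>W \<otimes> M\<close> over \<open>k\<close>, for a finite-dimensional \<open>W\<close>: finite sums of pure tensors. No sheafification is
  needed, and the tensor product over a field embeds into the functions on pairs of indices.
\<close>

definition rep_tensor :: "('i, 'k::field) trep \<Rightarrow> ('j, 'k) esheaf \<Rightarrow> ('i \<times> 'j, 'k) esheaf"
    (infixr \<open>\<otimes>\<^sub>k\<close> 75) where
  "W \<otimes>\<^sub>k M =
     \<lparr>sect = (\<lambda>V. {s. \<exists>(N::nat) w m. (\<forall>l<N. w l \<in> rep_space W \<and> m l \<in> sect M V) \<and>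
                       s = (\<lambda>P (i, j). \<Sum>l<N. scalar (w l i) * m l P j)}),
      wt = (\<lambda>(i, j). (fst (rep_wt W i) + fst (wt M j), snd (rep_wt W i) + snd (wt M j)))\<rparr>"

text \<open>
  The twist \<open>M(n) = M \<otimes> O(n)\<close> over \<open>O\<close>: the sections that are locally finite sums of products of a
  section of \<open>M\<close> and one of \<open>O(n)\<close>. Since \<open>O(n)\<close> is invertible and a subsheaf of the constant sheaf
  \<open>K\<close>, the canonical map from the tensor product into \<open>K\<^sup>I\<close> is injective, with this image.
\<close>

definition twist :: "('i, 'k::field) esheaf \<Rightarrow> int \<Rightarrow> ('i, 'k) esheaf" where
  "twist M n =
     \<lparr>sect = (\<lambda>V. {s. (\<forall>P. P \<notin> V \<longrightarrow> s P = (\<lambda>_. 0)) \<and>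
        (\<forall>P\<in>V. \<exists>W. zariski_open W \<and> P \<in> W \<and> W \<subseteq> V \<and>
           (\<exists>(N::nat) m g. (\<forall>l<N. m l \<in> sect M W \<and> g l \<in> twist_sections n W) \<and>
              (\<forall>Q\<in>W. s Q = (\<lambda>i. \<Sum>l<N. m l Q i * g l Q))))}),
      wt = wt M\<rparr>"

definition dsum :: "('i, 'k::field) esheaf \<Rightarrow> ('j, 'k) esheaf \<Rightarrow> ('i + 'j, 'k) esheaf"
    (infixr \<open>\<oplus>\<^sub>T\<close> 65) where
  "M \<oplus>\<^sub>T N =
     \<lparr>sect = (\<lambda>V. {s. (\<lambda>P i. s P (Inl i)) \<in> sect M V \<and> (\<lambda>P j. s P (Inr j)) \<in> sect N V}),
      wt = case_sum (wt M) (wt N)\<rparr>"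

text \<open>
  The map \<open>Dpow m \<otimes> O(n) \<rightarrow> Dpow (m - 1) \<otimes> O(n + 1)\<close>: on symmetric tensors the comultiplication is the
  inclusion into \<open>Dpow (m - 1) \<otimes> U\<close>, splitting off the last tensor factor, and \<open>U \<otimes> O \<rightarrow> O(1)\<close> sends the
  basis vectors of \<open>U\<close> to \<open>x\<close> and \<open>y\<close>. The formula depends on neither \<open>m\<close> nor \<open>n\<close>.
\<close>

definition Delta :: "('k poly poly set \<Rightarrow> basis list \<times> unit \<Rightarrow> 'k::field poly poly fract) \<Rightarrow>
    ('k poly poly set \<Rightarrow> basis list \<times> unit \<Rightarrow> 'k poly poly fract)" where
  "Delta s = (\<lambda>P (w, u). Fract xvar 1 * s P (w @ [E1], u) + Fract yvar 1 * s P (w @ [E2], u))"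

lemma twist_sections_mult_homog:
  assumes g: "g \<in> twist_sections n V" and h: "homog k h"
  shows "(\<lambda>P. Fract h 1 * g P) \<in> twist_sections (n + k) V"
  unfolding twist_sections_def
proof (intro CollectI conjI ballI allI impI)
  fix P assume "P \<notin> V"
  with g show "Fract h 1 * g P = 0" by (simp add: twist_sections_def)
next
  fix P assume "P \<in> V"
  with g obtain W a b m where W: "zariski_open W" "P \<in> W" "W \<subseteq> V" "homog (m + n) a" "homog m b"
      "\<forall>Q\<in>W. b \<notin> Q \<and> g Q = Fract a b"
    unfolding twist_sections_def by blast
  have "homog (m + (n + k)) (h * a)"
    unfolding homog_def
  proof (intro allI impI)
    fix i j assume "coeff (coeff (h * a) j) i \<noteq> 0"
    hence "(\<Sum>j'\<le>j. \<Sum>i'\<le>i. coeff (coeff h j') i' * coeff (coeff a (j - j')) (i - i')) \<noteq> 0"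
      by (simp add: coeff_mult coeff_sum)
    then obtain i' j' where ij: "i' \<le> i" "j' \<le> j"
        "coeff (coeff h j') i' \<noteq> 0" "coeff (coeff a (j - j')) (i - i') \<noteq> 0"
      by (metis (no_types, lifting) atMost_iff mult_eq_0_iff sum.neutral)
    have "int i' + int j' = k" "int (i - i') + int (j - j') = m + n"
      using ij(3,4) h W(4) unfolding homog_def by blast+
    with ij(1,2) show "int i + int j = m + (n + k)" by linarith
  qed
  moreover have "\<forall>Q\<in>W. b \<notin> Q \<and> Fract h 1 * g Q = Fract (h * a) b"
    using W(6) by simp
  ultimately show "\<exists>W. zariski_open W \<and> P \<in> W \<and> W \<subseteq> V \<and>
      (\<exists>a b m. homog (m + (n + k)) a \<and> homog m b \<and> (\<forall>Q\<in>W. b \<notin> Q \<and> Fract h 1 * g Q = Fract a b))"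
    using W(1,2,3,5) by blast
qed

lemma Dpow_last:
  assumes f: "f \<in> rep_space (Dpow m)"
  shows "(\<lambda>w. f (w @ [c])) \<in> rep_space (Dpow (m - 1))"
proof -
  have "f (permute_list \<pi> w @ [c]) = f (w @ [c])" if \<pi>: "\<pi> permutes {..<length w}" for w \<pi>
  proof -
    have "\<pi> permutes {..<length (w @ [c])}"
      by (rule permutes_subset[OF \<pi>]) auto
    moreover have "permute_list \<pi> (w @ [c]) = permute_list \<pi> w @ [c]"
    proof (rule nth_equalityI)
      fix i assume i: "i < length (permute_list \<pi> (w @ [c]))"
      have "\<pi> (length w) = length w" using \<pi> by (simp add: permutes_not_in)
      moreover have "\<pi> i < length w" if "i < length w"
        using permutes_in_image[OF \<pi>] that by simp
      ultimately show "permute_list \<pi> (w @ [c]) ! i = (permute_list \<pi> w @ [c]) ! i"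
        using i by (cases "i < length w") (auto simp: permute_list_def nth_append)
    qed simp
    moreover have "f (permute_list \<pi>' v) = f v" if "\<pi>' permutes {..<length v}" for v \<pi>'
      using f that by (simp add: Dpow_def)
    ultimately show ?thesis
      by metis
  qed
  moreover have "f (w @ [c]) = 0" if "int (length w) \<noteq> m - 1" for w
    using f that by (simp add: Dpow_def)
  ultimately show ?thesis
    by (simp add: Dpow_def)
qed

lemma Delta_sect:
  assumes "s \<in> sect (Dpow m \<otimes>\<^sub>k Osheaf n) V"
  shows "Delta s \<in> sect (Dpow (m - 1) \<otimes>\<^sub>k Osheaf (n + 1)) V"
proof -
  obtain N :: nat and w g where
      wg: "\<And>l. l < N \<Longrightarrow> w l \<in> rep_space (Dpow m) \<and> g l \<in> sect (Osheaf n) V"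
      and s: "s = (\<lambda>P (i, j). \<Sum>l<N. scalar (w l i) * g l P j)"
    using assms by (auto simp: rep_tensor_def)
  define w' where "w' l = (\<lambda>v. w (l div 2) (v @ [if even l then E1 else E2]))" for l
  define g' where
    "g' l = (\<lambda>P j. Fract (if even l then xvar else yvar) 1 * g (l div 2) P j)" for l
  have hom: "homog 1 (if b then xvar else yvar :: 'a poly poly)" for b
    by (auto simp: homog_def xvar_def yvar_def coeff_pCons split: nat.splits if_splits)
  have "w' l \<in> rep_space (Dpow (m - 1)) \<and> g' l \<in> sect (Osheaf (n + 1)) V" if "l < 2 * N" for l
  proof -
    have l: "l div 2 < N" using that by simp
    from wg[OF l] obtain g0 where "g0 \<in> twist_sections n V" "g (l div 2) = (\<lambda>P i. g0 P)"
      by (auto simp: Osheaf_def)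
    with twist_sections_mult_homog[OF this(1) hom[of "even l"]] show ?thesis
      using wg[OF l] by (auto simp: w'_def g'_def Osheaf_def intro!: Dpow_last)
  qed
  moreover have "Delta s = (\<lambda>P (i, j). \<Sum>l<2*N. scalar (w' l i) * g' l P j)"
  proof -
    have split: "(\<Sum>l<2*N. h l) = (\<Sum>l<N. h (2*l) + h (2*l+1))" for h :: "nat \<Rightarrow> 'a poly poly fract"
      by (induction N) (simp_all add: algebra_simps)
    show ?thesis
      unfolding split
      by (simp add: Delta_def s w'_def g'_def sum_distrib_left sum.distrib mult_ac fun_eq_iff)
  qed
  ultimately show ?thesis
    unfolding rep_tensor_def trep.simps esheaf.simps mem_Collect_eq by blast
qed

lemma Delta_funpow_sect:
  "s \<in> sect (Dpow m \<otimes>\<^sub>k Osheaf n) V \<Longrightarrow>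
   (Delta ^^ r) s \<in> sect (Dpow (m - int r) \<otimes>\<^sub>k Osheaf (n + int r)) V"
proof (induction r)
  case (Suc r)
  from Delta_sect[OF Suc.IH[OF Suc.prems]] show ?case by (simp add: algebra_simps)
qed simp

definition Fsheaf :: "nat \<Rightarrow> nat \<Rightarrow> (basis list \<times> unit, 'k::field) esheaf" where
  "Fsheaf d r = (Dpow (int d) \<otimes>\<^sub>k Osheaf 0)
     \<lparr>sect := (\<lambda>V. {s \<in> sect (Dpow (int d) \<otimes>\<^sub>k Osheaf 0) V. (Delta ^^ r) s = (\<lambda>_ _. 0)})\<rparr>"

end

theory Submission
  imports Defs "HOL-Computational_Algebra.Primes"
begin

text \<open>
  A symmetric tensor of degree \<open>d\<close> is the sequence \<open>b\<^sub>0, \<dots>, b\<^sub>d\<close> of its values on the words with \<open>j\<close> letters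
  \<open>E2\<close>, and it lies in the kernel of \<open>\<Delta>\<^sup>r\<close> iff it satisfies the recursion \<open>(x + y S)\<^sup>r b = 0\<close> with the shift
  \<open>S\<close>. Substituting \<open>b\<^sub>j = (-1)\<^sup>j x\<^sup>j\<^sup>-\<^sup>A y\<^sup>B\<^sup>-\<^sup>j g\<^sub>j\<close> reduces this to scalar sequences \<open>g\<close> killed by \<open>(S - 1)\<^sup>r\<close>,
  which are \<open>q\<close>-periodic for \<open>r \<le> q = p\<^sup>e\<close>. Such a \<open>g\<close> whose first and last nonzero positions in \<open>{0..d}\<close>
  are \<open>A\<close> and \<open>B\<close> spans a copy of \<open>O(A - B)\<close> of weight \<open>(d - A, B)\<close>. If for a family of such \<open>g\<close> the
  positions \<open>A\<close> are exactly \<open>0, \<dots>, r - 1\<close> and the \<open>B\<close> are distinct, then \<open>\<F>\<close> is the direct sum of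
  these line bundles: coefficients are solved for from the front where \<open>y \<noteq> 0\<close> and from the back where
  \<open>x \<noteq> 0\<close>. So every isomorphism amounts to exhibiting, for the pairs \<open>(A, B)\<close> that occur on the right hand
  side, one sequence each. For the sheaves occurring on the right, such families exist by the Bruhat
  decomposition of a pair of flags; in the last case the new sequences are polynomials in the
  leading base \<open>q'\<close> digit of the position, with coefficients depending on the residue modulo \<open>q'\<close>.
\<close>

section \<open>Sequences killed by a power of the difference operator\<close>

text \<open>The line bundle is O(A - B) because the substitution turns the value at position j into
  a constant times x^(j-A) y^(B-j), a monomial of degree B - A. The sheaves on the right of the last
  case have no explicit splitting, so their end positions B stay unknown; it is enough to transport
  each unknown pair (A, B) to a pair for d and r. Frobenius makes this possible: (S - 1)^q' = S^q' -
  1 is the first difference in the leading digit, so a polynomial in the digit of degree a = r div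
  q' whose leading coefficient is killed by (S - 1)^\<rho>, \<rho> = r - a q', is killed by (S -
  1)^r. Spending all a roots of such a polynomial on cutting off digits at the two ends gives the
  first summand; spending a - 1 of them and keeping an affine factor gives the second. The bound d <
  q = p q' keeps all digits below p, so that the cut-off factors vanish nowhere else. The two
  families never share a B, since (d - B) mod q' is below \<rho> for the first and at least \<rho>
  for the second.\<close>

definition fdiff :: "(nat \<Rightarrow> 'a::comm_ring_1) \<Rightarrow> nat \<Rightarrow> 'a" where
  "fdiff g = (\<lambda>i. g (Suc i) - g i)"

lemma fdiff_0: "(fdiff ^^ 0) g i = g i"
  by simp

lemma fdiff_Suc: "(fdiff ^^ Suc r) g i = (fdiff ^^ r) g (Suc i) - (fdiff ^^ r) g i"
  unfolding funpow.simps o_apply by (subst fdiff_def) (rule refl)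

lemmas fdiff_simps = fdiff_0 fdiff_Suc

lemma fdiff_cmult: "(fdiff ^^ r) (\<lambda>i. c * g i) i = c * (fdiff ^^ r) g i"
  by (induction r arbitrary: i) (simp_all add: fdiff_simps algebra_simps del: funpow.simps)

lemma fdiff_minus: "(fdiff ^^ r) (\<lambda>i. f i - g i) i = (fdiff ^^ r) f i - (fdiff ^^ r) g i"
  by (induction r arbitrary: i) (simp_all add: fdiff_simps del: funpow.simps)

lemma fdiff_shift: "(fdiff ^^ r) (\<lambda>i. g (i + s)) i = (fdiff ^^ r) g (i + s)"
  by (induction r arbitrary: i) (simp_all add: fdiff_simps del: funpow.simps)

lemma fdiff_fdiff: "(fdiff ^^ r) ((fdiff ^^ s) g) = (fdiff ^^ (r + s)) g"
  by (simp add: funpow_add)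

lemma fdiff_cong:
  assumes "\<And>k. k \<le> r \<Longrightarrow> f (i + k) = g (i' + k)"
  shows "(fdiff ^^ r) f i = (fdiff ^^ r) g i'"
  using assms
proof (induction r arbitrary: i i')
  case 0
  from "0.prems"[of 0] show ?case by simp
next
  case (Suc r)
  have "(fdiff ^^ r) f i = (fdiff ^^ r) g i'"
    using Suc.prems by (intro Suc.IH) simp
  moreover have "(fdiff ^^ r) f (Suc i) = (fdiff ^^ r) g (Suc i')"
    using Suc.prems[of "Suc _"] by (intro Suc.IH) simp
  ultimately show ?case by (simp add: fdiff_Suc del: funpow.simps)
qed

lemma fdiff_zero_fun: "(fdiff ^^ r) (\<lambda>_. 0) i = 0"
  by (induction r arbitrary: i) (simp_all add: fdiff_simps del: funpow.simps)

lemma fdiff_eq_0: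
  assumes "\<And>k. k \<le> r \<Longrightarrow> g (i + k) = 0"
  shows "(fdiff ^^ r) g i = 0"
  using fdiff_cong[of r g i "\<lambda>_. 0" i] assms by (simp add: fdiff_zero_fun)

lemma fdiff_last:
  assumes "\<And>k. k < r \<Longrightarrow> g (i + k) = 0"
  shows "(fdiff ^^ r) g i = g (i + r)"
  using assms
proof (induction r arbitrary: i)
  case (Suc r)
  have "(fdiff ^^ r) g (Suc i) = g (Suc i + r)"
    using Suc.prems[of "Suc _"] by (intro Suc.IH) simp
  moreover have "(fdiff ^^ r) g i = 0"
    using Suc.prems by (intro fdiff_eq_0) simp
  ultimately show ?case by (simp add: fdiff_Suc del: funpow.simps)
qed simp

lemma fdiff_first:
  assumes "\<And>k. 0 < k \<Longrightarrow> k \<le> r \<Longrightarrow> g (i + k) = 0"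
  shows "(fdiff ^^ r) g i = (-1) ^ r * g i"
  using assms
proof (induction r arbitrary: i)
  case (Suc r)
  have "(fdiff ^^ r) g (Suc i) = 0"
    using Suc.prems[of "Suc _"] by (intro fdiff_eq_0) simp
  moreover have "(fdiff ^^ r) g i = (-1) ^ r * g i"
    using Suc.prems by (intro Suc.IH) simp
  ultimately show ?case by (simp add: fdiff_Suc del: funpow.simps)
qed simp

lemma fdiff_expand:
  "(fdiff ^^ r) g i = (\<Sum>k\<le>r. (-1) ^ (r + k) * of_nat (r choose k) * g (i + k))"
proof (induction r arbitrary: i)
  case (Suc r)
  let ?t = "\<lambda>k. (-1) ^ (r + k) * of_nat (r choose k) * g (Suc i + k)"
  let ?u = "\<lambda>k. (-1) ^ (Suc r + k) * of_nat (r choose k) * g (i + k)"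
  have "(\<Sum>k\<le>Suc r. (-1) ^ (Suc r + k) * of_nat (Suc r choose k) * g (i + k)) =
      ?u 0 + (\<Sum>k\<le>r. (-1) ^ (r + k) * of_nat (Suc r choose Suc k) * g (Suc i + k))"
    by (simp only: sum.atMost_Suc_shift) simp
  also have "\<dots> = (\<Sum>k\<le>r. ?t k) + (?u 0 + (\<Sum>k\<le>r. ?u (Suc k)))"
    by (simp add: sum.distrib algebra_simps)
  also have "?u 0 + (\<Sum>k\<le>r. ?u (Suc k)) = (\<Sum>k\<le>Suc r. ?u k)"
    by (simp only: sum.atMost_Suc_shift)
  also have "\<dots> = (\<Sum>k\<le>r. ?u k)" by (simp add: binomial_eq_0)
  finally show ?case
    by (simp add: fdiff_Suc Suc.IH sum_negf sum_subtractf del: funpow.simps)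
qed simp

definition dker :: "nat \<Rightarrow> (nat \<Rightarrow> 'a::comm_ring_1) \<Rightarrow> bool" where
  "dker r g \<longleftrightarrow> (\<forall>i. (fdiff ^^ r) g i = 0)"

lemma dker_diff: "dker r f \<Longrightarrow> dker r g \<Longrightarrow> dker r (\<lambda>i. f i - g i)"
  by (simp add: dker_def fdiff_minus)

lemma dker_cmult: "dker r g \<Longrightarrow> dker r (\<lambda>i. c * g i)"
  by (simp add: dker_def fdiff_cmult)

lemma dker_shift: "dker r g \<Longrightarrow> dker r (\<lambda>i. g (i + s))"
  by (simp add: dker_def fdiff_shift)

lemma dker_mono:
  assumes "dker r g" "r \<le> s" shows "dker s g"
proof -
  have "(fdiff ^^ s) g = (fdiff ^^ (s - r)) ((fdiff ^^ r) g)"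
    using assms(2) by (simp add: fdiff_fdiff)
  also have "(fdiff ^^ r) g = (\<lambda>_. 0)" using assms(1) by (auto simp: dker_def)
  finally show ?thesis by (simp add: dker_def fdiff_zero_fun)
qed

lemma dker_fdiff: "dker r ((fdiff ^^ s) g) \<longleftrightarrow> dker (r + s) g"
  by (simp add: dker_def fdiff_fdiff)

lemma fdiff_antiderivative: "\<exists>h. (fdiff ^^ r) h = g"
proof (induction r arbitrary: g)
  case (Suc r)
  from Suc[of "\<lambda>i. \<Sum>k<i. g k"] obtain h where "(fdiff ^^ r) h = (\<lambda>i. \<Sum>k<i. g k)" by blast
  hence "(fdiff ^^ Suc r) h = g" by (simp add: fdiff_def)
  thus ?case by blast
qed auto

text \<open>Solutions for exponent r + 1 are the antiderivatives of solutions for exponent r: the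
  differences of the data are met by induction, and the constant of summation meets the value at
  0.\<close>

lemma dker_interpolation: "\<exists>g. dker r g \<and> (\<forall>j<r. g j = v j)"
proof (induction r arbitrary: v)
  case 0
  show ?case by (rule exI[of _ "\<lambda>_. 0"]) (simp add: dker_def)
next
  case (Suc r)
  from Suc[of "fdiff v"] obtain h where h: "dker r h" "\<And>j. j < r \<Longrightarrow> h j = fdiff v j" by blast
  define g where "g = (\<lambda>i. v 0 + (\<Sum>k<i. h k))"
  have "fdiff g = h" by (simp add: g_def fdiff_def)
  with h(1) have "dker (Suc r) g"
    using dker_fdiff[of r 1 g] by simp
  moreover have "g j = v j" if "j < Suc r" for j
    using that
  proof (induction j)
    case (Suc j)
    have "g (Suc j) = g j + h j" by (simp add: g_def)
    also have "\<dots> = v (Suc j)" using Suc h(2)[of j] by (simp add: fdiff_def)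
    finally show ?case .
  qed (simp add: g_def)
  ultimately show ?case by blast
qed

text \<open>The recursion expresses each value through the r preceding ones, so r consecutive zeros
  propagate forward.\<close>

lemma dker_zero_from:
  assumes "dker r g" "\<And>k. k < r \<Longrightarrow> g (s + k) = 0"
  shows "g (s + j) = 0"
proof (induction j rule: less_induct)
  case (less j)
  show ?case
  proof (cases "j < r")
    case False
    have "g (s + (j - r) + k) = 0" if "k < r" for k
      using less[of "j - r + k"] False that by (simp add: add.assoc)
    hence "(fdiff ^^ r) g (s + (j - r)) = g (s + (j - r) + r)"
      by (intro fdiff_last)
    with False assms(1) show ?thesis by (simp add: dker_def)
  qed (use assms in simp)
qed

section \<open>Characteristic p: periodicity modulo q\<close>

text \<open>This is (S - 1)^p = S^p - 1: the inner binomial coefficients vanish modulo p, and (-1)^p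
  = -1 also for p = 2.\<close>

lemma fdiff_CHAR:
  fixes g :: "nat \<Rightarrow> 'a::field"
  assumes p: "prime CHAR('a)"
  shows "(fdiff ^^ CHAR('a)) g i = g (i + CHAR('a)) - g i"
proof -
  let ?p = "CHAR('a)"
  let ?f = "\<lambda>k. (-1) ^ (?p + k) * of_nat (?p choose k) * g (i + k)"
  have "(fdiff ^^ ?p) g i = (\<Sum>k\<in>{0, ?p}. ?f k)"
    unfolding fdiff_expand
  proof (rule sum.mono_neutral_right)
    show "\<forall>k\<in>{..?p} - {0, ?p}. ?f k = 0"
    proof
      fix k assume "k \<in> {..?p} - {0, ?p}"
      hence "?p dvd (?p choose k)"
        by (intro dvd_choose_prime) (use p in auto)
      thus "?f k = 0" by (simp add: of_nat_eq_0_iff_char_dvd)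
    qed
  qed auto
  also have "\<dots> = g (i + ?p) - g i"
    using p prime_gt_0_nat[OF p] minus_power_prime_CHAR[of ?p "1::'a"]
    by (simp add: power_add flip: power_mult_distrib)
  finally show ?thesis .
qed

text \<open>With \<open>i\<close> fixed, \<open>j\<close> plays the role of a digit: once (S - 1)^n
  = S^n - 1, its powers act on \<open>j\<close> by ordinary differences. This serves both to pass
  from p^e to p^(e+1) and to treat polynomials in the leading digit.\<close>

lemma fdiff_step:
  fixes g :: "nat \<Rightarrow> 'a::comm_ring_1"
  assumes "\<And>(g :: nat \<Rightarrow> 'a) i. (fdiff ^^ n) g i = g (i + n) - g i"
  shows "(fdiff ^^ (n * r)) g (i + j * n) = (fdiff ^^ r) (\<lambda>j. g (i + j * n)) j"
proof (induction r arbitrary: j)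
  case (Suc r)
  have "(fdiff ^^ (n * Suc r)) g (i + j * n) = (fdiff ^^ n) ((fdiff ^^ (n * r)) g) (i + j * n)"
    by (simp add: fdiff_fdiff)
  also have "\<dots> = (fdiff ^^ (n * r)) g (i + j * n + n) - (fdiff ^^ (n * r)) g (i + j * n)"
    by (rule assms)
  also have "i + j * n + n = i + Suc j * n" by simp
  finally show ?case by (simp only: Suc fdiff_Suc)
qed simp

lemma fdiff_CHAR_power:
  fixes g :: "nat \<Rightarrow> 'a::field"
  assumes p: "prime CHAR('a)"
  shows "(fdiff ^^ (CHAR('a) ^ e)) g i = g (i + CHAR('a) ^ e) - g i"
proof (induction e arbitrary: g i)
  case (Suc e)
  from fdiff_step[OF Suc, of "CHAR('a)" g i 0] show ?case
    by (simp add: fdiff_CHAR[OF p] mult.commute)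
qed (simp add: fdiff_def)

locale char_p =
  fixes F :: "'a::field itself" and q e :: nat
  assumes prime_char: "prime CHAR('a)" and q_def: "q = CHAR('a) ^ e"
begin

lemma q_pos: "q > 0"
  using prime_gt_0_nat[OF prime_char] by (simp add: q_def)

lemma dker_periodic:
  fixes g :: "nat \<Rightarrow> 'a"
  assumes "dker r g" "r \<le> q"
  shows "g (i + q) = g i"
  using dker_mono[OF assms] fdiff_CHAR_power[OF prime_char, of e g i]
  by (simp add: dker_def q_def)

lemma dker_periodic_mult:
  fixes g :: "nat \<Rightarrow> 'a"
  assumes "dker r g" "r \<le> q"
  shows "g (i + n * q) = g i"
proof (induction n)
  case (Suc n)
  have "g (i + Suc n * q) = g (i + n * q + q)" by (simp add: algebra_simps)
  also have "\<dots> = g i" using dker_periodic[OF assms] Suc by simp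
  finally show ?case .
qed simp

lemma dker_mod:
  fixes g :: "nat \<Rightarrow> 'a"
  assumes "dker r g" "r \<le> q"
  shows "g (i mod q) = g i"
  using dker_periodic_mult[OF assms, of "i mod q" "i div q"] by simp

text \<open>The zeros spread forward by the recursion, and adding the period \<open>s\<close> times
  moves any \<open>j\<close> past \<open>s\<close>. This is the tool for showing that a value next
  to a run of zeros is nonzero.\<close>

lemma dker_eq_0:
  fixes g :: "nat \<Rightarrow> 'a"
  assumes "dker r g" "r \<le> q" "\<And>k. k < r \<Longrightarrow> g (s + k) = 0"
  shows "g j = 0"
proof -
  have "s \<le> j + s * q" using q_pos by (cases q) auto
  then obtain k where "j + s * q = s + k" using le_Suc_ex by blast
  with dker_zero_from[OF assms(1,3)] dker_periodic_mult[OF assms(1,2)] show ?thesis by metis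
qed

text \<open>The data at \<open>s\<close>, \<open>s + 1\<close>, ... are interpolated at the origin
  and must then be moved right by \<open>s\<close>. Since \<open>q\<close> is a period, reading the
  sequence \<open>s * q - s\<close> places further on has that effect.\<close>

lemma dker_interpolation_from:
  assumes "r \<le> q"
  obtains g :: "nat \<Rightarrow> 'a" where "dker r g" "\<And>k. k < r \<Longrightarrow> g (s + k) = v (s + k)"
proof -
  obtain h :: "nat \<Rightarrow> 'a" where h: "dker r h" "\<And>j. j < r \<Longrightarrow> h j = v (s + j)"
    using dker_interpolation[of r "\<lambda>j. v (s + j)"] by blast
  have sq: "s \<le> s * q" using q_pos by (cases q) auto
  have "h (s + k + (s * q - s)) = v (s + k)" if "k < r" for k
  proof -
    have "s + k + (s * q - s) = k + s * q" using sq by simp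
    thus ?thesis using dker_periodic_mult[OF h(1) assms] h(2)[OF that] by metis
  qed
  with dker_shift[OF h(1), of "s * q - s"] show ?thesis by (intro that) blast+
qed

end

section \<open>First and last nonzero positions in a window\<close>

text \<open>\<open>g\<close> is a solution on all of the naturals although only the window
  \<open>{..d}\<close> enters the sheaf: periodicity, which reaches outside the window, is what
  relates the two ends.\<close>

definition has_ends :: "nat \<Rightarrow> nat \<Rightarrow> nat \<Rightarrow> nat \<Rightarrow> (nat \<Rightarrow> 'a::comm_ring_1) \<Rightarrow> bool" where
  "has_ends r d A B g \<longleftrightarrow> dker r g \<and> (\<forall>j<A. g j = 0) \<and> g A \<noteq> 0 \<and> g B \<noteq> 0 \<and> B \<le> d \<and>
     (\<forall>j. B < j \<and> j \<le> d \<longrightarrow> g j = 0)"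


lemma has_endsD:
  assumes "has_ends r d A B g"
  shows "dker r g" "\<And>j. j < A \<Longrightarrow> g j = 0" "g A \<noteq> 0" "g B \<noteq> 0" "B \<le> d"
    "\<And>j. B < j \<Longrightarrow> j \<le> d \<Longrightarrow> g j = 0" "A \<le> B"
  using assms by (auto simp: has_ends_def not_less[symmetric])

context char_p
begin

lemma has_ends_first_less:
  fixes g :: "nat \<Rightarrow> 'a"
  assumes "has_ends r d A B g" "r \<le> q"
  shows "A < r"
proof (rule ccontr)
  assume "\<not> A < r"
  have "g A = 0"
    by (rule dker_eq_0[OF has_endsD(1)[OF assms(1)] assms(2), of 0])
      (use \<open>\<not> A < r\<close> has_endsD(2)[OF assms(1)] in simp)
  with has_endsD(3)[OF assms(1)] show False by simp
qed

lemma has_ends_last_greater: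
  fixes g :: "nat \<Rightarrow> 'a"
  assumes "has_ends r d A B g" "r \<le> q" "r \<le> Suc d"
  shows "d < B + r"
proof (rule ccontr)
  assume "\<not> d < B + r"
  have "g A = 0"
    by (rule dker_eq_0[OF has_endsD(1)[OF assms(1)] assms(2), of "Suc d - r"])
      (use \<open>\<not> d < B + r\<close> has_endsD(6)[OF assms(1)] assms(3) in simp)
  with has_endsD(3)[OF assms(1)] show False by simp
qed

text \<open>The Bruhat decomposition for the flags given by the initial and the final zeros: among the
  sequences with a given first nonzero position, take one whose last nonzero position is minimal.\<close>

lemma bruhat:
  assumes r: "r \<le> q" "r \<le> Suc d"
  obtains g :: "nat \<Rightarrow> nat \<Rightarrow> 'a" and \<sigma>
  where "\<forall>A<r. has_ends r d A (\<sigma> A) (g A)" "inj_on \<sigma> {..<r}"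
proof -
  define \<sigma> where "\<sigma> A = (LEAST B. \<exists>g :: nat \<Rightarrow> 'a. has_ends r d A B g)" for A
  have ends: "\<exists>g :: nat \<Rightarrow> 'a. has_ends r d A (\<sigma> A) g" if A: "A < r" for A
  proof -
    obtain g :: "nat \<Rightarrow> 'a" where g: "dker r g" "\<And>j. j < r \<Longrightarrow> g j = (if j = A then 1 else 0)"
      using dker_interpolation[of r "\<lambda>j. if j = A then 1 else 0"] by blast
    define B where "B = (GREATEST j. j \<le> d \<and> g j \<noteq> 0)"
    have gA: "A \<le> d \<and> g A \<noteq> 0" using A g r by auto
    have "B \<le> d \<and> g B \<noteq> 0"
      unfolding B_def by (rule GreatestI_nat[of _ A d]) (use gA in auto)
    moreover have "g j = 0" if "B < j" "j \<le> d" for j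
    proof (rule ccontr)
      assume "g j \<noteq> 0"
      hence "j \<le> B" unfolding B_def by (intro Greatest_le_nat[of _ _ d]) (use that in auto)
      with that show False by simp
    qed
    ultimately have "has_ends r d A B g" using g A gA by (auto simp: has_ends_def)
    hence "\<exists>B. \<exists>g :: nat \<Rightarrow> 'a. has_ends r d A B g" by blast
    thus ?thesis unfolding \<sigma>_def by (rule LeastI_ex)
  qed
  then obtain g :: "nat \<Rightarrow> nat \<Rightarrow> 'a" where g: "\<And>A. A < r \<Longrightarrow> has_ends r d A (\<sigma> A) (g A)"
    by metis
  have "\<sigma> A \<noteq> \<sigma> A'" if A: "A < A'" "A' < r" for A A'
  proof
    assume eq: "\<sigma> A = \<sigma> A'"
    define B where "B = \<sigma> A"
    \<comment> \<open>Cancelling the common last value keeps the start \<open>A\<close>, since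
      \<open>g A'\<close> vanishes there, but moves the end below \<open>B\<close>, against the
      minimality of \<open>\<sigma> A\<close>.\<close>
    define h where "h = (\<lambda>i. g A i - g A B / g A' B * g A' i)"
    have gA: "has_ends r d A B (g A)" using g[of A] A by (simp add: B_def)
    have gA': "has_ends r d A' B (g A')" using g[of A'] A by (simp add: B_def eq)
    have h: "dker r h"
      unfolding h_def using has_endsD(1)[OF gA] has_endsD(1)[OF gA'] by (intro dker_diff dker_cmult)
    have hA: "h A \<noteq> 0" using has_endsD(2)[OF gA', of A] has_endsD(3)[OF gA] A by (simp add: h_def)
    have hB: "h B = 0" using has_endsD(4)[OF gA'] by (simp add: h_def)
    have hlow: "h j = 0" if "j < A" for j
      using has_endsD(2)[OF gA, of j] has_endsD(2)[OF gA', of j] A that by (simp add: h_def)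
    have hhigh: "h j = 0" if "B < j" "j \<le> d" for j
      using has_endsD(6)[OF gA, of j] has_endsD(6)[OF gA', of j] that by (simp add: h_def)
    define C where "C = (GREATEST j. j \<le> d \<and> h j \<noteq> 0)"
    have hA': "A \<le> d \<and> h A \<noteq> 0" using A hA r by auto
    have C: "C \<le> d \<and> h C \<noteq> 0"
      unfolding C_def by (rule GreatestI_nat[of _ A d]) (use hA' in auto)
    have "h j = 0" if "C < j" "j \<le> d" for j
    proof (rule ccontr)
      assume "h j \<noteq> 0"
      hence "j \<le> C" unfolding C_def by (intro Greatest_le_nat[of _ _ d]) (use that in auto)
      with that show False by simp
    qed
    with C h hA hlow have "has_ends r d A C h" by (auto simp: has_ends_def)
    hence "B \<le> C" unfolding B_def \<sigma>_def by (intro Least_le) blast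
    with C hB hhigh[of C] show False by (cases "C = B") auto
  qed
  hence inj: "inj_on \<sigma> {..<r}" by (intro inj_onI) (metis lessThan_iff nat_neq_iff)
  have "\<forall>A<r. has_ends r d A (\<sigma> A) (g A)" using g by blast
  thus ?thesis using inj by (rule that)
qed

section \<open>Sequences for the first three assertions\<close>

text \<open>Enlarging the window by one period moves the run of final zeros along by
  \<open>q\<close> and leaves the initial one alone. This is the source of the second
  assertion.\<close>

lemma has_ends_add_period:
  fixes g :: "nat \<Rightarrow> 'a"
  assumes g: "has_ends r d A B g" and r: "r \<le> q"
  shows "has_ends r (d + q) A (B + q) g"
proof -
  note per = dker_periodic[OF has_endsD(1)[OF g] r]
  have "g j = 0" if "B + q < j" "j \<le> d + q" for j
    using per[of "j - q"] has_endsD(6)[OF g, of "j - q"] that by simp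
  with has_endsD[OF g] per[of B] show ?thesis by (auto simp: has_ends_def)
qed

text \<open>With exponent d + 1 all values in the window are free, so unit vectors qualify.\<close>

lemma has_ends_full:
  assumes "i \<le> d"
  obtains g :: "nat \<Rightarrow> 'a" where "has_ends (Suc d) d i i g"
proof -
  obtain g :: "nat \<Rightarrow> 'a" where "dker (Suc d) g" "\<And>j. j < Suc d \<Longrightarrow> g j = (if j = i then 1 else 0)"
    using dker_interpolation[of "Suc d" "\<lambda>j. if j = i then 1 else 0"] by blast
  with assms show ?thesis by (intro that[of g]) (auto simp: has_ends_def)
qed

text \<open>Take the unit vector at \<open>i + q\<close> on the last \<open>r\<close> positions of
  the window. Positions below \<open>i\<close> enter this stretch after one period, because
  \<open>d < q + r\<close>, so the sequence starts at \<open>i\<close>. These sequences account for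
  \<open>H d q\<close>.\<close>

lemma has_ends_wrap:
  assumes i: "i + q \<le> d" and r: "r \<le> q" "d < q + r"
  obtains g :: "nat \<Rightarrow> 'a" where "has_ends r d i (i + q) g"
proof -
  let ?s = "Suc d - r"
  obtain g :: "nat \<Rightarrow> 'a" where g: "dker r g"
      "\<And>k. k < r \<Longrightarrow> g (?s + k) = (if ?s + k = i + q then 1 else 0)"
    using dker_interpolation_from[OF r(1), of ?s "\<lambda>j. if j = i + q then 1 else 0"] by metis
  have val: "g j = (if j = i + q then 1 else 0)" if "?s \<le> j" "j \<le> d" for j
    using g(2)[of "j - ?s"] that by simp
  have per: "g (j + q) = g j" for j by (rule dker_periodic[OF g(1) r(1)])
  have "g j = 0" if "j < i" for j
    using per[of j] val[of "j + q"] that i r by auto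
  moreover have "g i = 1" "g (i + q) = 1" using per[of i] val[of "i + q"] i r by auto
  moreover have "g j = 0" if "i + q < j" "j \<le> d" for j using val[of j] that r by simp
  ultimately show ?thesis using g(1) i by (intro that[of g]) (auto simp: has_ends_def)
qed

text \<open>Take the unit vector at \<open>i\<close> on the \<open>r\<close> positions from
  \<open>i\<close> on, which reach at least to \<open>d\<close>. The next value, at
  \<open>i + r\<close>, cannot vanish, or it would complete a run of \<open>r\<close> zeros; one
  period earlier it is the first nonzero value. These sequences account for
  \<open>H (q - 1) (d + 1 - r)\<close>.\<close>

lemma has_ends_inner:
  assumes i: "i < q" "q \<le> i + r" "d < i + r" "i \<le> d" and r: "r \<le> q"
  obtains g :: "nat \<Rightarrow> 'a" where "has_ends r d (i + r - q) i g"
proof -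
  have r0: "r > 0" using i by auto
  obtain g :: "nat \<Rightarrow> 'a" where g: "dker r g"
      "\<And>k. k < r \<Longrightarrow> g (i + k) = (if i + k = i then 1 else 0)"
    using dker_interpolation_from[OF r, of i "\<lambda>j. if j = i then 1 else 0"] by metis
  have gi: "g i = 1" using g(2)[of 0] r0 by simp
  have zero: "g j = 0" if "i < j" "j < i + r" for j
    using g(2)[of "j - i"] that by simp
  have per: "g (j + q) = g j" for j by (rule dker_periodic[OF g(1) r])
  have "g (i + r) \<noteq> 0"
  proof
    assume *: "g (i + r) = 0"
    have "g i = 0"
    proof (rule dker_eq_0[OF g(1) r, of "Suc i"])
      fix k assume "k < r"
      thus "g (Suc i + k) = 0" using zero[of "Suc i + k"] * by (cases "Suc k = r") auto
    qed
    with gi show False by simp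
  qed
  moreover have "g (i + r) = g (i + r - q)" using per[of "i + r - q"] i by simp
  moreover have "g j = 0" if "j < i + r - q" for j
    using per[of j] zero[of "j + q"] that i by simp
  ultimately show ?thesis using g(1) gi zero i by (intro that[of g]) (auto simp: has_ends_def)
qed

end

section \<open>Polynomials in the leading digit\<close>

text \<open>This is how the difference operator sees a polynomial of degree at most n with
  coefficient c at j^n, whose n-th difference is the constant n! c.\<close>

definition has_lead :: "nat \<Rightarrow> 'a::comm_ring_1 \<Rightarrow> (nat \<Rightarrow> 'a) \<Rightarrow> bool" where
  "has_lead n c f \<longleftrightarrow> (\<forall>i. (fdiff ^^ n) f i = of_nat (fact n) * c)"

text \<open>Leibniz rule for a product with a linear factor, whose second difference
  vanishes.\<close>

lemma fdiff_linear_mult: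
  "(fdiff ^^ Suc n) (\<lambda>j. (of_nat j - x) * f j) i =
     (of_nat i - x) * (fdiff ^^ Suc n) f i + of_nat (Suc n) * (fdiff ^^ n) f (Suc i)"
proof (induction n arbitrary: i)
  case (Suc n)
  show ?case
    unfolding fdiff_Suc[of "Suc n"] Suc by (simp add: algebra_simps fdiff_simps del: funpow.simps)
qed (simp add: fdiff_def algebra_simps)

lemma has_lead_linear_mult:
  assumes "has_lead n c f"
  shows "has_lead (Suc n) c (\<lambda>j. (of_nat j - x) * f j)"
proof -
  have "(fdiff ^^ Suc n) f i = 0" for i
    using assms by (simp add: has_lead_def fdiff_Suc del: funpow.simps)
  with assms show ?thesis
    unfolding has_lead_def fdiff_linear_mult by (simp add: algebra_simps)
qed

lemma has_lead_prod_mult: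
  assumes "has_lead n c f"
  shows "has_lead (m + n) c (\<lambda>j. (\<Prod>s<m. of_nat j - x s) * f j)"
proof (induction m)
  case (Suc m)
  from has_lead_linear_mult[OF this, of "x m"] show ?case
    by (simp add: mult_ac)
qed (simp add: assms)

lemma has_lead_affine: "has_lead 1 c (\<lambda>j. c * (of_nat j - x) + y)"
  by (simp add: has_lead_def fdiff_def algebra_simps)

lemma has_lead_const: "has_lead 0 c (\<lambda>j. c)"
  by (simp add: has_lead_def)

context char_p
begin

text \<open>(S - 1)^(a q) is the a-th difference in the digit and leaves a! times the leading
  coefficient \<epsilon>, extended to all positions by its period \<open>q\<close>; the remaining
  \<rho> differences annihilate it.\<close>

lemma dker_digits:
  fixes f :: "nat \<Rightarrow> nat \<Rightarrow> 'a"
  assumes \<epsilon>: "dker \<rho> \<epsilon>" "\<rho> \<le> q" and f: "\<And>i. i < q \<Longrightarrow> has_lead a (\<epsilon> i) (f i)"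
  shows "dker (a * q + \<rho>) (\<lambda>i. f (i mod q) (i div q))"
proof -
  define g where "g = (\<lambda>i. f (i mod q) (i div q))"
  have "(fdiff ^^ (q * a)) g i = of_nat (fact a) * \<epsilon> i" for i
  proof -
    have step: "(fdiff ^^ q) h j = h (j + q) - h j" for h :: "nat \<Rightarrow> 'a" and j
      unfolding q_def by (rule fdiff_CHAR_power[OF prime_char])
    have "(fdiff ^^ (q * a)) g (i mod q + i div q * q) =
        (fdiff ^^ a) (\<lambda>j. g (i mod q + j * q)) (i div q)"
      by (rule fdiff_step[OF step])
    also have "(\<lambda>j. g (i mod q + j * q)) = f (i mod q)"
      using q_pos by (auto simp: g_def)
    finally show ?thesis
      using f[of "i mod q"] q_pos dker_mod[OF \<epsilon>, of i] by (simp add: has_lead_def)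
  qed
  hence "(fdiff ^^ (q * a)) g = (\<lambda>i. of_nat (fact a) * \<epsilon> i)" by blast
  hence "dker \<rho> ((fdiff ^^ (q * a)) g)" using dker_cmult[OF \<epsilon>(1)] by simp
  thus ?thesis unfolding dker_fdiff by (simp add: g_def add.commute mult.commute)
qed

lemma of_nat_eq_less_CHAR:
  assumes "of_nat x = (of_nat y :: 'a)" "x < CHAR('a)" "y < CHAR('a)"
  shows "x = y"
proof -
  have "False" if "x < y" "of_nat x = (of_nat y :: 'a)" "y < CHAR('a)" for x y
  proof -
    have "of_nat (y - x) = (0 :: 'a)" using that by (simp add: of_nat_diff)
    hence "CHAR('a) dvd y - x" by (simp add: of_nat_eq_0_iff_char_dvd)
    with that show False by (auto dest: dvd_imp_le)
  qed
  from this[of x y] this[of y x] assms show ?thesis by (metis nat_neq_iff)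
qed

text \<open>As a function of the leading digit \<open>j\<close> of a position with residue \<open>i\<close>, the following product
  vanishes on the first \<open>m\<close> and on the last \<open>n\<close> digits that occur in the window \<open>{..d}\<close>.\<close>

definition cutoff :: "nat \<Rightarrow> nat \<Rightarrow> nat \<Rightarrow> nat \<Rightarrow> nat \<Rightarrow> 'a" where
  "cutoff d m n i j = (\<Prod>s<m. of_nat j - of_nat s) * (\<Prod>s<n. of_nat j - of_nat ((d - i) div q - s))"

lemma has_lead_cutoff_mult:
  assumes "has_lead k c f"
  shows "has_lead (m + n + k) c (\<lambda>j. cutoff d m n i j * f j)"
  using has_lead_prod_mult[OF has_lead_prod_mult[OF assms, of n "\<lambda>s. of_nat ((d - i) div q - s)"],
      of m of_nat]
  by (simp add: cutoff_def mult_ac add_ac)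

text \<open>\<open>(d - i) div q\<close> is the last digit that occurs in the window for the residue
  \<open>i\<close>, and one step of the digit is a step of length \<open>q\<close> in the
  position.\<close>

lemma digit_le_iff:
  assumes "j \<le> d"
  shows "j div q + n \<le> (d - j mod q) div q \<longleftrightarrow> j + n * q \<le> d"
proof -
  have mod_le: "j mod q \<le> d" using assms mod_less_eq_dividend[of j q] by linarith
  have "j div q + n \<le> (d - j mod q) div q \<longleftrightarrow> (j div q + n) * q \<le> d - j mod q"
    using q_pos by (simp add: less_eq_div_iff_mult_less_eq)
  also have "\<dots> \<longleftrightarrow> j mod q + j div q * q + n * q \<le> d"
    using mod_le by (simp add: algebra_simps le_diff_conv2)
  finally show ?thesis by simp
qed

lemma cutoff_eq_0:
  assumes "j \<le> d" "j < m * q \<or> d < j + n * q"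
  shows "cutoff d m n (j mod q) (j div q) = 0"
proof (cases "j < m * q")
  case True
  hence "j div q < m" using q_pos by (simp add: div_less_iff_less_mult)
  thus ?thesis by (auto simp: cutoff_def)
next
  case False
  define t where "t = (d - j mod q) div q"
  have "\<not> j div q + n \<le> t" "j div q \<le> t"
    using digit_le_iff[OF assms(1), of n] digit_le_iff[OF assms(1), of 0] assms False
    by (auto simp: t_def)
  hence "t - j div q < n" "t - (t - j div q) = j div q" by auto
  hence "(\<Prod>s<n. of_nat (j div q) - of_nat (t - s)) = (0 :: 'a)"
    by (intro prod_zero) (auto intro!: bexI[of _ "t - j div q"])
  thus ?thesis by (simp add: cutoff_def t_def)
qed

text \<open>The bound on \<open>d\<close> keeps all digits in the window below the characteristic,
  so distinct digits stay distinct in the field and no factor vanishes by accident.\<close>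

lemma cutoff_neq_0:
  assumes d: "d < CHAR('a) * q" and j: "m * q \<le> j" "j + n * q \<le> d"
  shows "cutoff d m n (j mod q) (j div q) \<noteq> 0"
proof -
  define t where "t = (d - j mod q) div q"
  have "t \<le> d div q" unfolding t_def by (intro div_le_mono) simp
  also have "d div q < CHAR('a)" using d q_pos by (simp add: div_less_iff_less_mult)
  finally have t: "t < CHAR('a)" .
  have jt: "j div q + n \<le> t" using digit_le_iff[of j d n] j by (simp add: t_def)
  have mj: "m \<le> j div q" using j(1) q_pos by (simp add: less_eq_div_iff_mult_less_eq)
  have "of_nat (j div q) \<noteq> (of_nat s :: 'a)" if "s < m" for s
    using of_nat_eq_less_CHAR[of "j div q" s] that mj jt t by auto
  moreover have "of_nat (j div q) \<noteq> (of_nat (t - s) :: 'a)" if "s < n" for s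
    using of_nat_eq_less_CHAR[of "j div q" "t - s"] that jt t by auto
  ultimately show ?thesis by (auto simp: cutoff_def t_def)
qed

text \<open>All m + n roots in the digit are used to cut off m periods at the start and n at the
  end. What remains is a translate of the window \<open>{..D}\<close>, on which the cutoff has no
  zeros and the leading coefficient \<epsilon> alone decides where the product vanishes.\<close>

lemma has_ends_digits1:
  fixes \<epsilon> :: "nat \<Rightarrow> 'a"
  assumes \<epsilon>: "has_ends \<rho> D A B \<epsilon>" and \<rho>: "\<rho> \<le> q" and d: "D + (m + n) * q < CHAR('a) * q"
  obtains g :: "nat \<Rightarrow> 'a"
  where "has_ends ((m + n) * q + \<rho>) (D + (m + n) * q) (A + m * q) (B + m * q) g"
proof -
  define d' where "d' = D + (m + n) * q"
  define g where "g = (\<lambda>i. cutoff d' m n (i mod q) (i div q) * \<epsilon> (i mod q))"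
  note \<epsilon>' = has_endsD[OF \<epsilon>]
  have "has_lead (m + n) (\<epsilon> i) (\<lambda>j. cutoff d' m n i j * \<epsilon> i)" for i
    using has_lead_cutoff_mult[OF has_lead_const[of "\<epsilon> i"], where m = m and n = n] by simp
  hence dker: "dker ((m + n) * q + \<rho>) g"
    unfolding g_def by (intro dker_digits[OF \<epsilon>'(1) \<rho>, of "m + n" "\<lambda>i j. cutoff d' m n i j * \<epsilon> i"])
  have mod: "\<epsilon> (i mod q) = \<epsilon> i" for i by (rule dker_mod[OF \<epsilon>'(1) \<rho>])
  have per: "\<epsilon> (i + m * q) = \<epsilon> i" for i by (rule dker_periodic_mult[OF \<epsilon>'(1) \<rho>])
  have outside: "g j = 0" if "j \<le> d'" "j < m * q \<or> d' < j + n * q" for j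
    using cutoff_eq_0[OF that] by (simp add: g_def)
  have inside: "g (i + m * q) = 0 \<longleftrightarrow> \<epsilon> i = 0" if "i \<le> D" for i
    using cutoff_neq_0[of d' m "i + m * q" n] d that per[of i] mod[of "i + m * q"]
    by (simp add: g_def d'_def algebra_simps)
  have AB: "A \<le> D" "B \<le> D" using \<epsilon>' by simp_all
  have low: "g j = 0" if "j < A + m * q" for j
  proof (cases "j < m * q")
    case True
    thus ?thesis using outside[of j] by (simp add: d'_def algebra_simps)
  next
    case False
    thus ?thesis using inside[of "j - m * q"] \<epsilon>'(2)[of "j - m * q"] that AB by simp
  qed
  have high: "g j = 0" if "B + m * q < j" "j \<le> d'" for j
  proof (cases "d' < j + n * q")
    case False
    hence "j - m * q \<le> D" by (simp add: d'_def algebra_simps)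
    thus ?thesis using inside[of "j - m * q"] \<epsilon>'(6)[of "j - m * q"] that by simp
  qed (use outside that in simp)
  show ?thesis
  proof (rule that[of g])
    show "has_ends ((m + n) * q + \<rho>) (D + (m + n) * q) (A + m * q) (B + m * q) g"
      unfolding has_ends_def d'_def[symmetric]
      using dker low high inside[OF AB(1)] inside[OF AB(2)] \<epsilon>'(3,4) AB
      by (auto simp: d'_def algebra_simps)
  qed
qed

text \<open>The residues \<open>i < A + \<rho>\<close> lose one further initial digit, and those of the positions beyond \<open>B\<close> one
  further final digit, so that the affine factor in the leading digit has to vanish there. Its slope
  \<open>\<epsilon>\<close> must be killed by the \<open>\<rho>\<close>-th difference. An antiderivative \<open>h\<close> of \<open>\<eta>\<close> that vanishes beyond \<open>B\<close>
  and the sequence \<open>\<epsilon>\<close> that agrees with \<open>h\<close> below \<open>\<rho>\<close> (hence below \<open>A + \<rho>\<close>, but not at \<open>A + \<rho>\<close>) achieve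
  this: the factor interpolates between multiples of \<open>h - \<epsilon>\<close> at the first and of \<open>h\<close> at the last
  digit, \<open>c i\<close> steps apart.\<close>

lemma has_ends_digits2:
  fixes \<eta> :: "nat \<Rightarrow> 'a"
  assumes \<eta>: "has_ends (q - \<rho>) D A B \<eta>" and \<rho>: "\<rho> < q" and D: "q \<le> D"
    and d: "D + \<rho> + (m + n) * q < CHAR('a) * q"
  obtains g :: "nat \<Rightarrow> 'a"
  where "has_ends ((m + n + 1) * q + \<rho>) (D + \<rho> + (m + n) * q) (A + \<rho> + m * q) (B + m * q) g"
proof -
  define d' where "d' = D + \<rho> + (m + n) * q"
  note \<eta>' = has_endsD[OF \<eta>]
  have A: "A < q - \<rho>" by (rule has_ends_first_less[OF \<eta>]) simp
  have B: "D < B + (q - \<rho>)" by (rule has_ends_last_greater[OF \<eta>]) (use D in auto)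
  \<comment> \<open>Otherwise the zeros after \<open>B\<close> would join with those before
    \<open>A\<close>, moved by one period, to a run of \<open>q - \<rho>\<close> zeros.\<close>
  have AB: "A + \<rho> \<le> B"
  proof (rule ccontr)
    assume "\<not> A + \<rho> \<le> B"
    have "\<eta> A = 0"
    proof (rule dker_eq_0[OF \<eta>'(1)])
      fix k assume "k < q - \<rho>"
      with \<open>\<not> A + \<rho> \<le> B\<close> have k: "Suc B + k < A + q" using \<rho> by linarith
      show "\<eta> (Suc B + k) = 0"
      proof (cases "Suc B + k < q")
        case True
        thus ?thesis using D by (intro \<eta>'(6)) auto
      next
        case False
        have "\<eta> (Suc B + k - q + q) = \<eta> (Suc B + k - q)"
          by (rule dker_periodic[OF \<eta>'(1)]) simp
        also have "\<dots> = 0" using k False by (intro \<eta>'(2)) simp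
        finally show ?thesis using False by simp
      qed
    qed simp
    with \<eta>'(3) show False by simp
  qed
  obtain h0 where h0: "(fdiff ^^ \<rho>) h0 = \<eta>" using fdiff_antiderivative by blast
  \<comment> \<open>Antiderivatives are determined up to solutions for exponent \<rho>. This freedom
    makes \<open>h\<close> vanish at the \<rho> positions after \<open>B\<close>, from where the
    recursion with right hand side \<eta> carries the zeros on to \<open>D + \<rho>\<close>.\<close>
  obtain \<delta> :: "nat \<Rightarrow> 'a" where \<delta>: "dker \<rho> \<delta>" "\<And>k. k < \<rho> \<Longrightarrow> \<delta> (Suc B + k) = h0 (Suc B + k)"
    using dker_interpolation_from[of \<rho> "Suc B" h0] \<rho> by auto
  define h where "h = (\<lambda>i. h0 i - \<delta> i)"
  have h: "(fdiff ^^ \<rho>) h i = \<eta> i" for i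
    using \<delta>(1) by (simp add: h_def fdiff_minus h0 dker_def)
  \<comment> \<open>The exponents add up to \<open>q\<close>, so \<open>h\<close> has period
    \<open>q\<close> and depends on the residue only.\<close>
  have h_dker: "dker q h"
    using dker_fdiff[of "q - \<rho>" \<rho> h] h \<eta>'(1) \<rho> by (metis (no_types) ext less_imp_le_nat le_add_diff_inverse2)
  have h_zero: "h (Suc B + k) = 0" if "k < D + \<rho> - B" for k
    using that
  proof (induction k rule: less_induct)
    case (less k)
    show ?case
    proof (cases "k < \<rho>")
      case True
      thus ?thesis using \<delta>(2) by (simp add: h_def)
    next
      case False
      have "(fdiff ^^ \<rho>) h (Suc B + (k - \<rho>)) = h (Suc B + (k - \<rho>) + \<rho>)"
      proof (rule fdiff_last)
        fix k' assume "k' < \<rho>"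
        thus "h (Suc B + (k - \<rho>) + k') = 0"
          using less.IH[of "k - \<rho> + k'"] less.prems False by (simp add: add.assoc)
      qed
      also have "(fdiff ^^ \<rho>) h (Suc B + (k - \<rho>)) = 0"
        unfolding h using less.prems False \<eta>'(5) by (intro \<eta>'(6)) auto
      finally show ?thesis using False by simp
    qed
  qed
  have h_zero': "h l = 0" if "B < l" "l \<le> D + \<rho>" for l
    using h_zero[of "l - Suc B"] that by simp
  have hB: "h B \<noteq> 0"
  proof -
    have "(fdiff ^^ \<rho>) h B = (-1) ^ \<rho> * h B"
      using \<eta>'(5) by (intro fdiff_first h_zero') auto
    with h \<eta>'(4) show ?thesis by auto
  qed
  obtain \<epsilon> :: "nat \<Rightarrow> 'a" where \<epsilon>: "dker \<rho> \<epsilon>" "\<And>k. k < \<rho> \<Longrightarrow> \<epsilon> k = h k"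
    using dker_interpolation[of \<rho> h] by blast
  define u where "u = (\<lambda>i. h i - \<epsilon> i)"
  have u: "(fdiff ^^ \<rho>) u i = \<eta> i" for i
    using \<epsilon>(1) h by (simp add: u_def fdiff_minus dker_def)
  have u_zero: "u i = 0" if "i < A + \<rho>" for i
    using that
  proof (induction i rule: less_induct)
    case (less i)
    show ?case
    proof (cases "i < \<rho>")
      case False
      have "(fdiff ^^ \<rho>) u (i - \<rho>) = u (i - \<rho> + \<rho>)"
        using less False by (intro fdiff_last) auto
      thus ?thesis using u \<eta>'(2)[of "i - \<rho>"] less.prems False by simp
    qed (use \<epsilon>(2) in \<open>simp add: u_def\<close>)
  qed
  have uA: "u (A + \<rho>) \<noteq> 0"
    using fdiff_last[of \<rho> u A] u_zero u[of A] \<eta>'(3) by auto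
  define c where "c i = (D + \<rho> - i) div q" for i
  \<comment> \<open>If \<open>c i = 0\<close>, the residue \<open>i\<close> occurs at a single
    digit, where the affine factor equals its constant term. The term with \<open>u\<close> is then
    0, which is right outside the interval from \<open>A + \<rho>\<close> to \<open>B\<close> but
    would spoil its ends; residues inside get the value 1 instead.\<close>
  define free where "free i \<longleftrightarrow> c i = 0 \<and> A + \<rho> \<le> i \<and> i \<le> B" for i
  \<comment> \<open>At digit \<open>m\<close> the factor is \<open>c i * u i\<close>, and
    \<open>c i\<close> digits later it is \<open>c i * (u i + \<epsilon> i) = c i * h i\<close>.
    Scaling by \<open>c i\<close> makes the slope exactly \<epsilon>, without a division.\<close>
  define f where "f i j = \<epsilon> i * (of_nat j - of_nat m) + (if free i then 1 else of_nat (c i) * u i)"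
    for i j
  define g where "g = (\<lambda>i. cutoff d' m n (i mod q) (i div q) * f (i mod q) (i div q))"
  have "has_lead (m + n + 1) (\<epsilon> i) (\<lambda>j. cutoff d' m n i j * f i j)" for i
    unfolding f_def by (intro has_lead_cutoff_mult has_lead_affine)
  hence dker: "dker ((m + n + 1) * q + \<rho>) g"
    unfolding g_def using \<rho>
    by (intro dker_digits[OF \<epsilon>(1), of "m + n + 1" "\<lambda>i j. cutoff d' m n i j * f i j"]) auto
  have outside: "g j = 0" if "j \<le> d'" "j < m * q \<or> d' < j + n * q" for j
    using cutoff_eq_0[OF that] by (simp add: g_def)
  have inside: "g (l + m * q) = 0 \<longleftrightarrow> f (l mod q) (l div q + m) = 0" if "l \<le> D + \<rho>" for l
    using cutoff_neq_0[of d' m "l + m * q" n] d that q_pos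
    by (simp add: g_def d'_def algebra_simps)
  have h_mod: "h (l mod q) = h l" for l by (rule dker_mod[OF h_dker]) simp
  have f_eq: "f (l mod q) (l div q + m) = of_nat (c (l mod q)) * h (l mod q)"
    if "l div q = c (l mod q)" "\<not> free (l mod q)" for l
    using that by (simp add: f_def u_def algebra_simps)
  \<comment> \<open>From \<open>B\<close> on, adding \<open>q\<close> leaves the window
    \<open>{..D + \<rho>}\<close>, since \<open>D < B + (q - \<rho>)\<close>; so every such position
    carries the last digit of its residue.\<close>
  have top: "l div q = c (l mod q)" if "B \<le> l" "l \<le> D + \<rho>" for l
  proof -
    have "l div q + 0 \<le> c (l mod q)"
      unfolding c_def digit_le_iff[OF that(2)] using that by simp
    moreover have "\<not> l div q + 1 \<le> c (l mod q)"
      unfolding c_def digit_le_iff[OF that(2)] using that B \<rho> by simp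
    ultimately show ?thesis by simp
  qed
  have low: "g j = 0" if j: "j < A + \<rho> + m * q" for j
  proof (cases "j < m * q")
    case True
    thus ?thesis using outside[of j] by (simp add: d'_def algebra_simps)
  next
    case False
    define l where "l = j - m * q"
    have l: "l < A + \<rho>" "j = l + m * q" using j False by (auto simp: l_def)
    have "l < q" using l A by simp
    hence "f (l mod q) (l div q + m) = 0"
      using l u_zero by (simp add: f_def free_def)
    thus ?thesis using inside[of l] l \<eta>'(5,7) by simp
  qed
  have high: "g j = 0" if j: "B + m * q < j" "j \<le> d'" for j
  proof (cases "d' < j + n * q")
    case False
    define l where "l = j - m * q"
    have l: "l \<le> D + \<rho>" "B < l" "j = l + m * q" using j False by (auto simp: l_def d'_def algebra_simps)
    have t: "l div q = c (l mod q)" using top l by simp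
    \<comment> \<open>A free residue occurs only at digit 0, so \<open>l\<close> would be that
      residue itself and yet lie beyond \<open>B\<close>.\<close>
    have "\<not> free (l mod q)"
      using t l by (auto simp: free_def div_eq_0_iff)
    hence "f (l mod q) (l div q + m) = 0"
      using f_eq[OF t] h_mod[of l] h_zero'[of l] l by simp
    thus ?thesis using inside l by simp
  qed (use outside j in simp)
  have c_CHAR: "c i < CHAR('a)" for i
  proof -
    have "(D + \<rho>) < CHAR('a) * q" using d by simp
    hence "D + \<rho> - i < CHAR('a) * q" by linarith
    thus ?thesis unfolding c_def using q_pos by (simp add: div_less_iff_less_mult)
  qed
  have c_unit: "of_nat (c i) \<noteq> (0 :: 'a)" if "c i \<noteq> 0" for i
    using of_nat_eq_less_CHAR[of "c i" 0] c_CHAR[of i] that by auto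
  have first: "g (A + \<rho> + m * q) \<noteq> 0"
  proof -
    have Aq: "A + \<rho> < q" using A by simp
    hence "f ((A + \<rho>) mod q) ((A + \<rho>) div q + m) \<noteq> 0"
      using uA c_unit[of "A + \<rho>"] AB by (simp add: f_def free_def)
    thus ?thesis using inside[of "A + \<rho>"] \<eta>'(5,7) by simp
  qed
  have last: "g (B + m * q) \<noteq> 0"
  proof -
    have t: "B div q = c (B mod q)" using top \<eta>'(5) by simp
    have "f (B mod q) (B div q + m) \<noteq> 0"
    proof (cases "c (B mod q) = 0")
      case True
      hence "B < q" using t q_pos by (auto simp: div_eq_0_iff)
      with True AB show ?thesis by (simp add: f_def free_def)
    next
      case False
      thus ?thesis using f_eq[OF t] c_unit hB h_mod[of B] by (simp add: free_def)
    qed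
    thus ?thesis using inside[of B] \<eta>'(5) by simp
  qed
  show ?thesis
  proof (rule that[of g])
    show "has_ends ((m + n + 1) * q + \<rho>) (D + \<rho> + (m + n) * q) (A + \<rho> + m * q) (B + m * q) g"
      unfolding has_ends_def d'_def[symmetric]
      using dker low high first last \<eta>'(5) by (auto simp: d'_def algebra_simps)
  qed
qed

end

section \<open>The structure sheaf and its twists\<close>

lemma homog_add: "homog n f \<Longrightarrow> homog n g \<Longrightarrow> homog n (f + g)"
  unfolding homog_def by (metis add.right_neutral coeff_add)

lemma homog_0: "homog n 0"
  by (simp add: homog_def)

lemma homog_const: "homog 0 [:[:c:]:]"
  by (auto simp: homog_def coeff_pCons split: nat.splits)

lemma homog_1: "homog 0 1"
  using homog_const[of 1] by (simp flip: one_pCons)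

lemma homog_xvar: "homog 1 xvar"
  by (auto simp: homog_def xvar_def coeff_pCons split: nat.splits)

lemma homog_yvar: "homog 1 yvar"
  by (auto simp: homog_def yvar_def coeff_pCons split: nat.splits if_splits)

lemma homog_mult:
  assumes "homog m f" "homog n g"
  shows "homog (m + n) (f * g)"
  unfolding homog_def
proof (intro allI impI)
  fix i j assume "coeff (coeff (f * g) j) i \<noteq> 0"
  hence "(\<Sum>j'\<le>j. \<Sum>i'\<le>i. coeff (coeff f j') i' * coeff (coeff g (j - j')) (i - i')) \<noteq> 0"
    by (simp add: coeff_mult coeff_sum)
  then obtain i' j' where ij: "i' \<le> i" "j' \<le> j"
      "coeff (coeff f j') i' \<noteq> 0" "coeff (coeff g (j - j')) (i - i') \<noteq> 0"
    by (metis (no_types, lifting) atMost_iff mult_eq_0_iff sum.neutral)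
  have "int i' + int j' = m" "int (i - i') + int (j - j') = n"
    using ij(3,4) assms unfolding homog_def by blast+
  with ij(1,2) show "int i + int j = m + n" by linarith
qed

lemma homog_power: "homog n f \<Longrightarrow> homog (int k * n) (f ^ k)"
proof (induction k)
  case (Suc k)
  from homog_mult[OF Suc.prems Suc.IH[OF Suc.prems]] show ?case by (simp add: algebra_simps)
qed (simp add: homog_1)

lemma Proj1_prime: "P \<in> Proj1 \<Longrightarrow> f * g \<in> P \<longleftrightarrow> f \<in> P \<or> g \<in> P"
  unfolding Proj1_def homog_prime_def by (metis (no_types, lifting) mem_Collect_eq mult.commute)

lemma Proj1_zero: "P \<in> Proj1 \<Longrightarrow> 0 \<in> P"
  by (simp add: Proj1_def homog_prime_def)

lemma Proj1_one: "P \<in> Proj1 \<Longrightarrow> 1 \<notin> P"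
  by (simp add: Proj1_def homog_prime_def)

lemma Proj1_power:
  assumes "P \<in> Proj1" "f \<notin> P"
  shows "f ^ k \<notin> P"
  using assms by (induction k) (auto simp: Proj1_prime Proj1_one)

text \<open>x and y generate the irrelevant ideal, since a polynomial without constant term is a
  combination of them.\<close>

lemma Proj1_cover:
  assumes P: "P \<in> Proj1"
  shows "xvar \<notin> P \<or> yvar \<notin> P"
proof (rule ccontr)
  assume "\<not> (xvar \<notin> P \<or> yvar \<notin> P)"
  hence *: "xvar \<in> P" "yvar \<in> P" by auto
  have "f \<in> P" if "homog_part 0 f = 0" for f
  proof -
    obtain a g where f: "f = pCons a g" by (cases f)
    obtain c b where a: "a = pCons c b" by (cases a)
    have "c = 0" using that by (simp add: homog_part_def f a)
    hence "f = [:b:] * xvar + g * yvar"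
      by (simp add: f a xvar_def yvar_def)
    moreover have "[:b:] * xvar \<in> P" "g * yvar \<in> P"
      unfolding Proj1_prime[OF P] using * by auto
    ultimately show ?thesis using P by (auto simp: Proj1_def homog_prime_def)
  qed
  with P show False by (auto simp: Proj1_def)
qed

lemma zariski_open_Proj1: "zariski_open V \<Longrightarrow> P \<in> V \<Longrightarrow> P \<in> Proj1"
  by (auto simp: zariski_open_def)

lemma zariski_open_basic: "homog n f \<Longrightarrow> zariski_open {P \<in> Proj1. f \<notin> P}"
  unfolding zariski_open_def by (rule exI[of _ "{f}"]) auto

lemma zariski_open_Int:
  assumes "zariski_open V" "zariski_open W"
  shows "zariski_open (V \<inter> W)"
proof -
  from assms obtain E F where E: "\<forall>f\<in>E. \<exists>n. homog n f" "V = {P \<in> Proj1. \<not> E \<subseteq> P}"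
    and F: "\<forall>f\<in>F. \<exists>n. homog n f" "W = {P \<in> Proj1. \<not> F \<subseteq> P}"
    unfolding zariski_open_def by blast
  let ?G = "(\<lambda>(f, g). f * g) ` (E \<times> F)"
  have "\<forall>f\<in>?G. \<exists>n. homog n f" using E(1) F(1) homog_mult by fast
  moreover have "V \<inter> W = {P \<in> Proj1. \<not> ?G \<subseteq> P}"
    unfolding E(2) F(2) by (auto simp: Proj1_prime)
  ultimately show ?thesis unfolding zariski_open_def by blast
qed

text \<open>Gluing for O(n). The algebra of sections below is done with fixed fractions on a
  neighbourhood and returned to \<open>V\<close> through this lemma.\<close>

lemma twist_sections_local:
  assumes "\<And>P. P \<notin> V \<Longrightarrow> s P = 0"
    and "\<And>P. P \<in> V \<Longrightarrow> \<exists>W s'. zariski_open W \<and> P \<in> W \<and> W \<subseteq> V \<and> s' \<in> twist_sections n W \<and>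
           (\<forall>Q\<in>W. s Q = s' Q)"
  shows "s \<in> twist_sections n V"
  unfolding twist_sections_def
proof (intro CollectI conjI ballI allI impI)
  fix P assume "P \<in> V"
  with assms(2) obtain W s' where W: "zariski_open W" "P \<in> W" "W \<subseteq> V" "s' \<in> twist_sections n W"
      "\<forall>Q\<in>W. s Q = s' Q" by blast
  from W(4) have "\<forall>P\<in>W. \<exists>W'. zariski_open W' \<and> P \<in> W' \<and> W' \<subseteq> W \<and>
      (\<exists>a b m. homog (m + n) a \<and> homog m b \<and> (\<forall>Q\<in>W'. b \<notin> Q \<and> s' Q = Fract a b))"
    by (simp add: twist_sections_def)
  with W(2) obtain W' a b m where W': "zariski_open W'" "P \<in> W'" "W' \<subseteq> W"
      "homog (m + n) a" "homog m b" "\<forall>Q\<in>W'. b \<notin> Q \<and> s' Q = Fract a b"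
    by meson
  moreover have "\<forall>Q\<in>W'. b \<notin> Q \<and> s Q = Fract a b" using W' W(5) by auto
  moreover have "W' \<subseteq> V" using W' W(3) by auto
  ultimately show "\<exists>W. zariski_open W \<and> P \<in> W \<and> W \<subseteq> V \<and>
      (\<exists>a b m. homog (m + n) a \<and> homog m b \<and> (\<forall>Q\<in>W. b \<notin> Q \<and> s Q = Fract a b))"
    by meson
qed (use assms(1) in auto)

lemma twist_sectionsD:
  assumes "s \<in> twist_sections n V" "P \<in> V"
  obtains W a b m where "zariski_open W" "P \<in> W" "W \<subseteq> V" "homog (m + n) a" "homog m b"
    "\<And>Q. Q \<in> W \<Longrightarrow> b \<notin> Q" "\<And>Q. Q \<in> W \<Longrightarrow> s Q = Fract a b"
proof -
  from assms(1) have "\<forall>P\<in>V. \<exists>W. zariski_open W \<and> P \<in> W \<and> W \<subseteq> V \<and>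
      (\<exists>a b m. homog (m + n) a \<and> homog m b \<and> (\<forall>Q\<in>W. b \<notin> Q \<and> s Q = Fract a b))"
    by (simp add: twist_sections_def)
  with assms(2) that show ?thesis by meson
qed

lemma twist_sections_outside: "s \<in> twist_sections n V \<Longrightarrow> P \<notin> V \<Longrightarrow> s P = 0"
  by (simp add: twist_sections_def)

lemma twist_sections_fraction:
  assumes "zariski_open V" "homog (m + n) a" "homog m b" "\<And>Q. Q \<in> V \<Longrightarrow> b \<notin> Q"
  shows "(\<lambda>P. if P \<in> V then Fract a b else 0) \<in> twist_sections n V"
  unfolding twist_sections_def
proof (intro CollectI conjI ballI)
  fix P assume "P \<in> V"
  with assms show "\<exists>W. zariski_open W \<and> P \<in> W \<and> W \<subseteq> V \<and> (\<exists>a' b' m. homog (m + n) a' \<and> homog m b' \<and>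
      (\<forall>Q\<in>W. b' \<notin> Q \<and> (if Q \<in> V then Fract a b else 0) = Fract a' b'))"
    by (intro exI[of _ V] conjI exI[of _ a] exI[of _ b] exI[of _ m]) auto
qed auto

lemma twist_sections_restrict:
  assumes "s \<in> twist_sections n V" "zariski_open W" "W \<subseteq> V"
  shows "(\<lambda>P. if P \<in> W then s P else 0) \<in> twist_sections n W"
proof (rule twist_sections_local)
  fix P assume "P \<in> W"
  with assms(3) have "P \<in> V" by blast
  from twist_sectionsD[OF assms(1) this] obtain W' a b m where *: "zariski_open W'" "P \<in> W'" "W' \<subseteq> V"
    "homog (m + n) a" "homog m b" "\<And>Q. Q \<in> W' \<Longrightarrow> b \<notin> Q" "\<And>Q. Q \<in> W' \<Longrightarrow> s Q = Fract a b" by metis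
  show "\<exists>W'' s'. zariski_open W'' \<and> P \<in> W'' \<and> W'' \<subseteq> W \<and> s' \<in> twist_sections n W'' \<and>
      (\<forall>Q\<in>W''. (if Q \<in> W then s Q else 0) = s' Q)"
    using * \<open>P \<in> W\<close> zariski_open_Int[OF assms(2) *(1)]
      twist_sections_fraction[OF zariski_open_Int[OF assms(2) *(1)] *(4,5)]
    by (intro exI[of _ "W \<inter> W'"] exI[of _ "\<lambda>P. if P \<in> W \<inter> W' then Fract a b else 0"]) auto
qed simp

lemma twist_sections_0: "zariski_open V \<Longrightarrow> (\<lambda>_. 0) \<in> twist_sections n V"
  using twist_sections_fraction[of V 0 n 0 1]
  by (simp add: homog_0 homog_1 Proj1_one zariski_open_Proj1 fract_collapse cong: if_cong)

lemma twist_sections_add: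
  assumes s: "s \<in> twist_sections n V" and s': "s' \<in> twist_sections n V"
  shows "(\<lambda>P. s P + s' P) \<in> twist_sections n V"
proof (rule twist_sections_local)
  fix P assume P: "P \<in> V"
  from twist_sectionsD[OF s P] obtain W a b m where *: "zariski_open W" "P \<in> W" "W \<subseteq> V"
    "homog (m + n) a" "homog m b" "\<And>Q. Q \<in> W \<Longrightarrow> b \<notin> Q" "\<And>Q. Q \<in> W \<Longrightarrow> s Q = Fract a b" by metis
  from twist_sectionsD[OF s' P] obtain W' a' b' m' where **: "zariski_open W'" "P \<in> W'" "W' \<subseteq> V"
    "homog (m' + n) a'" "homog m' b'" "\<And>Q. Q \<in> W' \<Longrightarrow> b' \<notin> Q" "\<And>Q. Q \<in> W' \<Longrightarrow> s' Q = Fract a' b'"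
    by metis
  let ?W = "W \<inter> W'"
  have W: "zariski_open ?W" using * ** by (intro zariski_open_Int)
  have hom: "homog (m + m' + n) (a * b' + a' * b)" "homog (m + m') (b * b')"
    using homog_mult[OF *(4) **(5)] homog_mult[OF **(4) *(5)] homog_mult[OF *(5) **(5)]
    by (auto intro!: homog_add simp: algebra_simps)
  have nz: "b \<noteq> 0" "b' \<noteq> 0" "b * b' \<notin> Q" if "Q \<in> ?W" for Q
    using that *(6)[of Q] **(6)[of Q] zariski_open_Proj1[OF W that] by (auto simp: Proj1_prime Proj1_zero)
  show "\<exists>W t. zariski_open W \<and> P \<in> W \<and> W \<subseteq> V \<and> t \<in> twist_sections n W \<and>
      (\<forall>Q\<in>W. s Q + s' Q = t Q)"
    using W *(2,3) **(2) nz *(7) **(7) twist_sections_fraction[OF W hom nz(3)]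
    by (intro exI[of _ ?W] exI[of _ "\<lambda>P. if P \<in> ?W then Fract (a * b' + a' * b) (b * b') else 0"])
      auto
qed (use assms in \<open>simp add: twist_sections_outside\<close>)

lemma twist_sections_mult:
  assumes s: "s \<in> twist_sections n V" and s': "s' \<in> twist_sections n' V"
  shows "(\<lambda>P. s P * s' P) \<in> twist_sections (n + n') V"
proof (rule twist_sections_local)
  fix P assume P: "P \<in> V"
  from twist_sectionsD[OF s P] obtain W a b m where *: "zariski_open W" "P \<in> W" "W \<subseteq> V"
    "homog (m + n) a" "homog m b" "\<And>Q. Q \<in> W \<Longrightarrow> b \<notin> Q" "\<And>Q. Q \<in> W \<Longrightarrow> s Q = Fract a b" by metis
  from twist_sectionsD[OF s' P] obtain W' a' b' m' where **: "zariski_open W'" "P \<in> W'" "W' \<subseteq> V"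
    "homog (m' + n') a'" "homog m' b'" "\<And>Q. Q \<in> W' \<Longrightarrow> b' \<notin> Q" "\<And>Q. Q \<in> W' \<Longrightarrow> s' Q = Fract a' b'"
    by metis
  let ?W = "W \<inter> W'"
  have W: "zariski_open ?W" using * ** by (intro zariski_open_Int)
  have hom: "homog (m + m' + (n + n')) (a * a')" "homog (m + m') (b * b')"
    using homog_mult[OF *(4) **(4)] homog_mult[OF *(5) **(5)] by (auto simp: algebra_simps)
  have nz: "b * b' \<notin> Q" if "Q \<in> ?W" for Q
    using that *(6)[of Q] **(6)[of Q] zariski_open_Proj1[OF W that] by (auto simp: Proj1_prime)
  show "\<exists>W t. zariski_open W \<and> P \<in> W \<and> W \<subseteq> V \<and> t \<in> twist_sections (n + n') W \<and>
      (\<forall>Q\<in>W. s Q * s' Q = t Q)"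
    using W *(2,3) **(2) *(7) **(7) twist_sections_fraction[OF W hom nz]
    by (intro exI[of _ ?W] exI[of _ "\<lambda>P. if P \<in> ?W then Fract (a * a') (b * b') else 0"]) auto
qed (use assms in \<open>simp add: twist_sections_outside\<close>)

lemma twist_sections_sum:
  assumes "zariski_open V" "\<And>x. x \<in> X \<Longrightarrow> s x \<in> twist_sections n V"
  shows "(\<lambda>P. \<Sum>x\<in>X. s x P) \<in> twist_sections n V"
  using assms(2)
  by (induction X rule: infinite_finite_induct)
    (auto intro: twist_sections_0[OF assms(1)] twist_sections_add)

lemma twist_sections_scalar:
  "s \<in> twist_sections n V \<Longrightarrow> (\<lambda>P. scalar c * s P) \<in> twist_sections n V"
  using twist_sections_mult_homog[OF _ homog_const, of s n V c] by (simp add: scalar_def)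

text \<open>Where the linear form \<open>h\<close> has no zero it trivializes O(1), so all its
  integer powers are sections of the corresponding twists.\<close>

lemma twist_sections_powi:
  assumes V: "zariski_open V" and h: "homog 1 h" "\<And>P. P \<in> V \<Longrightarrow> h \<notin> P"
  shows "(\<lambda>P. if P \<in> V then Fract h 1 powi k else 0) \<in> twist_sections k V"
proof (cases "k \<ge> 0")
  case True
  have pow: "Fract h 1 ^ n = Fract (h ^ n) 1" for n
    by (induction n) (simp_all add: One_fract_def)
  have "homog (0 + k) (h ^ nat k)" using homog_power[OF h(1), of "nat k"] True by simp
  from twist_sections_fraction[OF V this homog_1] True show ?thesis
    by (simp add: power_int_def pow Proj1_one zariski_open_Proj1[OF V] cong: if_cong)
next
  case False
  have pow: "Fract 1 h ^ n = Fract 1 (h ^ n)" for n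
    by (induction n) (simp_all add: One_fract_def)
  have "homog (- k) (h ^ nat (- k))" using homog_power[OF h(1), of "nat (- k)"] False by simp
  from twist_sections_fraction[OF V, of "- k" k 1, OF _ this] False show ?thesis
    by (simp add: power_int_def pow Proj1_power h(2) zariski_open_Proj1[OF V] homog_1 cong: if_cong)
qed

lemma twist_sections_powi_mult:
  assumes V: "zariski_open V" and h: "homog 1 h" "\<And>P. P \<in> V \<Longrightarrow> h \<notin> P"
    and s: "s \<in> twist_sections n V"
  shows "(\<lambda>P. Fract h 1 powi k * s P) \<in> twist_sections (n + k) V"
proof -
  have "(\<lambda>P. s P * (if P \<in> V then Fract h 1 powi k else 0)) = (\<lambda>P. Fract h 1 powi k * s P)"
    using twist_sections_outside[OF s] by auto
  with twist_sections_mult[OF s twist_sections_powi[OF V h], of k] show ?thesis by simp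
qed

section \<open>Scalars and the torus action on the function field\<close>

lemma scalar_simps:
  "scalar 0 = 0" "scalar 1 = 1" "scalar (a + b) = scalar a + scalar b"
  "scalar (a * b) = scalar a * scalar b" "scalar (- a) = - scalar a"
  by (simp_all add: scalar_def fract_collapse flip: one_pCons)

lemma scalar_eq_0_iff: "scalar c = 0 \<longleftrightarrow> c = 0"
  by (simp add: scalar_def Zero_fract_def eq_fract)

lemma scalar_power: "scalar (c ^ n) = scalar c ^ n"
  by (induction n) (simp_all add: scalar_simps)

lemma scalar_inverse: "scalar (inverse c) = inverse (scalar c)"
proof (cases "c = 0")
  case False
  hence "scalar c * scalar (inverse c) = 1" by (simp flip: scalar_simps)
  thus ?thesis by (metis inverse_unique)
qed (simp add: scalar_simps)

lemma scalar_powi: "scalar (c powi n) = scalar c powi n"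
  by (simp add: power_int_def scalar_power scalar_inverse)

lemma scalar_of_nat: "scalar (of_nat n) = of_nat n"
  by (induction n) (simp_all add: scalar_simps)

lemma scalar_sum: "scalar (\<Sum>x\<in>X. f x) = (\<Sum>x\<in>X. scalar (f x))"
  by (induction X rule: infinite_finite_induct) (simp_all add: scalar_simps)

lemma tsym_add: "tsym t (f + g) = tsym t f + tsym t g"
  by (intro poly_eqI) (simp add: coeff_tsym algebra_simps)

lemma tsym_const: "tsym t [:[:c:]:] = [:[:c:]:]"
  by (intro poly_eqI) (auto simp: coeff_tsym coeff_pCons split: nat.splits)

lemma tsym_1: "tsym t 1 = 1"
  using tsym_const[of t 1] by (simp flip: one_pCons)

lemma tsym_xvar: "tsym t xvar = [:[:fst t:]:] * xvar"
  by (intro poly_eqI) (auto simp: coeff_tsym xvar_def coeff_pCons split: nat.splits)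

lemma tsym_yvar: "tsym t yvar = [:[:snd t:]:] * yvar"
  by (intro poly_eqI) (auto simp: coeff_tsym yvar_def coeff_pCons one_pCons split: nat.splits)

context
  fixes t :: "'k::field \<times> 'k"
  assumes t: "fst t \<noteq> 0" "snd t \<noteq> 0"
begin

lemma tfrac_Fract_1: "tfrac t (Fract a 1) = Fract (tsym t a) 1"
  using tfrac_Fract[OF t, of 1 a] by (simp add: tsym_1)

lemma tfrac_scalar: "tfrac t (scalar c) = scalar c"
  by (simp add: scalar_def tfrac_Fract_1 tsym_const)

lemma tfrac_0: "tfrac t 0 = 0" and tfrac_1: "tfrac t 1 = 1"
  using tfrac_scalar[of 0] tfrac_scalar[of 1] by (simp_all add: scalar_simps)

lemma tfrac_mult: "tfrac t (a * b) = tfrac t a * tfrac t b"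
  by (cases a rule: Fract_cases; cases b rule: Fract_cases) (simp add: tfrac_Fract[OF t] tsym_mult)

lemma tfrac_add: "tfrac t (a + b) = tfrac t a + tfrac t b"
  by (cases a rule: Fract_cases; cases b rule: Fract_cases)
    (simp add: tfrac_Fract[OF t] tsym_mult tsym_add tsym_eq_0_iff[OF t])

lemma tfrac_sum: "tfrac t (\<Sum>x\<in>X. f x) = (\<Sum>x\<in>X. tfrac t (f x))"
  by (induction X rule: infinite_finite_induct) (simp_all add: tfrac_0 tfrac_add)

lemma tfrac_power: "tfrac t (a ^ n) = tfrac t a ^ n"
  by (induction n) (simp_all add: tfrac_1 tfrac_mult)

lemma tfrac_inverse: "tfrac t (inverse a) = inverse (tfrac t a)"
proof (cases "a = 0")
  case False
  hence "tfrac t a * tfrac t (inverse a) = 1" by (simp add: tfrac_1 flip: tfrac_mult)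
  thus ?thesis by (metis inverse_unique)
qed (simp add: tfrac_0)

lemma tfrac_powi: "tfrac t (a powi n) = tfrac t a powi n"
  by (simp add: power_int_def tfrac_power tfrac_inverse)

lemma tfrac_xvar: "tfrac t (Fract xvar 1) = scalar (fst t) * Fract xvar 1"
  by (simp add: scalar_def tfrac_Fract_1 tsym_xvar)

lemma tfrac_yvar: "tfrac t (Fract yvar 1) = scalar (snd t) * Fract yvar 1"
  by (simp add: scalar_def tfrac_Fract_1 tsym_yvar)

end

lemma Fract_xvar_nonzero: "Fract xvar 1 \<noteq> 0"
  by (simp add: Zero_fract_def eq_fract xvar_def)

lemma Fract_yvar_nonzero: "Fract yvar 1 \<noteq> 0"
  by (simp add: Zero_fract_def eq_fract yvar_def)

section \<open>Equivariant splittings into line bundles\<close>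

text \<open>A frame of \<open>M\<close> consists of \<open>T\<close>-eigenvectors \<open>G i\<close> with coordinates in \<open>K\<close>, of weight \<open>w i\<close>, such that \<open>M\<close> is
  the direct sum of the subsheaves \<open>O(n i) \<sqdot> G i\<close>.\<close>

definition frame :: "('j, 'k::field) esheaf \<Rightarrow> 'i set \<Rightarrow> ('i \<Rightarrow> int \<times> int) \<Rightarrow> ('i \<Rightarrow> int) \<Rightarrow>
    ('i \<Rightarrow> 'j \<Rightarrow> 'k poly poly fract) \<Rightarrow> bool" where
  "frame M I w n G \<longleftrightarrow> finite I \<and>
     (\<forall>V s. zariski_open V \<longrightarrow> s \<in> sect M V \<longleftrightarrow>
        (\<exists>c. (\<forall>i\<in>I. (\<lambda>P. c P i) \<in> twist_sections (n i) V) \<and> s = (\<lambda>P j. \<Sum>i\<in>I. G i j * c P i))) \<and>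
     (\<forall>c. (\<forall>j. (\<Sum>i\<in>I. G i j * c i) = 0) \<longrightarrow> (\<forall>i\<in>I. c i = 0)) \<and>
     (\<forall>t i j. fst t \<noteq> 0 \<and> snd t \<noteq> 0 \<and> i \<in> I \<longrightarrow>
        scalar (character (wt M j) t) * tfrac t (G i j) = scalar (character (w i) t) * G i j)"

lemma frame_finite: "frame M I w n G \<Longrightarrow> finite I"
  by (simp add: frame_def)

lemma frame_sect:
  "frame M I w n G \<Longrightarrow> zariski_open V \<Longrightarrow> s \<in> sect M V \<longleftrightarrow>
     (\<exists>c. (\<forall>i\<in>I. (\<lambda>P. c P i) \<in> twist_sections (n i) V) \<and> s = (\<lambda>P j. \<Sum>i\<in>I. G i j * c P i))"
  by (simp add: frame_def)

lemma frame_sectE: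
  assumes "frame M I w n G" "zariski_open V" "s \<in> sect M V"
  obtains c where "\<And>i. i \<in> I \<Longrightarrow> (\<lambda>P. c P i) \<in> twist_sections (n i) V"
    "s = (\<lambda>P j. \<Sum>i\<in>I. G i j * c P i)"
  using assms frame_sect by blast

lemma frame_sectI:
  assumes "frame M I w n G" "zariski_open V" "\<And>i. i \<in> I \<Longrightarrow> (\<lambda>P. c P i) \<in> twist_sections (n i) V"
  shows "(\<lambda>P j. \<Sum>i\<in>I. G i j * c P i) \<in> sect M V"
  using assms frame_sect by blast

lemma frame_weight:
  "frame M I w n G \<Longrightarrow> fst t \<noteq> 0 \<Longrightarrow> snd t \<noteq> 0 \<Longrightarrow> i \<in> I \<Longrightarrow>
     scalar (character (wt M j) t) * tfrac t (G i j) = scalar (character (w i) t) * G i j"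
  unfolding frame_def by blast

lemma frame_unique:
  assumes "frame M I w n G" "\<And>j. (\<Sum>i\<in>I. G i j * c i) = (\<Sum>i\<in>I. G i j * c' i)" "i \<in> I"
  shows "c i = c' i"
proof -
  have "(\<Sum>i\<in>I. G i j * (c i - c' i)) = 0" for j
    using assms(2)[of j] by (simp add: algebra_simps sum_subtractf)
  hence "\<forall>i\<in>I. c i - c' i = 0" using assms(1) unfolding frame_def by fast
  with assms(3) show ?thesis by simp
qed

lemma frame_cong:
  assumes "frame M I w n G" "\<And>i. i \<in> I \<Longrightarrow> w i = w' i" "\<And>i. i \<in> I \<Longrightarrow> n i = n' i"
  shows "frame M I w' n' G"
  using assms by (simp add: frame_def cong: conj_cong)

text \<open>The choice is made for each vector \<open>v\<close> and not for each section, so a map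
  defined through it acts pointwise and does not depend on the open set. For a frame, the
  coordinates with index in \<open>I\<close> are unique.\<close>

definition coords :: "'i set \<Rightarrow> ('i \<Rightarrow> 'j \<Rightarrow> 'a::field) \<Rightarrow> ('j \<Rightarrow> 'a) \<Rightarrow> 'i \<Rightarrow> 'a" where
  "coords I G v = (SOME c. v = (\<lambda>j. \<Sum>i\<in>I. G i j * c i))"

lemma coords_eq:
  assumes "frame M I w n G" "i \<in> I"
  shows "coords I G (\<lambda>j. \<Sum>i\<in>I. G i j * c i) i = c i"
proof -
  define v where "v = (\<lambda>j. \<Sum>i\<in>I. G i j * c i)"
  have "\<exists>c. v = (\<lambda>j. \<Sum>i\<in>I. G i j * c i)" unfolding v_def by blast
  hence "v = (\<lambda>j. \<Sum>i\<in>I. G i j * coords I G v i)"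
    unfolding coords_def by (rule someI_ex)
  hence "(\<Sum>i\<in>I. G i j * coords I G v i) = (\<Sum>i\<in>I. G i j * c i)" for j
    unfolding v_def by metis
  from frame_unique[OF assms(1) this assms(2)] show ?thesis unfolding v_def .
qed

lemma frame_coords:
  fixes M :: "('j, 'k::field) esheaf" and I :: "'i set"
  assumes M: "frame M I w n G" and V: "zariski_open V" and s: "s \<in> sect M V"
  shows frame_coords_sections: "i \<in> I \<Longrightarrow> (\<lambda>P. coords I G (s P) i) \<in> twist_sections (n i) V"
    and frame_coords_sum: "s P j = (\<Sum>i\<in>I. G i j * coords I G (s P) i)"
proof -
  obtain c where c: "\<And>i. i \<in> I \<Longrightarrow> (\<lambda>P. c P i) \<in> twist_sections (n i) V"
    and s: "s = (\<lambda>P j. \<Sum>i\<in>I. G i j * c P i)"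
    by (rule frame_sectE[OF M V s]) blast
  have coords: "coords I G (s P) i = c P i" if "i \<in> I" for P i
    unfolding s by (rule coords_eq[OF M that])
  show "i \<in> I \<Longrightarrow> (\<lambda>P. coords I G (s P) i) \<in> twist_sections (n i) V"
    using c by (simp add: coords)
  show "s P j = (\<Sum>i\<in>I. G i j * coords I G (s P) i)"
    by (simp add: coords cong: sum.cong) (simp add: s)
qed

text \<open>Sending \<open>G i\<close> to \<open>G' i\<close> matches summands of equal degree and
  weight. In terms of coefficients, every operation on the two sheaves is given by the same
  formula.\<close>

lemma frame_isomorphic:
  fixes M :: "('j, 'k::field) esheaf" and N :: "('l, 'k) esheaf" and I :: "'i set"
  assumes M: "frame M I w n G" and N: "frame N I w n G'"
  shows "M \<simeq>\<^sub>T N"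
proof -
  define \<Theta> where "\<Theta> v = (\<lambda>j. \<Sum>i\<in>I. G' i j * coords I G v i)" for v
  define \<Theta>' where "\<Theta>' v = (\<lambda>j. \<Sum>i\<in>I. G i j * coords I G' v i)" for v
  define \<phi> where "\<phi> V s = (\<lambda>P. \<Theta> (s P))" for V :: "'k poly poly set set" and s :: "'k poly poly set \<Rightarrow> 'j \<Rightarrow> 'k poly poly fract"
  have \<Theta>: "\<Theta> (\<lambda>j. \<Sum>i\<in>I. G i j * c i) = (\<lambda>j. \<Sum>i\<in>I. G' i j * c i)" for c
    unfolding \<Theta>_def using coords_eq[OF M] by simp
  have \<Theta>': "\<Theta>' (\<lambda>j. \<Sum>i\<in>I. G' i j * c i) = (\<lambda>j. \<Sum>i\<in>I. G i j * c i)" for c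
    unfolding \<Theta>'_def using coords_eq[OF N] by simp
  have \<phi>: "\<phi> V (\<lambda>P j. \<Sum>i\<in>I. G i j * c P i) = (\<lambda>P j. \<Sum>i\<in>I. G' i j * c P i)" for V c
    unfolding \<phi>_def \<Theta> ..
  have "equivariant_iso \<phi> M N"
    unfolding equivariant_iso_def
  proof (intro allI impI conjI ballI; (elim conjE)?)
    fix V :: "'k poly poly set set" assume V: "zariski_open V"
    note M_sect = frame_sectE[OF M V] and N_sect = frame_sectE[OF N V]
    show "bij_betw (\<phi> V) (sect M V) (sect N V)"
    proof (rule bij_betw_byWitness[where f' = "\<lambda>s P. \<Theta>' (s P)"]; intro ballI image_subsetI)
      fix s assume "s \<in> sect M V"
      then obtain c where s: "s = (\<lambda>P j. \<Sum>i\<in>I. G i j * c P i)"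
        and c: "\<And>i. i \<in> I \<Longrightarrow> (\<lambda>P. c P i) \<in> twist_sections (n i) V"
        by (rule M_sect) blast
      show "(\<lambda>P. \<Theta>' (\<phi> V s P)) = s" unfolding s \<phi> \<Theta>' ..
      show "\<phi> V s \<in> sect N V" unfolding s \<phi> by (rule frame_sectI[OF N V c])
    next
      fix s assume "s \<in> sect N V"
      then obtain c where s: "s = (\<lambda>P j. \<Sum>i\<in>I. G' i j * c P i)"
        and c: "\<And>i. i \<in> I \<Longrightarrow> (\<lambda>P. c P i) \<in> twist_sections (n i) V"
        by (rule N_sect) blast
      show "\<phi> V (\<lambda>P. \<Theta>' (s P)) = s" unfolding s \<Theta>' \<phi> ..
      show "(\<lambda>P. \<Theta>' (s P)) \<in> sect M V" unfolding s \<Theta>' by (rule frame_sectI[OF M V c])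
    qed
    {
      fix s s' assume "s \<in> sect M V" "s' \<in> sect M V"
      obtain c where s: "s = (\<lambda>P j. \<Sum>i\<in>I. G i j * c P i)"
        by (rule M_sect[OF \<open>s \<in> sect M V\<close>]) blast
      obtain c' where s': "s' = (\<lambda>P j. \<Sum>i\<in>I. G i j * c' P i)"
        by (rule M_sect[OF \<open>s' \<in> sect M V\<close>]) blast
      have "(\<lambda>P j. s P j + s' P j) = (\<lambda>P j. \<Sum>i\<in>I. G i j * (c P i + c' P i))"
        by (simp add: s s' algebra_simps sum.distrib)
      thus "\<phi> V (\<lambda>P j. s P j + s' P j) = (\<lambda>P j. \<phi> V s P j + \<phi> V s' P j)"
        by (simp only: s s' \<phi>) (simp add: algebra_simps sum.distrib)
    }
    fix s assume "s \<in> sect M V"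
    then obtain c where s: "s = (\<lambda>P j. \<Sum>i\<in>I. G i j * c P i)"
      by (rule M_sect) blast
    {
      fix g :: "'k poly poly set \<Rightarrow> 'k poly poly fract"
      have "(\<lambda>P j. g P * s P j) = (\<lambda>P j. \<Sum>i\<in>I. G i j * (g P * c P i))"
        by (simp add: s algebra_simps sum_distrib_left)
      thus "\<phi> V (\<lambda>P j. g P * s P j) = (\<lambda>P j. g P * \<phi> V s P j)"
        by (simp only: s \<phi>) (simp add: algebra_simps sum_distrib_left)
    }
    {
      fix W
      have "restrict_section W s = (\<lambda>P j. \<Sum>i\<in>I. G i j * (if P \<in> W then c P i else 0))"
        by (auto simp: restrict_section_def s fun_eq_iff)
      thus "\<phi> W (restrict_section W s) = restrict_section W (\<phi> V s)"
        by (simp only: s \<phi>) (auto simp: restrict_section_def fun_eq_iff)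
    }
    fix t :: "'k \<times> 'k" assume t: "fst t \<noteq> 0" "snd t \<noteq> 0"
    \<comment> \<open>Since the frame vectors are eigenvectors, \<open>t\<close> acts on the
      coefficients by a rule that mentions neither the sheaf nor the frame.\<close>
    define c' where "c' Q i = scalar (character (w i) t) * tfrac t (c (tsym t -` Q) i)" for Q i
    have act: "act M t (\<lambda>P j. \<Sum>i\<in>I. G i j * c P i) = (\<lambda>Q j. \<Sum>i\<in>I. G i j * c' Q i)"
      if "frame M I w n G" for M :: "('x, 'k) esheaf" and G
    proof (intro ext)
      fix Q j
      have "act M t (\<lambda>P j. \<Sum>i\<in>I. G i j * c P i) Q j =
          (\<Sum>i\<in>I. (scalar (character (wt M j) t) * tfrac t (G i j)) * tfrac t (c (tsym t -` Q) i))"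
        using t by (simp add: act_def tfrac_sum tfrac_mult sum_distrib_left mult.assoc)
      also have "\<dots> = (\<Sum>i\<in>I. G i j * c' Q i)"
        using t by (intro sum.cong) (simp_all add: frame_weight[OF that] c'_def)
      finally show "act M t (\<lambda>P j. \<Sum>i\<in>I. G i j * c P i) Q j = (\<Sum>i\<in>I. G i j * c' Q i)" .
    qed
    show "\<phi> (translate t V) (act M t s) = act N t (\<phi> V s)"
      unfolding s \<phi> act[OF M] act[OF N] ..
  qed
  thus ?thesis unfolding isomorphic_def by blast
qed

lemma frame_Osheaf: "frame (Osheaf m :: (unit, 'k::field) esheaf) (UNIV :: unit set) (\<lambda>_. (0, 0)) (\<lambda>_. m) (\<lambda>_ _. 1)"
  unfolding frame_def
proof (intro conjI allI impI)
  fix V :: "'k poly poly set set" and s :: "'k poly poly set \<Rightarrow> unit \<Rightarrow> 'k poly poly fract"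
  show "s \<in> sect (Osheaf m) V \<longleftrightarrow> (\<exists>c. (\<forall>i\<in>(UNIV :: unit set). (\<lambda>P. c P i) \<in> twist_sections m V) \<and>
      s = (\<lambda>P j. \<Sum>i\<in>UNIV. 1 * c P i))"
  proof
    assume "s \<in> sect (Osheaf m) V"
    then obtain g where "g \<in> twist_sections m V" "s = (\<lambda>P i. g P)" by (auto simp: Osheaf_def)
    thus "\<exists>c. (\<forall>i\<in>(UNIV :: unit set). (\<lambda>P. c P i) \<in> twist_sections m V) \<and> s = (\<lambda>P j. \<Sum>i\<in>UNIV. 1 * c P i)"
      by (intro exI[of _ "\<lambda>P _. g P"]) (simp add: UNIV_unit del: sum_constant)
  next
    assume "\<exists>c. (\<forall>i\<in>(UNIV :: unit set). (\<lambda>P. c P i) \<in> twist_sections m V) \<and> s = (\<lambda>P j. \<Sum>i\<in>UNIV. 1 * c P i)"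
    then obtain c where "(\<lambda>P. c P ()) \<in> twist_sections m V" "s = (\<lambda>P j. c P ())"
      by (auto simp: UNIV_unit)
    thus "s \<in> sect (Osheaf m) V"
      unfolding Osheaf_def esheaf.simps by (intro image_eqI[of _ _ "\<lambda>P. c P ()"])
  qed
qed (simp_all add: UNIV_unit Osheaf_def tfrac_1)

text \<open>The new frame consists of the tensors of standard basis vectors with the
  \<open>G i\<close>, so weights add and degrees are kept.\<close>

lemma frame_weight_rep:
  fixes M :: "('j, 'k::field) esheaf" and I :: "'i set" and J :: "'l set"
  assumes M: "frame M I w n G" and J: "finite J"
  shows "frame (weight_rep J v \<otimes>\<^sub>k M) (J \<times> I)
    (\<lambda>(l, i). (fst (v l) + fst (w i), snd (v l) + snd (w i))) (\<lambda>(l, i). n i)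
    (\<lambda>(l, i) (l', j). if l' = l then G i j else 0)"
proof -
  define G' :: "'l \<times> 'i \<Rightarrow> 'l \<times> 'j \<Rightarrow> 'k poly poly fract"
    where "G' = (\<lambda>(l, i) (l', j). if l' = l then G i j else 0)"
  have I: "finite I" by (rule frame_finite[OF M])
  have comb: "(\<Sum>x\<in>J \<times> I. G' x (l, j) * c x) = (if l \<in> J then \<Sum>i\<in>I. G i j * c (l, i) else 0)" for l j c
  proof -
    have "(\<Sum>(l', i)\<in>J \<times> I. G' (l', i) (l, j) * c (l', i)) = (\<Sum>l'\<in>J. if l = l' then \<Sum>i\<in>I. G i j * c (l', i) else 0)"
    proof (subst sum.Sigma[symmetric])
      have "(\<Sum>i\<in>I. G' (l', i) (l, j) * c (l', i)) =
          (if l = l' then \<Sum>i\<in>I. G i j * c (l', i) else 0)" for l'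
        by (auto simp: G'_def)
      thus "(\<Sum>l'\<in>J. \<Sum>i\<in>I. G' (l', i) (l, j) * c (l', i)) =
          (\<Sum>l'\<in>J. if l = l' then \<Sum>i\<in>I. G i j * c (l', i) else 0)" by simp
    qed (use I J in auto)
    thus ?thesis using J by (simp add: split_def)
  qed
  have "frame (weight_rep J v \<otimes>\<^sub>k M) (J \<times> I)
    (\<lambda>(l, i). (fst (v l) + fst (w i), snd (v l) + snd (w i))) (\<lambda>(l, i). n i) G'"
    unfolding frame_def
  proof (intro conjI allI impI)
    show "finite (J \<times> I)" using I J by simp
  next
    fix V :: "'k poly poly set set" and s :: "'k poly poly set \<Rightarrow> 'l \<times> 'j \<Rightarrow> 'k poly poly fract"
    assume V: "zariski_open V"
    show "s \<in> sect (weight_rep J v \<otimes>\<^sub>k M) V \<longleftrightarrow>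
        (\<exists>c. (\<forall>x\<in>J \<times> I. (\<lambda>P. c P x) \<in> twist_sections (case x of (l, i) \<Rightarrow> n i) V) \<and>
          s = (\<lambda>P y. \<Sum>x\<in>J \<times> I. G' x y * c P x))" (is "_ \<longleftrightarrow> (\<exists>c. ?Q c)")
    proof
      assume "s \<in> sect (weight_rep J v \<otimes>\<^sub>k M) V"
      then obtain N :: nat and u m
        where um: "\<And>x. x < N \<Longrightarrow> u x \<in> rep_space (weight_rep J v) \<and> m x \<in> sect M V"
          and s: "s = (\<lambda>P (l, j). \<Sum>x<N. scalar (u x l) * m x P j)"
        unfolding rep_tensor_def by auto
      define c where "c x P i = coords I G (m x P) i" for x P i
      have c: "(\<lambda>P. c x P i) \<in> twist_sections (n i) V" if "x < N" "i \<in> I" for x i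
        unfolding c_def using um[OF that(1)] that(2) by (intro frame_coords_sections[OF M V]) auto
      have m: "m x P j = (\<Sum>i\<in>I. G i j * c x P i)" if "x < N" for x P j
        unfolding c_def using um[OF that] by (intro frame_coords_sum[OF M V]) auto
      have "?Q (\<lambda>P (l, i). \<Sum>x<N. scalar (u x l) * c x P i)"
      proof (intro conjI ballI ext)
        fix y assume "y \<in> J \<times> I"
        thus "(\<lambda>P. case y of (l, i) \<Rightarrow> \<Sum>x<N. scalar (u x l) * c x P i) \<in>
            twist_sections (case y of (l, i) \<Rightarrow> n i) V"
          using c by (auto intro!: twist_sections_sum[OF V] twist_sections_scalar)
      next
        fix P and y :: "'l \<times> 'j"
        obtain l j where y: "y = (l, j)" by (cases y)
        have "s P y = (\<Sum>x<N. \<Sum>i\<in>I. G i j * (scalar (u x l) * c x P i))"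
          by (simp add: s y m sum_distrib_left mult_ac)
        also have "\<dots> = (\<Sum>i\<in>I. G i j * (\<Sum>x<N. scalar (u x l) * c x P i))"
          by (subst sum.swap) (simp add: sum_distrib_left)
        also have "\<dots> = (if l \<in> J then \<dots> else 0)"
          using um by (auto simp: weight_rep_def scalar_simps intro!: sum.neutral)
        finally show "s P y = (\<Sum>x\<in>J \<times> I. G' x y * (case x of (l, i) \<Rightarrow> \<Sum>x<N. scalar (u x l) * c x P i))"
          by (simp add: y comb)
      qed
      thus "\<exists>c. ?Q c" by (rule exI[of ?Q "\<lambda>P (l, i). \<Sum>x<N. scalar (u x l) * c x P i"])
    next
      assume "\<exists>c. ?Q c"
      then obtain c where c: "\<And>l i. l \<in> J \<Longrightarrow> i \<in> I \<Longrightarrow> (\<lambda>P. c P (l, i)) \<in> twist_sections (n i) V"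
        and s: "s = (\<lambda>P y. \<Sum>x\<in>J \<times> I. G' x y * c P x)" by fastforce
      \<comment> \<open>Sections of the tensor product are sums over an initial segment of the
        naturals, so \<open>J\<close> has to be enumerated.\<close>
      obtain h where h: "bij_betw h {..<card J} J"
        using ex_bij_betw_nat_finite[OF J] by (auto simp: atLeast0LessThan)
      define u :: "nat \<Rightarrow> 'l \<Rightarrow> 'k" where "u x l = (if l = h x then 1 else 0)" for x l
      define m where "m x = (\<lambda>P j. \<Sum>i\<in>I. G i j * c P (h x, i))" for x
      have "u x \<in> rep_space (weight_rep J v) \<and> m x \<in> sect M V" if "x < card J" for x
      proof -
        have "h x \<in> J" using h that by (auto dest: bij_betwE)
        thus ?thesis
          unfolding m_def by (auto simp: u_def weight_rep_def intro!: frame_sectI[OF M V] c)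
      qed
      moreover have "s = (\<lambda>P (l, j). \<Sum>x<card J. scalar (u x l) * m x P j)"
      proof (intro ext, clarify)
        fix P l j
        have "(\<Sum>x<card J. scalar (u x l) * m x P j) =
            (\<Sum>l'\<in>J. if l = l' then \<Sum>i\<in>I. G i j * c P (l', i) else 0)"
          by (rule sum.reindex_bij_betw[OF h, THEN trans[rotated]])
            (auto simp: u_def m_def scalar_simps intro!: sum.cong)
        thus "s P (l, j) = (\<Sum>x<card J. scalar (u x l) * m x P j)"
          using J by (simp add: s comb)
      qed
      ultimately show "s \<in> sect (weight_rep J v \<otimes>\<^sub>k M) V"
        unfolding rep_tensor_def by auto
    qed
  next
    fix c :: "'l \<times> 'i \<Rightarrow> 'k poly poly fract"
    assume *: "\<forall>y. (\<Sum>x\<in>J \<times> I. G' x y * c x) = 0"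
    show "\<forall>x\<in>J \<times> I. c x = 0"
    proof clarify
      fix l i assume li: "l \<in> J" "i \<in> I"
      have "(\<Sum>i\<in>I. G i j * c (l, i)) = (\<Sum>i\<in>I. G i j * 0)" for j
        using *[rule_format, of "(l, j)"] li by (simp add: comb)
      thus "c (l, i) = 0" using frame_unique[OF M, of "\<lambda>i. c (l, i)" "\<lambda>_. 0"] li by simp
    qed
  next
    fix t :: "'k \<times> 'k" and x :: "'l \<times> 'i" and y :: "'l \<times> 'j" assume t: "fst t \<noteq> 0 \<and> snd t \<noteq> 0 \<and> x \<in> J \<times> I"
    obtain l i l' j where xy: "x = (l, i)" "y = (l', j)" by (cases x; cases y)
    have char: "character (fst a + fst b, snd a + snd b) t = character a t * character b t" for a b
      using t by (simp add: character_def power_int_add mult_ac)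
    have "scalar (character (wt M j) t) * tfrac t (G i j) = scalar (character (w i) t) * G i j"
      using t xy by (intro frame_weight[OF M]) auto
    thus "scalar (character (wt (weight_rep J v \<otimes>\<^sub>k M) y) t) * tfrac t (G' x y) =
        scalar (character (case x of (l, i) \<Rightarrow> (fst (v l) + fst (w i), snd (v l) + snd (w i))) t) * G' x y"
      using t by (auto simp: xy rep_tensor_def weight_rep_def G'_def char scalar_simps tfrac_0 mult.assoc)
  qed
  thus ?thesis by (simp add: G'_def)
qed

lemma frame_dsum:
  fixes M :: "('j, 'k::field) esheaf" and N :: "('l, 'k) esheaf" and I :: "'i set" and J :: "'m set"
  assumes M: "frame M I w n G" and N: "frame N J w' n' G'"
  shows "frame (M \<oplus>\<^sub>T N) (I <+> J) (case_sum w w') (case_sum n n')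
    (case_sum (\<lambda>i. case_sum (G i) (\<lambda>_. 0)) (\<lambda>i. case_sum (\<lambda>_. 0) (G' i)))"
proof -
  define G0 :: "'i + 'm \<Rightarrow> 'j + 'l \<Rightarrow> 'k poly poly fract"
    where "G0 = case_sum (\<lambda>i. case_sum (G i) (\<lambda>_. 0)) (\<lambda>i. case_sum (\<lambda>_. 0) (G' i))"
  have IJ: "finite I" "finite J" using frame_finite M N by blast+
  have comb: "(\<Sum>x\<in>I <+> J. G0 x (Inl j) * c x) = (\<Sum>i\<in>I. G i j * c (Inl i))"
    "(\<Sum>x\<in>I <+> J. G0 x (Inr k) * c x) = (\<Sum>i\<in>J. G' i k * c (Inr i))" for c j k
    using IJ by (simp_all add: sum.Plus G0_def)
  have "frame (M \<oplus>\<^sub>T N) (I <+> J) (case_sum w w') (case_sum n n') G0"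
    unfolding frame_def
  proof (intro conjI allI impI)
    show "finite (I <+> J)" using IJ by simp
  next
    fix V :: "'k poly poly set set" and s :: "'k poly poly set \<Rightarrow> 'j + 'l \<Rightarrow> 'k poly poly fract"
    assume V: "zariski_open V"
    show "s \<in> sect (M \<oplus>\<^sub>T N) V \<longleftrightarrow>
        (\<exists>c. (\<forall>x\<in>I <+> J. (\<lambda>P. c P x) \<in> twist_sections (case_sum n n' x) V) \<and>
          s = (\<lambda>P y. \<Sum>x\<in>I <+> J. G0 x y * c P x))" (is "_ \<longleftrightarrow> (\<exists>c. ?Q c)")
    proof
      assume "s \<in> sect (M \<oplus>\<^sub>T N) V"
      hence sect: "(\<lambda>P j. s P (Inl j)) \<in> sect M V" "(\<lambda>P j. s P (Inr j)) \<in> sect N V"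
        by (simp_all add: dsum_def)
      obtain c where c: "\<And>i. i \<in> I \<Longrightarrow> (\<lambda>P. c P i) \<in> twist_sections (n i) V"
        and s: "(\<lambda>P j. s P (Inl j)) = (\<lambda>P j. \<Sum>i\<in>I. G i j * c P i)"
        by (rule frame_sectE[OF M V sect(1)]) blast
      obtain c' where c': "\<And>i. i \<in> J \<Longrightarrow> (\<lambda>P. c' P i) \<in> twist_sections (n' i) V"
        and s': "(\<lambda>P j. s P (Inr j)) = (\<lambda>P j. \<Sum>i\<in>J. G' i j * c' P i)"
        by (rule frame_sectE[OF N V sect(2)]) blast
      have "?Q (\<lambda>P. case_sum (c P) (c' P))"
      proof (intro conjI ballI ext)
        fix P y
        show "s P y = (\<Sum>x\<in>I <+> J. G0 x y * case_sum (c P) (c' P) x)"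
          using s[THEN fun_cong, THEN fun_cong] s'[THEN fun_cong, THEN fun_cong]
          by (cases y) (simp_all add: comb)
      qed (use c c' in auto)
      thus "\<exists>c. ?Q c" by (rule exI[of ?Q "\<lambda>P. case_sum (c P) (c' P)"])
    next
      assume "\<exists>c. ?Q c"
      then obtain c where c: "\<And>x. x \<in> I <+> J \<Longrightarrow> (\<lambda>P. c P x) \<in> twist_sections (case_sum n n' x) V"
        and s: "s = (\<lambda>P y. \<Sum>x\<in>I <+> J. G0 x y * c P x)" by blast
      have "(\<lambda>P j. \<Sum>i\<in>I. G i j * c P (Inl i)) \<in> sect M V"
        using c[OF InlI] by (intro frame_sectI[OF M V]) simp
      moreover have "(\<lambda>P j. \<Sum>i\<in>J. G' i j * c P (Inr i)) \<in> sect N V"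
        using c[OF InrI] by (intro frame_sectI[OF N V]) simp
      ultimately show "s \<in> sect (M \<oplus>\<^sub>T N) V" by (simp add: dsum_def s comb)
    qed
  next
    fix c :: "'i + 'm \<Rightarrow> 'k poly poly fract"
    assume *: "\<forall>y. (\<Sum>x\<in>I <+> J. G0 x y * c x) = 0"
    have "c (Inl i) = 0" if "i \<in> I" for i
      using *[rule_format, of "Inl _"] frame_unique[OF M, of "\<lambda>i. c (Inl i)" "\<lambda>_. 0", OF _ that]
      by (simp add: comb)
    moreover have "c (Inr i) = 0" if "i \<in> J" for i
      using *[rule_format, of "Inr _"] frame_unique[OF N, of "\<lambda>i. c (Inr i)" "\<lambda>_. 0", OF _ that]
      by (simp add: comb)
    ultimately show "\<forall>x\<in>I <+> J. c x = 0" by auto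
  next
    fix t :: "'k \<times> 'k" and x y assume "fst t \<noteq> 0 \<and> snd t \<noteq> 0 \<and> x \<in> I <+> J"
    thus "scalar (character (wt (M \<oplus>\<^sub>T N) y) t) * tfrac t (G0 x y) =
        scalar (character (case_sum w w' x) t) * G0 x y"
      using frame_weight[OF M, of t] frame_weight[OF N, of t]
      by (cases x; cases y) (auto simp: dsum_def G0_def tfrac_0)
  qed
  thus ?thesis by (simp add: G0_def)
qed

text \<open>Where x or y is a unit, multiplication by its k-th power identifies sections of degree
  \<open>n i\<close> and \<open>n i + k\<close>; hence the same vectors \<open>G i\<close> serve for
  the twist.\<close>

lemma frame_twist:
  fixes M :: "('j, 'k::field) esheaf" and I :: "'i set"
  assumes M: "frame M I w n G"
  shows "frame (twist M k) I w (\<lambda>i. n i + k) G"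
  unfolding frame_def
proof (intro conjI allI impI)
  show "finite I" by (rule frame_finite[OF M])
next
  fix V :: "'k poly poly set set" and s :: "'k poly poly set \<Rightarrow> 'j \<Rightarrow> 'k poly poly fract"
  assume V: "zariski_open V"
  show "s \<in> sect (twist M k) V \<longleftrightarrow>
      (\<exists>c. (\<forall>i\<in>I. (\<lambda>P. c P i) \<in> twist_sections (n i + k) V) \<and> s = (\<lambda>P j. \<Sum>i\<in>I. G i j * c P i))"
    (is "_ \<longleftrightarrow> (\<exists>c. ?Q c)")
  proof
    assume "s \<in> sect (twist M k) V"
    hence s: "\<And>P. P \<notin> V \<Longrightarrow> s P = (\<lambda>_. 0)"
      "\<And>P. P \<in> V \<Longrightarrow> \<exists>W. zariski_open W \<and> P \<in> W \<and> W \<subseteq> V \<and>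
           (\<exists>(N::nat) m g. (\<forall>l<N. m l \<in> sect M W \<and> g l \<in> twist_sections k W) \<and>
              (\<forall>Q\<in>W. s Q = (\<lambda>i. \<Sum>l<N. m l Q i * g l Q)))"
      by (auto simp: twist_def)
    define c where "c P i = (if P \<in> V then coords I G (s P) i else 0)" for P i
    have local: "\<exists>W c'. zariski_open W \<and> P \<in> W \<and> W \<subseteq> V \<and>
        (\<forall>i\<in>I. (\<lambda>P. c' P i) \<in> twist_sections (n i + k) W) \<and>
        (\<forall>Q\<in>W. s Q = (\<lambda>j. \<Sum>i\<in>I. G i j * c' Q i))" if "P \<in> V" for P
    proof -
      from s(2)[OF that] obtain W N m g where W: "zariski_open W" "P \<in> W" "W \<subseteq> V"
        and mg': "\<forall>l<N. m l \<in> sect M W \<and> g l \<in> twist_sections k W"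
        and sQ': "\<forall>Q\<in>W. s Q = (\<lambda>i. \<Sum>l<(N::nat). m l Q i * g l Q)"
        by (elim exE conjE)
      have mg: "m l \<in> sect M W \<and> g l \<in> twist_sections k W" if "l < N" for l using mg' that by simp
      have sQ: "s Q = (\<lambda>i. \<Sum>l<(N::nat). m l Q i * g l Q)" if "Q \<in> W" for Q using sQ' that by blast
      define a where "a l P i = coords I G (m l P) i" for l P i
      have a: "(\<lambda>P. a l P i) \<in> twist_sections (n i) W" if "l < N" "i \<in> I" for l i
        unfolding a_def using mg[OF that(1)] that(2) by (intro frame_coords_sections[OF M W(1)]) auto
      have m: "m l P j = (\<Sum>i\<in>I. G i j * a l P i)" if "l < N" for l P j
        unfolding a_def using mg[OF that] by (intro frame_coords_sum[OF M W(1)]) auto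
      define c' where "c' Q i = (\<Sum>l<N. a l Q i * g l Q)" for Q i
      have "(\<lambda>P. c' P i) \<in> twist_sections (n i + k) W" if "i \<in> I" for i
        unfolding c'_def using a that mg by (intro twist_sections_sum[OF W(1)] twist_sections_mult) auto
      moreover have "s Q = (\<lambda>j. \<Sum>i\<in>I. G i j * c' Q i)" if "Q \<in> W" for Q
      proof
        fix j
        have "s Q j = (\<Sum>l<N. \<Sum>i\<in>I. G i j * (a l Q i * g l Q))"
          by (simp add: sQ[OF that] m sum_distrib_right mult.assoc)
        also have "\<dots> = (\<Sum>i\<in>I. G i j * c' Q i)"
          unfolding c'_def by (subst sum.swap) (simp add: sum_distrib_left)
        finally show "s Q j = (\<Sum>i\<in>I. G i j * c' Q i)" .
      qed
      ultimately show ?thesis using W by blast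
    qed
    have "?Q c"
    proof (intro conjI ballI)
      fix i assume i: "i \<in> I"
      show "(\<lambda>P. c P i) \<in> twist_sections (n i + k) V"
      proof (rule twist_sections_local)
        fix P assume "P \<in> V"
        from local[OF this] obtain W c' where W: "zariski_open W" "P \<in> W" "W \<subseteq> V"
            "\<forall>i\<in>I. (\<lambda>P. c' P i) \<in> twist_sections (n i + k) W"
            "\<forall>Q\<in>W. s Q = (\<lambda>j. \<Sum>i\<in>I. G i j * c' Q i)"
          by (elim exE conjE)
        have "c Q i = c' Q i" if "Q \<in> W" for Q
          using W(3,5) that coords_eq[OF M i] by (auto simp: c_def)
        with W i show "\<exists>W s'. zariski_open W \<and> P \<in> W \<and> W \<subseteq> V \<and> s' \<in> twist_sections (n i + k) W \<and>
            (\<forall>Q\<in>W. c Q i = s' Q)"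
          by (intro exI[of _ W] exI[of _ "\<lambda>P. c' P i"]) auto
      qed (simp add: c_def)
    next
      show "s = (\<lambda>P j. \<Sum>i\<in>I. G i j * c P i)"
      proof
        fix P
        show "s P = (\<lambda>j. \<Sum>i\<in>I. G i j * c P i)"
        proof (cases "P \<in> V")
          case True
          from local[OF this] obtain W c' where "P \<in> W" "\<forall>Q\<in>W. s Q = (\<lambda>j. \<Sum>i\<in>I. G i j * c' Q i)"
            by (elim exE conjE)
          hence c': "s P = (\<lambda>j. \<Sum>i\<in>I. G i j * c' P i)" by blast
          have "c P i = c' P i" if "i \<in> I" for i
            using True coords_eq[OF M that] by (simp add: c_def c')
          thus ?thesis by (simp add: c')
        qed (simp add: s c_def)
      qed
    qed
    thus "\<exists>c. ?Q c" by (rule exI[of ?Q c])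
  next
    assume "\<exists>c. ?Q c"
    then obtain c where c: "\<And>i. i \<in> I \<Longrightarrow> (\<lambda>P. c P i) \<in> twist_sections (n i + k) V"
      and s: "s = (\<lambda>P j. \<Sum>i\<in>I. G i j * c P i)" by blast
    have "\<exists>W. zariski_open W \<and> P \<in> W \<and> W \<subseteq> V \<and>
           (\<exists>(N::nat) m g. (\<forall>l<N. m l \<in> sect M W \<and> g l \<in> twist_sections k W) \<and>
              (\<forall>Q\<in>W. s Q = (\<lambda>i. \<Sum>l<N. m l Q i * g l Q)))" if P: "P \<in> V" for P
    proof -
      obtain h :: "'k poly poly" where h: "homog 1 h" "h \<notin> P" "Fract h 1 \<noteq> 0"
        using Proj1_cover[OF zariski_open_Proj1[OF V P]] homog_xvar homog_yvar
          Fract_xvar_nonzero Fract_yvar_nonzero by blast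
      define W where "W = V \<inter> {P \<in> Proj1. h \<notin> P}"
      have W: "zariski_open W" "P \<in> W" "W \<subseteq> V" "\<And>Q. Q \<in> W \<Longrightarrow> h \<notin> Q"
        using zariski_open_Int[OF V zariski_open_basic[OF h(1)]] P zariski_open_Proj1[OF V P] h(2)
        by (auto simp: W_def)
      \<comment> \<open>Splitting each coefficient into a part of degree \<open>n i\<close> and the
        common factor h^k presents the section near \<open>P\<close> as a single product.\<close>
      define a where "a Q i = Fract h 1 powi (- k) * (if Q \<in> W then c Q i else 0)" for Q i
      define g where "g = (\<lambda>Q. if Q \<in> W then Fract h 1 powi k else 0)"
      have a: "(\<lambda>Q. a Q i) \<in> twist_sections (n i) W" if "i \<in> I" for i
        using twist_sections_powi_mult[OF W(1) h(1) W(4)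
            twist_sections_restrict[OF c[OF that] W(1,3)], of "- k"]
        by (simp add: a_def)
      have g: "g \<in> twist_sections k W"
        unfolding g_def by (rule twist_sections_powi[OF W(1) h(1) W(4)])
      have "s Q = (\<lambda>j. \<Sum>l<1::nat. (\<Sum>i\<in>I. G i j * a Q i) * g Q)" if "Q \<in> W" for Q
      proof -
        have *: "u * (Fract h 1 powi (- k) * v) * Fract h 1 powi k = u * v" for u v
          using h(3) by (simp add: power_int_minus field_simps)
        show ?thesis using that by (simp add: s a_def g_def sum_distrib_right *)
      qed
      moreover have "(\<lambda>P j. \<Sum>i\<in>I. G i j * a P i) \<in> sect M W" by (rule frame_sectI[OF M W(1) a])
      ultimately have "\<forall>l<1::nat. (\<lambda>P j. \<Sum>i\<in>I. G i j * a P i) \<in> sect M W \<and> g \<in> twist_sections k W"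
        "\<forall>Q\<in>W. s Q = (\<lambda>j. \<Sum>l<1::nat. (\<Sum>i\<in>I. G i j * a Q i) * g Q)" using g by blast+
      with W(1-3) show ?thesis
        by (intro exI[of _ W] conjI exI[of _ "1::nat"] exI[of _ "\<lambda>_ P j. \<Sum>i\<in>I. G i j * a P i"]
            exI[of _ "\<lambda>_. g"])
    qed
    moreover have "s P = (\<lambda>_. 0)" if "P \<notin> V" for P
      using twist_sections_outside[OF c that] by (simp add: s)
    ultimately show "s \<in> sect (twist M k) V" by (simp add: twist_def)
  qed
next
  fix c :: "'i \<Rightarrow> 'k poly poly fract" assume "\<forall>j. (\<Sum>i\<in>I. G i j * c i) = 0"
  thus "\<forall>i\<in>I. c i = 0" using M unfolding frame_def by blast
next
  fix t :: "'k \<times> 'k" and i j assume "fst t \<noteq> 0 \<and> snd t \<noteq> 0 \<and> i \<in> I"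
  thus "scalar (character (wt (twist M k) j) t) * tfrac t (G i j) = scalar (character (w i) t) * G i j"
    using frame_weight[OF M, of t i j] by (simp add: twist_def)
qed

section \<open>The kernels of the iterated comultiplication\<close>

lemma count_list_mset: "count_list w c = count (mset w) c"
  by (induction w) auto

lemma count_list_replicate_same: "count_list (replicate n c) c = n"
  by (induction n) auto

lemma length_eq_count: "length w = count_list w E1 + count_list w E2"
proof (induction w)
  case (Cons a w)
  thus ?case by (cases a) auto
qed simp

lemma mset_basis_word:
  assumes "length v = length w" "count_list v E2 = count_list w E2"
  shows "mset v = mset w"
proof -
  have "count_list v c = count_list w c" for c
    using assms length_eq_count[of v] length_eq_count[of w] by (cases c) auto
  thus ?thesis by (intro multiset_eqI) (simp flip: count_list_mset)
qed

text \<open>With two letters, the permutation orbits of words of length d are told apart by the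
  number j of letters \<open>E2\<close>, so a symmetric tensor amounts to d + 1 values.\<close>

lemma Dpow_sect:
  fixes s :: "'k::field poly poly set \<Rightarrow> basis list \<times> unit \<Rightarrow> 'k poly poly fract"
  assumes V: "zariski_open V"
  shows "s \<in> sect (Dpow (int d) \<otimes>\<^sub>k Osheaf n) V \<longleftrightarrow>
    (\<exists>b. (\<forall>j\<le>d. b j \<in> twist_sections n V) \<and>
      s = (\<lambda>P (w, u). if length w = d then b (count_list w E2) P else 0))" (is "_ \<longleftrightarrow> (\<exists>b. ?Q b)")
proof
  assume "s \<in> sect (Dpow (int d) \<otimes>\<^sub>k Osheaf n) V"
  then obtain N :: nat and f g
    where fg: "\<And>l. l < N \<Longrightarrow> f l \<in> rep_space (Dpow (int d)) \<and> g l \<in> sect (Osheaf n) V"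
      and s: "s = (\<lambda>P (w, u). \<Sum>l<N. scalar (f l w) * g l P u)"
    unfolding rep_tensor_def by auto
  define word where "word j = replicate (d - j) E1 @ replicate j E2" for j
  define b where "b j P = (\<Sum>l<N. scalar (f l (word j)) * g l P ())" for j P
  have "(\<lambda>P. g l P ()) \<in> twist_sections n V" if "l < N" for l
    using fg[OF that] by (auto simp: Osheaf_def)
  hence "b j \<in> twist_sections n V" for j
    unfolding b_def by (intro twist_sections_sum[OF V] twist_sections_scalar) auto
  moreover have "s P (w, u) = (if length w = d then b (count_list w E2) P else 0)" for P w u
  proof (cases "length w = d")
    case True
    have "f l w = f l (word (count_list w E2))" if l: "l < N" for l
    proof -
      have "mset w = mset (word (count_list w E2))"
        using True count_le_length[of w E2] by (intro mset_basis_word) (simp_all add: word_def count_list_replicate_same)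
      then obtain \<pi> where "\<pi> permutes {..<length (word (count_list w E2))}"
          "permute_list \<pi> (word (count_list w E2)) = w"
        by (rule mset_eq_permutation)
      with fg[OF l] show ?thesis unfolding Dpow_def by force
    qed
    thus ?thesis using True by (simp add: s b_def)
  next
    case False
    have "f l w = 0" if "l < N" for l
      using fg[OF that] False by (simp add: Dpow_def)
    thus ?thesis using False by (simp add: s scalar_simps)
  qed
  hence "s = (\<lambda>P (w, u). if length w = d then b (count_list w E2) P else 0)"
    by (intro ext) auto
  ultimately have "?Q b" by (intro conjI allI impI)
  thus "\<exists>b. ?Q b" by (rule exI[of ?Q b])
next
  assume "\<exists>b. ?Q b"
  then obtain b where b: "\<And>j. j \<le> d \<Longrightarrow> b j \<in> twist_sections n V"
    and s: "s = (\<lambda>P (w, u). if length w = d then b (count_list w E2) P else 0)" by blast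
  \<comment> \<open>The indicators of the orbits are the divided power monomials, the standard basis
    of \<open>Dpow\<close>.\<close>
  define f :: "nat \<Rightarrow> basis list \<Rightarrow> 'k"
    where "f j w = (if length w = d \<and> count_list w E2 = j then 1 else 0)" for j w
  define g where "g j = (\<lambda>P (u :: unit). b j P)" for j
  have "f j (permute_list \<pi> w) = f j w" if "\<pi> permutes {..<length w}" for j \<pi> w
  proof -
    have "mset (permute_list \<pi> w) = mset w" using that by simp
    hence "count_list (permute_list \<pi> w) E2 = count_list w E2"
      by (metis count_list_mset)
    thus ?thesis by (simp add: f_def)
  qed
  hence "f j \<in> rep_space (Dpow (int d))" for j
    by (simp add: Dpow_def f_def)
  moreover have "g j \<in> sect (Osheaf n) V" if "j < Suc d" for j
    using b that by (auto simp: Osheaf_def g_def)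
  moreover have "s = (\<lambda>P (w, u). \<Sum>l<Suc d. scalar (f l w) * g l P u)"
  proof (intro ext, clarify)
    fix P w u
    have "(\<Sum>l<Suc d. scalar (f l w) * g l P u) =
        (\<Sum>l<Suc d. if l = count_list w E2 then if length w = d then b l P else 0 else 0)"
      by (intro sum.cong) (auto simp: f_def g_def scalar_simps)
    also have "\<dots> = s P (w, u)"
      using count_le_length[of w E2] by (auto simp: s)
    finally show "s P (w, u) = (\<Sum>l<Suc d. scalar (f l w) * g l P u)" ..
  qed
  ultimately show "s \<in> sect (Dpow (int d) \<otimes>\<^sub>k Osheaf n) V"
    unfolding rep_tensor_def trep.simps esheaf.simps mem_Collect_eq
    by (intro exI[of _ "Suc d"] exI[of _ f] exI[of _ g] conjI allI impI)
qed

text \<open>Appending \<open>E1\<close> keeps the count of \<open>E2\<close> and appending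
  \<open>E2\<close> raises it by one, so \<open>Delta\<close> acts as x + y S and its powers expand
  by the binomial theorem.\<close>

lemma Delta_funpow:
  "(Delta ^^ r) (\<lambda>P (w, u). f P (length w) (count_list w E2)) P (w, u) =
     (\<Sum>k\<le>r. of_nat (r choose k) * Fract xvar 1 ^ (r - k) * Fract yvar 1 ^ k *
       f P (length w + r) (count_list w E2 + k))"
proof (induction r arbitrary: w)
  case (Suc r)
  let ?X = "Fract xvar 1 :: 'a poly poly fract" and ?Y = "Fract yvar 1 :: 'a poly poly fract"
  define b where "b k = f P (length w + Suc r) (count_list w E2 + k)" for k
  define F where "F = (\<lambda>P (w, u :: unit). f P (length w) (count_list w E2))"
  have "(Delta ^^ Suc r) F P (w, u) =
      ?X * (Delta ^^ r) F P (w @ [E1], u) + ?Y * (Delta ^^ r) F P (w @ [E2], u)"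
    by (simp only: funpow.simps o_apply Delta_def[of "(Delta ^^ r) F"] case_prod_conv)
  also have "\<dots> = ?X * (\<Sum>k\<le>r. of_nat (r choose k) * ?X ^ (r - k) * ?Y ^ k * b k) +
      ?Y * (\<Sum>k\<le>r. of_nat (r choose k) * ?X ^ (r - k) * ?Y ^ k * b (Suc k))"
    unfolding F_def Suc.IH by (simp add: b_def)
  also have "?X * (\<Sum>k\<le>r. of_nat (r choose k) * ?X ^ (r - k) * ?Y ^ k * b k) =
      (\<Sum>k\<le>r. of_nat (r choose k) * ?X ^ (Suc r - k) * ?Y ^ k * b k)"
    by (auto simp: sum_distrib_left Suc_diff_le mult_ac intro!: sum.cong)
  also have "\<dots> = (\<Sum>k\<le>Suc r. of_nat (r choose k) * ?X ^ (Suc r - k) * ?Y ^ k * b k)"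
    by (simp add: binomial_eq_0)
  also have "\<dots> = ?X ^ Suc r * b 0 +
      (\<Sum>k\<le>r. of_nat (r choose Suc k) * ?X ^ (r - k) * ?Y ^ Suc k * b (Suc k))"
    by (subst sum.atMost_Suc_shift) simp
  also have "\<dots> + ?Y * (\<Sum>k\<le>r. of_nat (r choose k) * ?X ^ (r - k) * ?Y ^ k * b (Suc k)) =
      ?X ^ Suc r * b 0 +
      (\<Sum>k\<le>r. of_nat (Suc r choose Suc k) * ?X ^ (r - k) * ?Y ^ Suc k * b (Suc k))"
    by (simp add: sum_distrib_left sum.distrib[symmetric] algebra_simps)
  also have "\<dots> = (\<Sum>k\<le>Suc r. of_nat (Suc r choose k) * ?X ^ (Suc r - k) * ?Y ^ k * b k)"
    by (subst sum.atMost_Suc_shift) simp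
  finally show ?case by (simp add: b_def F_def)
qed simp

definition symbol :: "nat \<Rightarrow> (nat \<Rightarrow> 'k::field poly poly fract) \<Rightarrow> nat \<Rightarrow> 'k poly poly fract" where
  "symbol r b i = (\<Sum>k\<le>r. of_nat (r choose k) * Fract xvar 1 ^ (r - k) * Fract yvar 1 ^ k * b (i + k))"

text \<open>The recursion is imposed for \<open>i + r \<le> d\<close> because the image lives on
  words of length d - r, in which \<open>E2\<close> occurs at most d - r times.\<close>

lemma Fsheaf_sect:
  fixes s :: "'k::field poly poly set \<Rightarrow> basis list \<times> unit \<Rightarrow> 'k poly poly fract"
  assumes V: "zariski_open V"
  shows "s \<in> sect (Fsheaf d r) V \<longleftrightarrow>
    (\<exists>b. (\<forall>j\<le>d. b j \<in> twist_sections 0 V) \<and>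
      (\<forall>P i. i + r \<le> d \<longrightarrow> symbol r (\<lambda>j. b j P) i = 0) \<and>
      s = (\<lambda>P (w, u). if length w = d then b (count_list w E2) P else 0))"
proof -
  have key: "(Delta ^^ r) s = (\<lambda>_ _. 0) \<longleftrightarrow> (\<forall>P i. i + r \<le> d \<longrightarrow> symbol r (\<lambda>j. b j P) i = 0)"
    if s: "s = (\<lambda>P (w, u). if length w = d then b (count_list w E2) P else 0)" for b
  proof -
    have *: "(Delta ^^ r) s P (w, u) =
        (if length w + r = d then symbol r (\<lambda>j. b j P) (count_list w E2) else 0)" for P w u
      using Delta_funpow[of r "\<lambda>P l c. if l = d then b c P else 0" P w u]
      by (simp add: s symbol_def cong: if_cong)
    show ?thesis
    proof (intro iffI allI impI)
      fix P i assume "(Delta ^^ r) s = (\<lambda>_ _. 0)" and i: "i + r \<le> d"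
      with *[of P "replicate (d - r - i) E1 @ replicate i E2" "()"]
      show "symbol r (\<lambda>j. b j P) i = 0" by (simp add: count_list_replicate_same)
    next
      assume **: "\<forall>P i. i + r \<le> d \<longrightarrow> symbol r (\<lambda>j. b j P) i = 0"
      show "(Delta ^^ r) s = (\<lambda>_ _. 0)"
      proof (intro ext, clarify)
        fix P w u
        show "(Delta ^^ r) s P (w, u) = 0"
          unfolding * using ** count_le_length[of w E2] by auto
      qed
    qed
  qed
  have "s \<in> sect (Fsheaf d r) V \<longleftrightarrow>
      s \<in> sect (Dpow (int d) \<otimes>\<^sub>k Osheaf 0) V \<and> (Delta ^^ r) s = (\<lambda>_ _. 0)"
    by (simp add: Fsheaf_def)
  thus ?thesis
    unfolding Dpow_sect[OF V]
  proof (elim ssubst, intro iffI; elim exE conjE; intro exI conjI)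
    show "(Delta ^^ r) s = (\<lambda>_ _. 0)" if "\<forall>P i. i + r \<le> d \<longrightarrow> symbol r (\<lambda>j. b j P) i = 0"
      "s = (\<lambda>P (w, u). if length w = d then b (count_list w E2) P else 0)" for b
      using key[OF that(2)] that(1) by blast
    show "\<forall>P i. i + r \<le> d \<longrightarrow> symbol r (\<lambda>j. b j P) i = 0" if "(Delta ^^ r) s = (\<lambda>_ _. 0)"
      "s = (\<lambda>P (w, u). if length w = d then b (count_list w E2) P else 0)" for b
      using key[OF that(2)] that(1) by blast
  qed assumption+
qed


section \<open>Monomial solutions of the recursion and the frames they form\<close>

lemma symbol_diff: "symbol r (\<lambda>j. b j - b' j) i = symbol r b i - symbol r b' i"
  by (simp add: symbol_def algebra_simps sum_subtractf)

lemma symbol_mult_right: "symbol r (\<lambda>j. b j * c) i = symbol r b i * c"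
  by (simp add: symbol_def sum_distrib_right mult.assoc)

lemma symbol_sum: "symbol r (\<lambda>j. \<Sum>x\<in>X. b x j) i = (\<Sum>x\<in>X. symbol r (b x) i)"
  unfolding symbol_def by (subst sum.swap) (simp add: sum_distrib_left)

text \<open>The coefficient of \<open>b (i + r)\<close> in the recursion is y^r, which is invertible
  in the function field, so the first r values determine the rest.\<close>

lemma symbol_eq_0_determined:
  assumes "\<And>i. i + r \<le> d \<Longrightarrow> symbol r b i = 0" "\<And>j. j < r \<Longrightarrow> b j = 0" "j \<le> d"
  shows "b j = 0"
  using assms(3)
proof (induction j rule: less_induct)
  case (less j)
  show ?case
  proof (cases "j < r")
    case False
    have "symbol r b (j - r) = (\<Sum>k\<in>{r}. of_nat (r choose k) * Fract xvar 1 ^ (r - k) *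
        Fract yvar 1 ^ k * b (j - r + k))"
      unfolding symbol_def using less False by (intro sum.mono_neutral_right) auto
    with assms(1)[of "j - r"] less.prems False show ?thesis by (simp add: Fract_yvar_nonzero)
  qed (use assms(2) in simp)
qed

text \<open>The sign turns the kernel of \<open>S - 1\<close> into that of \<open>1 + S\<close>, with \<open>S\<close> the shift.\<close>

definition entry :: "nat \<Rightarrow> nat \<Rightarrow> (nat \<Rightarrow> 'k::field) \<Rightarrow> nat \<Rightarrow> 'k poly poly fract" where
  "entry A B g j = scalar ((-1) ^ j * g j) * Fract xvar 1 powi (int j - int A) *
     Fract yvar 1 powi (int B - int j)"

lemma entry_eq_0_iff: "entry A B g j = 0 \<longleftrightarrow> g j = 0"
  by (simp add: entry_def scalar_eq_0_iff Fract_xvar_nonzero Fract_yvar_nonzero)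

text \<open>The exponents in \<open>entry\<close> are such that all terms of the recursion carry the
  same monomial x^(r+i-A) y^(B-i); what is left is, up to sign, the r-th difference of
  \<open>g\<close>.\<close>

lemma symbol_entry:
  assumes "dker r g"
  shows "symbol r (entry A B g) i = 0"
proof -
  let ?X = "Fract xvar 1 :: 'a poly poly fract" and ?Y = "Fract yvar 1 :: 'a poly poly fract"
  have "of_nat (r choose k) * ?X ^ (r - k) * ?Y ^ k * entry A B g (i + k) =
      ?X powi (int r + int i - int A) * ?Y powi (int B - int i) *
        scalar ((-1) ^ (r + i) * ((-1) ^ (r + k) * of_nat (r choose k) * g (i + k)))"
    if "k \<le> r" for k
  proof -
    have X: "?X ^ (r - k) * ?X powi (int (i + k) - int A) = ?X powi (int r + int i - int A)"
      using that by (simp add: Fract_xvar_nonzero of_nat_diff algebra_simps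
          flip: power_int_of_nat power_int_add)
    have Y: "?Y ^ k * ?Y powi (int B - int (i + k)) = ?Y powi (int B - int i)"
      by (simp add: Fract_yvar_nonzero flip: power_int_of_nat power_int_add)
    have "(-1 :: 'a) ^ (i + k) = (-1) ^ (r + i) * (-1) ^ (r + k)"
      by (simp add: power_add mult_ac flip: power_mult_distrib)
    hence S: "of_nat (r choose k) * scalar ((-1) ^ (i + k) * g (i + k)) =
        scalar ((-1) ^ (r + i) * ((-1) ^ (r + k) * of_nat (r choose k) * g (i + k)))"
      by (simp add: scalar_simps scalar_of_nat mult_ac)
    show ?thesis unfolding entry_def S[symmetric] X[symmetric] Y[symmetric] by (simp add: mult_ac)
  qed
  hence "symbol r (entry A B g) i = ?X powi (int r + int i - int A) * ?Y powi (int B - int i) *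
      scalar ((-1) ^ (r + i) * (fdiff ^^ r) g i)"
    by (simp add: symbol_def fdiff_expand scalar_sum sum_distrib_left)
  thus ?thesis using assms by (simp add: dker_def scalar_simps)
qed

text \<open>Where \<open>g\<close> is nonzero in the window, A \<le> j \<le> B, so both exponents
  are nonnegative and the entry is a scalar times a monomial of degree B - A, which compensates the
  degree of \<open>s\<close>.\<close>

lemma entry_section:
  fixes g :: "nat \<Rightarrow> 'k::field"
  assumes s: "s \<in> twist_sections (int A - int B) V" and V: "zariski_open V"
    and g: "has_ends r d A B g" and j: "j \<le> d"
  shows "(\<lambda>P. entry A B g j * s P) \<in> twist_sections 0 V"
proof (cases "g j = 0")
  case True
  thus ?thesis using twist_sections_0[OF V] by (simp add: entry_def scalar_simps)
next
  case False
  with has_endsD(2,6)[OF g, of j] j have AB: "A \<le> j" "j \<le> B" by (auto simp: not_less[symmetric])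
  have pow: "Fract h 1 ^ n = Fract (h ^ n) 1" for h :: "'k poly poly" and n
    by (induction n) (simp_all add: One_fract_def)
  have "homog (int (j - A) * 1 + int (B - j) * 1) (xvar ^ (j - A) * yvar ^ (B - j))"
    by (intro homog_mult homog_power homog_xvar homog_yvar)
  hence "homog (int B - int A) (xvar ^ (j - A) * yvar ^ (B - j))" using AB by (simp add: of_nat_diff)
  from twist_sections_scalar[OF twist_sections_mult_homog[OF s this], of "(-1) ^ j * g j"]
  have "(\<lambda>P. scalar ((-1) ^ j * g j) * (Fract (xvar ^ (j - A) * yvar ^ (B - j)) 1 * s P)) \<in>
      twist_sections 0 V" by simp
  moreover have "Fract (xvar ^ (j - A) * yvar ^ (B - j) :: 'k poly poly) 1 =
      Fract xvar 1 powi (int j - int A) * Fract yvar 1 powi (int B - int j)"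
    using AB by (simp add: pow flip: of_nat_diff)
  ultimately show ?thesis by (simp add: entry_def mult.assoc)
qed

text \<open>The weight (d - j, j) of the coordinate and the exponents (j - A, B - j) of the entry
  add up to (d - A, B) for every j, so the entries form an eigenvector.\<close>

lemma tfrac_entry:
  assumes t: "fst t \<noteq> 0" "snd t \<noteq> 0" and "j \<le> d"
  shows "scalar (character (int (d - j), int j) t) * tfrac t (entry A B g j) =
    scalar (character (int d - int A, int B) t) * entry A B g j"
proof -
  have X: "fst t powi (int d - int j) * fst t powi (int j - int A) = fst t powi (int d - int A)"
    and Y: "snd t powi int j * snd t powi (int B - int j) = snd t powi int B"
    using t by (simp_all del: power_int_of_nat flip: power_int_add)
  have comm: "a * b * (c * e) = (a * c) * (b * e)" for a b c e :: 'a by simp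
  have "character (int (d - j), int j) t *
      (fst t powi (int j - int A) * snd t powi (int B - int j)) = character (int d - int A, int B) t"
    unfolding character_def fst_conv snd_conv of_nat_diff[OF assms(3)] by (subst comm) (simp only: X Y)
  hence "scalar (character (int (d - j), int j) t) *
      (scalar (fst t powi (int j - int A)) * scalar (snd t powi (int B - int j))) =
      scalar (character (int d - int A, int B) t)"
    by (simp flip: scalar_simps)
  thus ?thesis
    using t by (simp add: entry_def tfrac_mult tfrac_scalar tfrac_powi tfrac_xvar tfrac_yvar
        power_int_mult_distrib scalar_powi[symmetric] mult_ac)
qed


text \<open>Over the function field, the \<open>A i\<close> are triangular pivots for the first r
  values, and these determine a solution. For regularity of the coefficients, the pivot entry at
  \<open>A i\<close> is a scalar times a pure power of y and the one at \<open>B i\<close> a scalar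
  times a pure power of x, so each can be divided by where that variable is a unit.\<close>

lemma frame_Fsheaf:
  fixes A B :: "'i \<Rightarrow> nat" and g :: "'i \<Rightarrow> nat \<Rightarrow> 'k::field"
  assumes I: "finite I" and r: "r \<le> Suc d"
    and g: "\<And>i. i \<in> I \<Longrightarrow> has_ends r d (A i) (B i) (g i)"
    and A: "inj_on A I" "A ` I = {..<r}" and B: "inj_on B I"
  shows "frame (Fsheaf d r) I (\<lambda>i. (int d - int (A i), int (B i))) (\<lambda>i. int (A i) - int (B i))
    (\<lambda>i (w, u). if length w = d then entry (A i) (B i) (g i) (count_list w E2) else 0)"
proof -
  define E where "E i = entry (A i) (B i) (g i)" for i
  define G where "G = (\<lambda>i (w, u :: unit). if length w = d then E i (count_list w E2) else 0)"
  define n where "n i = int (A i) - int (B i)" for i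
  note gD = has_endsD[OF g]
  have E0: "E i j = 0 \<longleftrightarrow> g i j = 0" for i j by (simp add: E_def entry_eq_0_iff)
  have Ar: "A i < r" "A i \<le> d" if "i \<in> I" for i
  proof -
    show "A i < r" using A(2) that by blast
    thus "A i \<le> d" using r by simp
  qed
  have Bd: "B i \<le> d" if "i \<in> I" for i using gD(5) that by blast
  have low: "E i' (A i) = 0" if "i \<in> I" "i' \<in> I" "i' \<noteq> i" "\<not> A i' < A i" for i i'
  proof -
    have "A i < A i'" using that A(1) by (metis inj_onD nat_neq_iff)
    thus ?thesis using gD(2) that(2) by (simp add: E0)
  qed
  have high: "E i' (B i) = 0" if "i \<in> I" "i' \<in> I" "i' \<noteq> i" "\<not> B i < B i'" for i i'
  proof -
    have "B i' < B i" using that B by (metis inj_onD nat_neq_iff)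
    thus ?thesis using gD(6) that(1,2) Bd by (simp add: E0)
  qed
  have word: "\<exists>w. length w = d \<and> count_list w E2 = j" if "j \<le> d" for j
    using that by (intro exI[of _ "replicate (d - j) E1 @ replicate j E2"])
      (simp add: count_list_replicate_same)
  have G_sum: "(\<Sum>i\<in>I. G i (w, u) * c i) =
      (if length w = d then \<Sum>i\<in>I. E i (count_list w E2) * c i else 0)" for w u c
    by (simp add: G_def)
  have indep: "\<forall>i\<in>I. c i = 0" if *: "\<And>j. j \<le> d \<Longrightarrow> (\<Sum>i\<in>I. E i j * c i) = 0" for c
  proof
    fix i assume "i \<in> I"
    thus "c i = 0"
    proof (induction "A i" arbitrary: i rule: less_induct)
      case less
      have "E i' (A i) * c i' = 0" if "i' \<in> I - {i}" for i'
        using less low[of i i'] that by (cases "A i' < A i") auto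
      hence "(\<Sum>i'\<in>I. E i' (A i) * c i') = (\<Sum>i'\<in>{i}. E i' (A i) * c i')"
        using I less.prems by (intro sum.mono_neutral_right) auto
      with *[of "A i"] gD(3) Ar less.prems show ?case by (simp add: E0)
    qed
  qed
  \<comment> \<open>Values are matched one position at a time: the vector starting at
    \<open>m\<close> corrects position \<open>m\<close> without disturbing earlier ones. From
    \<open>r\<close> on the recursion takes over.\<close>
  have solve: "\<exists>c. \<forall>j\<le>d. b j = (\<Sum>i\<in>I. E i j * c i)"
    if b: "\<And>i. i + r \<le> d \<Longrightarrow> symbol r b i = 0" for b
  proof -
    have "\<exists>c. \<forall>j<m. b j = (\<Sum>i\<in>I. E i j * c i)" if "m \<le> r" for m
      using that
    proof (induction m)
      case (Suc m)
      then obtain c where c: "\<forall>j<m. b j = (\<Sum>i\<in>I. E i j * c i)" by auto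
      from Suc.prems A(2) obtain i where i: "i \<in> I" "A i = m" by (metis imageE lessThan_iff Suc_le_eq)
      define x where "x = (b m - (\<Sum>i\<in>I. E i m * c i)) / E i m"
      have Ei: "E i m \<noteq> 0" "\<And>j. j < m \<Longrightarrow> E i j = 0" using gD(2,3) i by (auto simp: E0)
      have "(\<Sum>i'\<in>I. E i' j * (c(i := c i + x)) i') = (\<Sum>i'\<in>I. E i' j * c i') + E i j * x" for j
      proof -
        have "(\<Sum>i'\<in>I. E i' j * (c(i := c i + x)) i') =
            (\<Sum>i'\<in>I. E i' j * c i' + (if i' = i then E i j * x else 0))"
          by (intro sum.cong) (auto simp: algebra_simps)
        thus ?thesis using I i(1) by (simp add: sum.distrib)
      qed
      hence "\<forall>j<Suc m. b j = (\<Sum>i'\<in>I. E i' j * (c(i := c i + x)) i')"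
        using c Ei by (auto simp: less_Suc_eq x_def)
      thus ?case by blast
    qed simp
    then obtain c where c: "\<And>j. j < r \<Longrightarrow> b j = (\<Sum>i\<in>I. E i j * c i)" by blast
    have "b j - (\<Sum>i\<in>I. E i j * c i) = 0" if "j \<le> d" for j
    proof (rule symbol_eq_0_determined[OF _ _ that, of r])
      fix i assume "i + r \<le> d"
      thus "symbol r (\<lambda>j. b j - (\<Sum>i\<in>I. E i j * c i)) i = 0"
        using b gD(1) by (simp add: symbol_diff symbol_sum symbol_mult_right E_def symbol_entry)
    qed (use c in simp)
    thus ?thesis by (intro exI[of _ c]) auto
  qed
  \<comment> \<open>\<open>pos i\<close> is the pivot position of the vector \<open>i\<close>, and
    \<open>\<mu>\<close> orders the elimination: at \<open>pos i\<close> only \<open>i\<close>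
    itself and vectors of smaller \<open>\<mu>\<close> contribute. One statement thus serves
    elimination from the front and from the back.\<close>
  have triangular: "\<forall>i\<in>I. (\<lambda>P. c P i) \<in> twist_sections (n i) W"
    if W: "zariski_open W" and h: "homog 1 h" "\<And>P. P \<in> W \<Longrightarrow> h \<notin> P"
      and c: "\<And>P i. P \<notin> W \<Longrightarrow> c P i = 0"
      and b: "\<And>j. j \<le> d \<Longrightarrow> (\<lambda>P. \<Sum>i\<in>I. E i j * c P i) \<in> twist_sections 0 W"
      and pos: "\<And>i. i \<in> I \<Longrightarrow> pos i \<le> d"
      and diag: "\<And>i. i \<in> I \<Longrightarrow> \<exists>x. x \<noteq> 0 \<and> E i (pos i) = scalar x * Fract h 1 powi (- n i)"
      and off: "\<And>i i'. i \<in> I \<Longrightarrow> i' \<in> I \<Longrightarrow> i' \<noteq> i \<Longrightarrow> \<not> \<mu> i' < \<mu> i \<Longrightarrow> E i' (pos i) = 0"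
    for W h c pos and \<mu> :: "'i \<Rightarrow> nat"
  proof
    fix i assume "i \<in> I"
    thus "(\<lambda>P. c P i) \<in> twist_sections (n i) W"
    proof (induction "\<mu> i" arbitrary: i rule: less_induct)
      case less
      obtain x where x: "x \<noteq> 0" "E i (pos i) = scalar x * Fract h 1 powi (- n i)"
        using diag[OF less.prems] by blast
      have h0: "Fract h 1 \<noteq> 0" if "P \<in> W" for P
        using h(2)[OF that] Proj1_zero[OF zariski_open_Proj1[OF W that]]
        by (auto simp: Zero_fract_def eq_fract)
      let ?J = "{i' \<in> I. \<mu> i' < \<mu> i}"
      define u where "u P = (\<Sum>i'\<in>I. E i' (pos i) * c P i') +
          scalar (- 1) * (\<Sum>i'\<in>?J. E i' (pos i) * c P i')" for P
      have "(\<lambda>P. E i' (pos i) * c P i') \<in> twist_sections 0 W" if "i' \<in> ?J" for i'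
        unfolding E_def using less that g pos
        by (intro entry_section[where d = d] W) (auto simp: n_def)
      hence "(\<lambda>P. \<Sum>i'\<in>?J. E i' (pos i) * c P i') \<in> twist_sections 0 W"
        by (rule twist_sections_sum[OF W])
      from twist_sections_add[OF b[OF pos[OF less.prems]] twist_sections_scalar[OF this, of "- 1"]]
      have "u \<in> twist_sections 0 W" by (simp add: u_def[abs_def])
      from twist_sections_scalar[OF twist_sections_powi_mult[OF W h this, of "n i"], of "inverse x"]
      have "(\<lambda>P. scalar (inverse x) * (Fract h 1 powi n i * u P)) \<in> twist_sections (n i) W" by simp
      moreover have "scalar (inverse x) * (Fract h 1 powi n i * u P) = c P i" for P
      proof (cases "P \<in> W")
        case True
        have "(\<Sum>i'\<in>I. E i' (pos i) * c P i') = (\<Sum>i'\<in>insert i ?J. E i' (pos i) * c P i')"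
          using I off less.prems by (intro sum.mono_neutral_right) auto
        also have "\<dots> = E i (pos i) * c P i + (\<Sum>i'\<in>?J. E i' (pos i) * c P i')"
          using I by (subst sum.insert) auto
        finally have "u P = E i (pos i) * c P i" by (simp add: u_def scalar_simps)
        hence "scalar (inverse x) * (Fract h 1 powi n i * u P) =
            (scalar (inverse x) * scalar x) * (Fract h 1 powi n i * Fract h 1 powi (- n i)) * c P i"
          by (simp add: x(2) mult_ac)
        also have "\<dots> = c P i"
          using x(1) h0[OF True] by (simp add: scalar_inverse scalar_eq_0_iff power_int_minus)
        finally show ?thesis .
      qed (simp add: u_def c)
      ultimately show ?case by simp
    qed
  qed
  have "frame (Fsheaf d r) I (\<lambda>i. (int d - int (A i), int (B i))) n G"
    unfolding frame_def
  proof (intro conjI allI impI I)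
    fix V :: "'k poly poly set set" and s :: "'k poly poly set \<Rightarrow> basis list \<times> unit \<Rightarrow> 'k poly poly fract"
    assume V: "zariski_open V"
    show "s \<in> sect (Fsheaf d r) V \<longleftrightarrow>
        (\<exists>c. (\<forall>i\<in>I. (\<lambda>P. c P i) \<in> twist_sections (n i) V) \<and> s = (\<lambda>P y. \<Sum>i\<in>I. G i y * c P i))"
      (is "_ \<longleftrightarrow> (\<exists>c. ?Q c)")
    proof
      assume "\<exists>c. ?Q c"
      then obtain c where c: "\<And>i. i \<in> I \<Longrightarrow> (\<lambda>P. c P i) \<in> twist_sections (n i) V"
        and s: "s = (\<lambda>P y. \<Sum>i\<in>I. G i y * c P i)" by blast
      define b where "b j P = (\<Sum>i\<in>I. E i j * c P i)" for j P
      have "b j \<in> twist_sections 0 V" if "j \<le> d" for j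
        unfolding b_def E_def using c g that
        by (intro twist_sections_sum V entry_section[where d = d]) (auto simp: n_def)
      moreover have "symbol r (\<lambda>j. b j P) i = 0" for P i
        using gD(1) by (simp add: b_def symbol_sum symbol_mult_right E_def symbol_entry)
      moreover have "s = (\<lambda>P (w, u). if length w = d then b (count_list w E2) P else 0)"
        by (intro ext) (auto simp: s G_sum b_def)
      ultimately show "s \<in> sect (Fsheaf d r) V"
        unfolding Fsheaf_sect[OF V] by (intro exI[of _ b] conjI allI impI)
    next
      assume "s \<in> sect (Fsheaf d r) V"
      then obtain b where b: "\<forall>j\<le>d. b j \<in> twist_sections 0 V"
        and rec: "\<forall>P i. i + r \<le> d \<longrightarrow> symbol r (\<lambda>j. b j P) i = 0"
        and s: "s = (\<lambda>P (w, u). if length w = d then b (count_list w E2) P else 0)"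
        unfolding Fsheaf_sect[OF V] by (elim exE conjE)
      define c where "c P = (SOME c. \<forall>j\<le>d. b j P = (\<Sum>i\<in>I. E i j * c i))" for P
      have c: "b j P = (\<Sum>i\<in>I. E i j * c P i)" if "j \<le> d" for j P
      proof -
        have "\<exists>c. \<forall>j\<le>d. b j P = (\<Sum>i\<in>I. E i j * c i)" using rec by (intro solve) blast
        hence "\<forall>j\<le>d. b j P = (\<Sum>i\<in>I. E i j * c P i)" unfolding c_def by (rule someI_ex)
        thus ?thesis using that by blast
      qed
      have outside: "c P i = 0" if "P \<notin> V" "i \<in> I" for P i
        using indep[of "c P"] twist_sections_outside[OF b[rule_format] that(1)] that(2)
        by (simp flip: c)
      have "?Q c"
      proof (intro conjI ballI)
        fix i assume i: "i \<in> I"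
        show "(\<lambda>P. c P i) \<in> twist_sections (n i) V"
        proof (rule twist_sections_local)
          fix P assume P: "P \<in> V"
          have local: "\<exists>W. zariski_open W \<and> P \<in> W \<and> W \<subseteq> V \<and>
              (\<lambda>P. if P \<in> W then c P i else 0) \<in> twist_sections (n i) W"
            if h: "homog 1 h" "h \<notin> P" and pos: "\<And>i. i \<in> I \<Longrightarrow> pos i \<le> d"
              and diag: "\<And>i. i \<in> I \<Longrightarrow> \<exists>x. x \<noteq> 0 \<and> E i (pos i) = scalar x * Fract h 1 powi (- n i)"
              and off: "\<And>i i'. i \<in> I \<Longrightarrow> i' \<in> I \<Longrightarrow> i' \<noteq> i \<Longrightarrow> \<not> \<mu> i' < \<mu> i \<Longrightarrow> E i' (pos i) = 0"
            for h pos and \<mu> :: "'i \<Rightarrow> nat"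
          proof -
            define W where "W = V \<inter> {P \<in> Proj1. h \<notin> P}"
            have W: "zariski_open W" "P \<in> W" "W \<subseteq> V" "\<And>Q. Q \<in> W \<Longrightarrow> h \<notin> Q"
              using zariski_open_Int[OF V zariski_open_basic[OF h(1)]] P zariski_open_Proj1[OF V P] h(2)
              by (auto simp: W_def)
            have "(\<lambda>P. \<Sum>i\<in>I. E i j * (if P \<in> W then c P i else 0)) \<in> twist_sections 0 W"
              if "j \<le> d" for j
            proof -
              have "(\<lambda>P. \<Sum>i\<in>I. E i j * (if P \<in> W then c P i else 0)) = (\<lambda>P. if P \<in> W then b j P else 0)"
                using that by (auto simp: c)
              thus ?thesis using twist_sections_restrict[OF _ W(1,3)] b that by simp
            qed
            with triangular[OF W(1) h(1) W(4), of "\<lambda>P i. if P \<in> W then c P i else 0" pos \<mu>]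
              pos diag off i W(1-3) show ?thesis by (intro exI[of _ W]) auto
          qed
          have "\<exists>W. zariski_open W \<and> P \<in> W \<and> W \<subseteq> V \<and>
              (\<lambda>P. if P \<in> W then c P i else 0) \<in> twist_sections (n i) W"
            using Proj1_cover[OF zariski_open_Proj1[OF V P]]
          proof
            \<comment> \<open>Elimination from the back: the measure \<open>d - B i\<close> is
              smallest for the vector that ends last.\<close>
            assume x: "xvar \<notin> P"
            show ?thesis
            proof (rule local[OF homog_xvar x, of B "\<lambda>i. d - B i"])
              show "\<exists>x. x \<noteq> 0 \<and> E i (B i) = scalar x * Fract xvar 1 powi (- n i)" if "i \<in> I" for i
                using gD(4)[OF that] by (intro exI[of _ "(-1) ^ B i * g i (B i)"])
                  (simp add: E_def entry_def n_def)
              show "E i' (B i) = 0" if "i \<in> I" "i' \<in> I" "i' \<noteq> i" "\<not> d - B i' < d - B i" for i i'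
                using high[OF that(1-3)] that(4) Bd[OF that(1)] Bd[OF that(2)] by linarith
            qed (rule Bd)
          next
            assume y: "yvar \<notin> P"
            show ?thesis
            proof (rule local[OF homog_yvar y, of A A])
              show "\<exists>x. x \<noteq> 0 \<and> E i (A i) = scalar x * Fract yvar 1 powi (- n i)" if "i \<in> I" for i
                using gD(3)[OF that] by (intro exI[of _ "(-1) ^ A i * g i (A i)"])
                  (simp add: E_def entry_def n_def)
            qed (use low Ar in auto)
          qed
          then obtain W where "zariski_open W" "P \<in> W" "W \<subseteq> V"
              "(\<lambda>P. if P \<in> W then c P i else 0) \<in> twist_sections (n i) W" by blast
          thus "\<exists>W s'. zariski_open W \<and> P \<in> W \<and> W \<subseteq> V \<and> s' \<in> twist_sections (n i) W \<and>
              (\<forall>Q\<in>W. c Q i = s' Q)"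
            by (intro exI[of _ W] exI[of _ "\<lambda>P. if P \<in> W then c P i else 0"]) auto
        qed (use outside i in auto)
      next
        show "s = (\<lambda>P y. \<Sum>i\<in>I. G i y * c P i)"
        proof (intro ext, clarify)
          fix P w u
          show "s P (w, u) = (\<Sum>i\<in>I. G i (w, u) * c P i)"
            using c[of "count_list w E2" P] count_le_length[of w E2] by (auto simp: s G_sum)
        qed
      qed
      thus "\<exists>c. ?Q c" by (rule exI[of ?Q c])
    qed
  next
    fix c assume *: "\<forall>y. (\<Sum>i\<in>I. G i y * c i) = 0"
    show "\<forall>i\<in>I. c i = 0"
    proof (rule indep)
      fix j assume "j \<le> d"
      then obtain w where "length w = d" "count_list w E2 = j" using word by blast
      thus "(\<Sum>i\<in>I. E i j * c i) = 0" using *[rule_format, of "(w, ())"] by (simp add: G_sum)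
    qed
  next
    fix t :: "'k \<times> 'k" and i and y :: "basis list \<times> unit"
    assume t: "fst t \<noteq> 0 \<and> snd t \<noteq> 0 \<and> i \<in> I"
    obtain w u where y: "y = (w, u)" by (cases y)
    show "scalar (character (wt (Fsheaf d r) y) t) * tfrac t (G i y) =
        scalar (character (int d - int (A i), int (B i)) t) * G i y"
    proof (cases "length w = d")
      case True
      have "count_list w E1 = d - count_list w E2"
        using True length_eq_count[of w] by simp
      thus ?thesis
        using t True tfrac_entry[of t "count_list w E2" d "A i" "B i" "g i"] count_le_length[of w E2]
        by (simp add: y G_def E_def Fsheaf_def rep_tensor_def Dpow_def Osheaf_def)
    qed (use t in \<open>simp add: y G_def tfrac_0\<close>)
  qed
  thus ?thesis unfolding G_def E_def n_def[abs_def] .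
qed

text \<open>For d < r the target of the r-fold map is zero, and so is that of the (d + 1)-fold one;
  d + 1 is within the range \<open>r \<le> Suc d\<close> that \<open>frame_Fsheaf\<close>
  covers.\<close>

lemma Fsheaf_eq_full:
  assumes "d < r"
  shows "(Fsheaf d r :: (basis list \<times> unit, 'k::field) esheaf) = Fsheaf d (Suc d)"
proof -
  have "s \<in> sect (Fsheaf d r) V \<longleftrightarrow> s \<in> sect (Dpow (int d) \<otimes>\<^sub>k Osheaf 0) V" if "d < r"
    for r V and s :: "'k poly poly set \<Rightarrow> basis list \<times> unit \<Rightarrow> 'k poly poly fract"
  proof -
    have "(Delta ^^ r) s = (\<lambda>_ _. 0)" if s: "s \<in> sect (Dpow (int d) \<otimes>\<^sub>k Osheaf 0) V"
      using Delta_funpow_sect[OF s, of r] \<open>d < r\<close>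
      by (auto simp: rep_tensor_def Dpow_def scalar_simps fun_eq_iff)
    thus ?thesis by (auto simp: Fsheaf_def)
  qed
  from this[OF assms] this[of "Suc d"] show ?thesis
    by (intro esheaf.equality ext) (auto simp: Fsheaf_def)
qed

section \<open>Comparison of frames and the four isomorphisms\<close>

context char_p
begin

text \<open>Only the injectivity of \<sigma> and the sequences realizing it are recorded: for a
  sheaf on a right hand side, the pairs (A, \<sigma> A) merely have to be transported, not
  computed.\<close>

lemma Fsheaf_frame:
  fixes r d :: nat
  assumes "r \<le> q" "r \<le> Suc d"
  obtains \<sigma> :: "nat \<Rightarrow> nat" and g :: "nat \<Rightarrow> nat \<Rightarrow> 'a"
    and G :: "nat \<Rightarrow> basis list \<times> unit \<Rightarrow> 'a poly poly fract"
  where "\<forall>A<r. has_ends r d A (\<sigma> A) (g A)" "inj_on \<sigma> {..<r}"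
    "frame (Fsheaf d r :: (basis list \<times> unit, 'a) esheaf) {..<r}
       (\<lambda>A. (int d - int A, int (\<sigma> A))) (\<lambda>A. int A - int (\<sigma> A)) G"
proof -
  obtain g :: "nat \<Rightarrow> nat \<Rightarrow> 'a" and \<sigma> :: "nat \<Rightarrow> nat"
    where g: "\<forall>A<r. has_ends r d A (\<sigma> A) (g A)" "inj_on \<sigma> {..<r}"
    using assms by (rule bruhat)
  have "frame (Fsheaf d r) {..<r} (\<lambda>A. (int d - int A, int (\<sigma> A))) (\<lambda>A. int A - int (\<sigma> A))
      (\<lambda>A (w, u). if length w = d then entry A (\<sigma> A) (g A) (count_list w E2) else 0)"
    by (rule frame_Fsheaf) (use assms g in auto)
  with g show ?thesis by (intro that)
qed

text \<open>First positions are automatically below \<open>r\<close>, so covering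
  \<open>{..<r}\<close> and the bound on the cardinality of \<open>I\<close> together make
  \<open>A\<close> a bijection onto it. What then remains is to match weights and degrees with those
  of \<open>N\<close>.\<close>

lemma Fsheaf_iso:
  fixes N :: "('j, 'a) esheaf" and I :: "'i set"
  assumes N: "frame N I w n G" and r: "r \<le> q" "r \<le> Suc d" and I: "card I \<le> r"
    and ends: "\<And>i. i \<in> I \<Longrightarrow> \<exists>g :: nat \<Rightarrow> 'a. has_ends r d (A i) (B i) g"
    and A: "{..<r} \<subseteq> A ` I" and B: "inj_on B I"
    and w: "\<And>i. i \<in> I \<Longrightarrow> w i = (int d - int (A i), int (B i))"
    and n: "\<And>i. i \<in> I \<Longrightarrow> n i = int (A i) - int (B i)"
  shows "(Fsheaf d r :: (basis list \<times> unit, 'a) esheaf) \<simeq>\<^sub>T N"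
proof -
  have fin: "finite I" by (rule frame_finite[OF N])
  from ends obtain g :: "'i \<Rightarrow> nat \<Rightarrow> 'a"
    where g: "\<And>i. i \<in> I \<Longrightarrow> has_ends r d (A i) (B i) (g i)" by metis
  have "A ` I \<subseteq> {..<r}" using has_ends_first_less[OF g r(1)] by auto
  hence Ar: "A ` I = {..<r}" using A by blast
  moreover have "inj_on A I"
    using card_image_le[OF fin, of A] I fin by (intro eq_card_imp_inj_on) (auto simp: Ar)
  ultimately have "frame (Fsheaf d r) I (\<lambda>i. (int d - int (A i), int (B i)))
      (\<lambda>i. int (A i) - int (B i))
      (\<lambda>i (w, u). if length w = d then entry (A i) (B i) (g i) (count_list w E2) else 0)"
    using fin r g B by (intro frame_Fsheaf)
  moreover have "frame N I (\<lambda>i. (int d - int (A i), int (B i))) (\<lambda>i. int (A i) - int (B i)) G"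
    by (rule frame_cong[OF N w n])
  ultimately show ?thesis by (rule frame_isomorphic)
qed

end

lemma frame_H:
  "frame (H a b \<otimes>\<^sub>k Osheaf m :: (nat \<times> unit, 'k::field) esheaf) ({b..a} \<times> (UNIV :: unit set))
    (\<lambda>(i, u). (int a + int b - int i, int i)) (\<lambda>_. m) (\<lambda>(l, i) (l', j). if l' = l then 1 else 0)"
  using frame_weight_rep[OF frame_Osheaf finite_atLeastAtMost, of b a
      "\<lambda>i. (int a + int b - int i, int i)" m]
  unfolding H_def by (simp add: case_prod_unfold)

theorem theorem3p2:
  fixes p e q q' r d :: nat
  assumes char: "CHAR('k::alg_closed_field) = p" "p > 0"
    and e: "e \<ge> 1"
    and q: "q = p ^ e" "q' = p ^ (e - 1)"
    and r: "q' \<le> r" "r \<le> q"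
  shows
    "(d < r \<longrightarrow>
        (Fsheaf d r :: (basis list \<times> unit, 'k) esheaf) \<simeq>\<^sub>T H d 0 \<otimes>\<^sub>k Osheaf 0) \<and>
     (d \<ge> q + r - 1 \<longrightarrow>
        (Fsheaf d r :: (basis list \<times> unit, 'k) esheaf) \<simeq>\<^sub>T
          L (int q) (int q) \<otimes>\<^sub>k twist (Fsheaf (d - q) r) (- int q)) \<and>
     (q - 1 \<le> d \<and> d \<le> q + r - 1 \<longrightarrow>
        (Fsheaf d r :: (basis list \<times> unit, 'k) esheaf) \<simeq>\<^sub>T
          H d q \<otimes>\<^sub>k Osheaf (- int q) \<oplus>\<^sub>T H (q - 1) (d + 1 - r) \<otimes>\<^sub>k Osheaf (int r - int q)) \<and>
     (\<forall>a. r \<le> d \<and> d \<le> q - 1 \<and> 1 \<le> a \<and> a < p \<and> a * q' \<le> r \<and> r < (a + 1) * q' \<longrightarrow>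
        (Fsheaf d r :: (basis list \<times> unit, 'k) esheaf) \<simeq>\<^sub>T
          frobenius_twist q' (H a 0) \<otimes>\<^sub>k Fsheaf (d - a * q') (r - a * q') \<oplus>\<^sub>T
          frobenius_twist q' (H (a - 1) 0) \<otimes>\<^sub>k
            twist (Fsheaf (d - r + q') ((a + 1) * q' - r)) (int r - int (a * q')))"
proof -
  have prime: "prime CHAR('k)" using char by (intro prime_CHAR_semidom) simp
  interpret q: char_p "TYPE('k)" q e
    by standard (use prime q char in auto)
  interpret q': char_p "TYPE('k)" q' "e - 1"
    by standard (use prime q char in auto)
  have q_q': "q = p * q'" using q e by (cases e) auto
  have r1: "r \<ge> 1" using r q'.q_pos by simp
  have case1: "(Fsheaf d r :: (basis list \<times> unit, 'k) esheaf) \<simeq>\<^sub>T H d 0 \<otimes>\<^sub>k Osheaf 0" if "d < r"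
  proof -
    have "(Fsheaf d (Suc d) :: (basis list \<times> unit, 'k) esheaf) \<simeq>\<^sub>T H d 0 \<otimes>\<^sub>k Osheaf 0"
    proof (rule q.Fsheaf_iso[OF frame_H, where A = fst and B = fst])
      show "\<exists>g :: nat \<Rightarrow> 'k. has_ends (Suc d) d (fst i) (fst i) g" if "i \<in> {0..d} \<times> (UNIV :: unit set)" for i
        using that q.has_ends_full[of "fst i" d] by (metis atLeastAtMost_iff mem_Times_iff)
      show "{..<Suc d} \<subseteq> fst ` ({0..d} \<times> (UNIV :: unit set))" by force
    qed (use that r in \<open>auto simp: inj_on_def card_cartesian_product\<close>)
    thus ?thesis using Fsheaf_eq_full[OF that] by metis
  qed
  have case2: "(Fsheaf d r :: (basis list \<times> unit, 'k) esheaf) \<simeq>\<^sub>T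
      L (int q) (int q) \<otimes>\<^sub>k twist (Fsheaf (d - q) r) (- int q)" if d: "d \<ge> q + r - 1"
  proof -
    have rd: "r \<le> Suc (d - q)" "q \<le> d" using d r1 by auto
    obtain \<sigma> :: "nat \<Rightarrow> nat" and g :: "nat \<Rightarrow> nat \<Rightarrow> 'k"
        and G :: "nat \<Rightarrow> basis list \<times> unit \<Rightarrow> 'k poly poly fract"
      where g0: "\<forall>A<r. has_ends r (d - q) A (\<sigma> A) (g A)" and \<sigma>: "inj_on \<sigma> {..<r}"
      and F: "frame (Fsheaf (d - q) r :: (basis list \<times> unit, 'k) esheaf) {..<r}
        (\<lambda>A. (int (d - q) - int A, int (\<sigma> A))) (\<lambda>A. int A - int (\<sigma> A)) G"
      using r(2) rd(1) by (rule q.Fsheaf_frame)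
    have g: "has_ends r (d - q) A (\<sigma> A) (g A)" if "A < r" for A using g0 that by blast
    show ?thesis
      unfolding L_def
    proof (rule q.Fsheaf_iso[OF frame_weight_rep[OF frame_twist[OF F]],
          where A = snd and B = "\<lambda>i. \<sigma> (snd i) + q"])
      show "\<exists>g :: nat \<Rightarrow> 'k. has_ends r d (snd i) (\<sigma> (snd i) + q) g"
        if "i \<in> (UNIV :: unit set) \<times> {..<r}" for i
        using q.has_ends_add_period[OF g r(2), of "snd i"] that rd by auto
      show "inj_on (\<lambda>i. \<sigma> (snd i) + q) ((UNIV :: unit set) \<times> {..<r})"
        using \<sigma> by (auto simp: inj_on_def)
    qed (use r rd in \<open>auto simp: card_cartesian_product of_nat_diff\<close>)
  qed
  have case3: "(Fsheaf d r :: (basis list \<times> unit, 'k) esheaf) \<simeq>\<^sub>T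
      H d q \<otimes>\<^sub>k Osheaf (- int q) \<oplus>\<^sub>T H (q - 1) (d + 1 - r) \<otimes>\<^sub>k Osheaf (int r - int q)"
    if d: "q - 1 \<le> d" "d \<le> q + r - 1"
  proof -
    have dr: "d < q + r" "q \<le> d + 1" "r \<le> d + 1" using d r r1 by auto
    let ?I = "{q..d} \<times> (UNIV :: unit set) <+> {d + 1 - r..q - 1} \<times> (UNIV :: unit set)"
    \<comment> \<open>A last position \<open>i\<close> is paired with the first position that the
      degree dictates, \<open>i - q\<close> for degree -q and \<open>i + r - q\<close> for degree r
      - q. The first positions so obtained fill 0, ..., d - q and d + 1 - q, ..., r - 1.\<close>
    let ?A = "case_sum (\<lambda>(i, u). i - q) (\<lambda>(i, u). i + r - q)"
    let ?B = "case_sum fst fst :: nat \<times> unit + nat \<times> unit \<Rightarrow> nat"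
    show ?thesis
    proof (rule q.Fsheaf_iso[OF frame_dsum[OF frame_H frame_H], where A = ?A and B = ?B])
      show "card ?I \<le> r" using dr q.q_pos by (simp add: card_Plus card_cartesian_product)
      show "\<exists>g :: nat \<Rightarrow> 'k. has_ends r d (?A i) (?B i) g" if i: "i \<in> ?I" for i
      proof (cases i)
        case (Inl x)
        then obtain l u where x: "i = Inl (l, u)" "q \<le> l" "l \<le> d" using i by (cases x) auto
        from q.has_ends_wrap[of "l - q" d r] x dr r obtain g :: "nat \<Rightarrow> 'k"
          where "has_ends r d (l - q) l g" by auto
        thus ?thesis using x by auto
      next
        case (Inr x)
        then obtain l u where x: "i = Inr (l, u)" "d + 1 - r \<le> l" "l \<le> q - 1" using i by (cases x) auto
        have "l < q" "q \<le> l + r" "d < l + r" "l \<le> d" using x dr q.q_pos by auto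
        from q.has_ends_inner[OF this r(2)] obtain g :: "nat \<Rightarrow> 'k"
          where "has_ends r d (l + r - q) l g" .
        thus ?thesis using x by auto
      qed
      show "{..<r} \<subseteq> ?A ` ?I"
      proof
        fix x assume x: "x \<in> {..<r}"
        show "x \<in> ?A ` ?I"
        proof (cases "x + q \<le> d")
          case True
          thus ?thesis by (intro image_eqI[of _ _ "Inl (x + q, ())"]) auto
        next
          case False
          thus ?thesis using x dr r by (intro image_eqI[of _ _ "Inr (x + q - r, ())"]) auto
        qed
      qed
      show "inj_on ?B ?I" using q.q_pos by (auto simp: inj_on_def)
    qed (use r dr in \<open>auto simp: of_nat_diff\<close>)
  qed
  have case4: "(Fsheaf d r :: (basis list \<times> unit, 'k) esheaf) \<simeq>\<^sub>T
          frobenius_twist q' (H a 0) \<otimes>\<^sub>k Fsheaf (d - a * q') (r - a * q') \<oplus>\<^sub>T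
          frobenius_twist q' (H (a - 1) 0) \<otimes>\<^sub>k
            twist (Fsheaf (d - r + q') ((a + 1) * q' - r)) (int r - int (a * q'))"
    if d: "r \<le> d" "d \<le> q - 1" and a: "1 \<le> a" "a < p" "a * q' \<le> r" "r < (a + 1) * q'" for a
  proof -
    define \<rho> where "\<rho> = r - a * q'"
    define D where "D = d - a * q'"
    define D2 where "D2 = d - r + q'"
    obtain b where b: "a = Suc b" using a(1) by (cases a) auto
    have r_eq: "r = a * q' + \<rho>" "r = b * q' + q' + \<rho>" using a(3) b by (simp_all add: \<rho>_def)
    have \<rho>: "\<rho> < q'" "(a + 1) * q' - r = q' - \<rho>" using a(3,4) by (simp_all add: \<rho>_def algebra_simps)
    have d_eq: "d = D + a * q'" "d = D2 + \<rho> + b * q'" "\<rho> \<le> D" "q' \<le> D2"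
      using d r_eq by (simp_all add: D_def D2_def)
    have "d < q" using d(2) q.q_pos by linarith
    \<comment> \<open>As q = p q', positions in the window have leading digits to base q' below
      p.\<close>
    hence dq: "d < CHAR('k) * q'" by (simp add: q_q' char)
    obtain \<sigma> :: "nat \<Rightarrow> nat" and g :: "nat \<Rightarrow> nat \<Rightarrow> 'k"
        and G :: "nat \<Rightarrow> basis list \<times> unit \<Rightarrow> 'k poly poly fract"
      where g0: "\<forall>A<\<rho>. has_ends \<rho> D A (\<sigma> A) (g A)" and \<sigma>: "inj_on \<sigma> {..<\<rho>}"
      and F: "frame (Fsheaf D \<rho> :: (basis list \<times> unit, 'k) esheaf) {..<\<rho>}
        (\<lambda>A. (int D - int A, int (\<sigma> A))) (\<lambda>A. int A - int (\<sigma> A)) G"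
      by (rule q'.Fsheaf_frame[of \<rho> D]) (use \<rho> d_eq in auto)
    obtain \<sigma>2 :: "nat \<Rightarrow> nat" and g2 :: "nat \<Rightarrow> nat \<Rightarrow> 'k"
        and G2 :: "nat \<Rightarrow> basis list \<times> unit \<Rightarrow> 'k poly poly fract"
      where g20: "\<forall>A<q' - \<rho>. has_ends (q' - \<rho>) D2 A (\<sigma>2 A) (g2 A)"
      and \<sigma>2: "inj_on \<sigma>2 {..<q' - \<rho>}"
      and F2: "frame (Fsheaf D2 (q' - \<rho>) :: (basis list \<times> unit, 'k) esheaf) {..<q' - \<rho>}
        (\<lambda>A. (int D2 - int A, int (\<sigma>2 A))) (\<lambda>A. int A - int (\<sigma>2 A)) G2"
      by (rule q'.Fsheaf_frame[of "q' - \<rho>" D2]) (use \<rho> d_eq in auto)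
    have g: "has_ends \<rho> D A (\<sigma> A) (g A)" if "A < \<rho>" for A using g0 that by blast
    have g2: "has_ends (q' - \<rho>) D2 A (\<sigma>2 A) (g2 A)" if "A < q' - \<rho>" for A using g20 that by blast
    have twist_H: "frobenius_twist q' (H c 0) =
        weight_rep {0..c} (\<lambda>i. (int q' * (int c - int i), int q' * int i))" for c
      by (simp add: frobenius_twist_def H_def weight_rep_def)
    \<comment> \<open>The copy with index \<open>m\<close> cuts off \<open>m\<close> digits at the
      start and the other \<open>a - m\<close>, or \<open>b - m\<close>, at the end;
      \<open>b = a - 1\<close> because one of the a roots goes into the affine factor. First
      positions with residue below \<rho> come from the left family, all others from the right
      one.\<close>
    let ?I = "{0..a} \<times> {..<\<rho>} <+> {0..b} \<times> {..<q' - \<rho>}"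
    let ?A = "case_sum (\<lambda>(m, A). A + m * q') (\<lambda>(m, A). A + \<rho> + m * q')"
    let ?B = "case_sum (\<lambda>(m, A). \<sigma> A + m * q') (\<lambda>(m, A). \<sigma>2 A + m * q')"
    have "(Fsheaf d r :: (basis list \<times> unit, 'k) esheaf) \<simeq>\<^sub>T
        frobenius_twist q' (H a 0) \<otimes>\<^sub>k Fsheaf D \<rho> \<oplus>\<^sub>T
        frobenius_twist q' (H b 0) \<otimes>\<^sub>k twist (Fsheaf D2 (q' - \<rho>)) (int \<rho>)"
      unfolding twist_H
    proof (rule q.Fsheaf_iso[OF frame_dsum[OF frame_weight_rep[OF F] frame_weight_rep[OF frame_twist[OF F2]]],
          where A = ?A and B = ?B])
      have "card ?I = Suc a * \<rho> + a * (q' - \<rho>)"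
        by (simp add: card_Plus card_cartesian_product b)
      also have "\<dots> = a * (\<rho> + (q' - \<rho>)) + \<rho>" by (simp add: algebra_simps)
      also have "\<dots> = r" using \<rho>(1) by (simp add: r_eq(1))
      finally show "card ?I \<le> r" by simp
      show "\<exists>g :: nat \<Rightarrow> 'k. has_ends r d (?A i) (?B i) g" if i: "i \<in> ?I" for i
      proof (cases i)
        case (Inl x)
        then obtain m A where x: "i = Inl (m, A)" "m \<le> a" "A < \<rho>" using i by (cases x) auto
        have "D + (m + (a - m)) * q' < CHAR('k) * q'" using x d_eq dq by simp
        from q'.has_ends_digits1[OF g[OF x(3)] _ this] \<rho> obtain g :: "nat \<Rightarrow> 'k"
          where "has_ends ((m + (a - m)) * q' + \<rho>) (D + (m + (a - m)) * q') (A + m * q') (\<sigma> A + m * q') g"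
          by auto
        thus ?thesis using x d_eq r_eq by auto
      next
        case (Inr x)
        then obtain m A where x: "i = Inr (m, A)" "m \<le> b" "A < q' - \<rho>" using i by (cases x) auto
        have "D2 + \<rho> + (m + (b - m)) * q' < CHAR('k) * q'" using x d_eq dq by simp
        from q'.has_ends_digits2[OF g2[OF x(3)] \<rho>(1) d_eq(4) this] obtain g :: "nat \<Rightarrow> 'k"
          where "has_ends ((m + (b - m) + 1) * q' + \<rho>) (D2 + \<rho> + (m + (b - m)) * q')
            (A + \<rho> + m * q') (\<sigma>2 A + m * q') g" .
        moreover have "(m + (b - m) + 1) * q' + \<rho> = r" using x(2) r_eq(2) by simp
        moreover have "D2 + \<rho> + (m + (b - m)) * q' = d" using x(2) d_eq(2) by simp
        ultimately have "has_ends r d (A + \<rho> + m * q') (\<sigma>2 A + m * q') g" by simp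
        thus ?thesis by (auto simp: x(1))
      qed
      show "{..<r} \<subseteq> ?A ` ?I"
      proof
        fix x assume x: "x \<in> {..<r}"
        have mod: "x mod q' < q'" using q'.q_pos by simp
        have x_eq: "x = x mod q' + x div q' * q'" by simp
        show "x \<in> ?A ` ?I"
        proof (cases "x mod q' < \<rho>")
          case True
          have "x < (a + 1) * q'" using x a(4) by simp
          hence "x div q' \<le> a" using q'.q_pos by (simp add: div_less_iff_less_mult flip: less_Suc_eq_le)
          thus ?thesis using True by (intro image_eqI[of _ _ "Inl (x div q', x mod q')"]) auto
        next
          case False
          have "x mod q' + x div q' * q' < b * q' + q' + \<rho>" using x r_eq(2) by simp
          with False have "x div q' * q' < b * q' + q'" by linarith
          also have "\<dots> = (b + 1) * q'" by simp
          finally have "x div q' < b + 1" using mult_less_cancel2 by blast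
          hence "x div q' \<le> b" by simp
          thus ?thesis using False mod
            by (intro image_eqI[of _ _ "Inr (x div q', x mod q' - \<rho>)"]) auto
        qed
      qed
      \<comment> \<open>The residue of \<open>d - B\<close> modulo q' separates the families: it is
        below \<rho> here and at least \<rho> in the other one. Within a family, quotient and
        residue recover \<open>m\<close> and, by injectivity of \<sigma> or
        \<open>\<sigma>2\<close>, also \<open>A\<close>.\<close>
      have left: "(d - (\<sigma> A + m * q')) div q' = a - m" "(d - (\<sigma> A + m * q')) mod q' = D - \<sigma> A"
        "D - \<sigma> A < \<rho>" "\<sigma> A \<le> D" if m: "m \<le> a" "A < \<rho>" for m A
      proof -
        show *: "\<sigma> A \<le> D" by (rule has_endsD(5)[OF g[OF that(2)]])
        have "D < \<sigma> A + \<rho>"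
          by (rule q'.has_ends_last_greater[OF g[OF that(2)]]) (use \<rho>(1) d_eq(3) in simp_all)
        with * show **: "D - \<sigma> A < \<rho>" by linarith
        obtain k where k: "a = m + k" using m(1) le_Suc_ex by blast
        have "d - (\<sigma> A + m * q') = (D - \<sigma> A) + k * q'"
          using * by (simp add: d_eq(1) k algebra_simps)
        thus "(d - (\<sigma> A + m * q')) div q' = a - m" "(d - (\<sigma> A + m * q')) mod q' = D - \<sigma> A"
          using ** \<rho>(1) k by simp_all
      qed
      have right: "(d - (\<sigma>2 A + m * q')) div q' = b - m"
        "(d - (\<sigma>2 A + m * q')) mod q' = D2 - \<sigma>2 A + \<rho>" "\<sigma>2 A \<le> D2"
        if m: "m \<le> b" "A < q' - \<rho>" for m A
      proof -
        show *: "\<sigma>2 A \<le> D2" by (rule has_endsD(5)[OF g2[OF that(2)]])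
        have "D2 < \<sigma>2 A + (q' - \<rho>)"
          by (rule q'.has_ends_last_greater[OF g2[OF that(2)]]) (use d_eq(4) in simp_all)
        with * \<rho>(1) have **: "D2 - \<sigma>2 A + \<rho> < q'" by linarith
        obtain k where k: "b = m + k" using m(1) le_Suc_ex by blast
        have "d - (\<sigma>2 A + m * q') = (D2 - \<sigma>2 A + \<rho>) + k * q'"
          using * by (simp add: d_eq(2) k algebra_simps)
        thus "(d - (\<sigma>2 A + m * q')) div q' = b - m"
          "(d - (\<sigma>2 A + m * q')) mod q' = D2 - \<sigma>2 A + \<rho>"
          using ** k by simp_all
      qed
      show "inj_on ?B ?I"
      proof (rule inj_onI)
        fix i j assume i: "i \<in> ?I" and j: "j \<in> ?I" and eq: "?B i = ?B j"
        consider (LL) m A m' A' where "i = Inl (m, A)" "j = Inl (m', A')"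
            "m \<le> a" "A < \<rho>" "m' \<le> a" "A' < \<rho>"
          | (LR) m A m' A' where "i = Inl (m, A)" "j = Inr (m', A')"
            "m \<le> a" "A < \<rho>" "m' \<le> b" "A' < q' - \<rho>"
          | (RL) m A m' A' where "i = Inr (m, A)" "j = Inl (m', A')"
            "m \<le> b" "A < q' - \<rho>" "m' \<le> a" "A' < \<rho>"
          | (RR) m A m' A' where "i = Inr (m, A)" "j = Inr (m', A')"
            "m \<le> b" "A < q' - \<rho>" "m' \<le> b" "A' < q' - \<rho>"
          using i j by auto
        thus "i = j"
        proof cases
          case LL
          hence e: "\<sigma> A + m * q' = \<sigma> A' + m' * q'" using eq by simp
          have "a - m = a - m'" "D - \<sigma> A = D - \<sigma> A'"
            using left[OF LL(3,4)] left[OF LL(5,6)] unfolding e by simp_all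
          with left(4)[OF LL(3,4)] left(4)[OF LL(5,6)] LL inj_onD[OF \<sigma>, of A A'] show ?thesis by simp
        next
          case LR
          hence e: "\<sigma> A + m * q' = \<sigma>2 A' + m' * q'" using eq by simp
          show ?thesis
            using left[OF LR(3,4)] right[OF LR(5,6)] unfolding e by simp
        next
          case RL
          hence e: "\<sigma>2 A + m * q' = \<sigma> A' + m' * q'" using eq by simp
          show ?thesis
            using right[OF RL(3,4)] left[OF RL(5,6)] unfolding e by simp
        next
          case RR
          hence e: "\<sigma>2 A + m * q' = \<sigma>2 A' + m' * q'" using eq by simp
          have "b - m = b - m'" "D2 - \<sigma>2 A = D2 - \<sigma>2 A'"
            using right(1,2)[OF RR(3,4)] right(1,2)[OF RR(5,6)] unfolding e by linarith+
          with right(3)[OF RR(3,4)] right(3)[OF RR(5,6)] RR inj_onD[OF \<sigma>2, of A A'] show ?thesis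
            by simp
        qed
      qed
    qed (use r d d_eq r_eq \<rho> b in \<open>auto simp: algebra_simps\<close>)
    moreover have "int r - int (a * q') = int \<rho>" "a - 1 = b"
      using a(3) b by (simp_all add: \<rho>_def of_nat_diff)
    ultimately show ?thesis by (simp only: \<rho>(2) flip: D_def D2_def \<rho>_def)
  qed
  show ?thesis using case1 case2 case3 case4 by blast
qed

end
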